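(* Let $r_{\mathcal{A}}$ be the general residual of a hyperplane arrangement $\mathcal{A}\subset\mathbb{P}^n$ with respect to a general linear form $\ell$. Set $I=r_{\mathcal{A}}\cap I_{\ell^\vee}$. Then: (a) There is a minimal generating set of $r_{\mathcal{A}}$ that contains $\frac{\partial f_{\mathcal{A}}}{\partial\ell}$, and $r_{\mathcal{A}}=(I,\frac{\partial f_{\mathcal{A}}}{\partial\ell})$. (b) The Hilbert function of $S/I$ is $$h_{S/I}(j)=\begin{cases}h_{S/r_{\mathcal{A}}}(j)&\text{if } j\le|\mathcal{A}|-2,\\ h_{S/r_{\mathcal{A}}}(j)+1&\text{if } j\ge|\mathcal{A}|-1.\end{cases}$$ (c) The Castelnuovo–Mumford regularity of $I$ is $\mathrm{reg}\, I=|\mathcal{A}|$.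
   Context: $K$ is a field of characteristic zero, $n\ge2$, $S=K[x_0,\dots,x_n]$ with the standard grading. A hyperplane arrangement $\mathcal{A}\subset\mathbb{P}^n$ is a finite nonempty set of distinct hyperplanes, and $f_{\mathcal{A}}$ is the product of linear forms defining them; $\mathrm{Jac}(f_{\mathcal{A}})$ is the ideal generated by its first partial derivatives. For a linear form $\ell=\sum a_ix_i$, put $\frac{\partial f}{\partial\ell}=\sum_i a_i\frac{\partial f}{\partial x_i}$ and $\ell^\vee=(a_0:\dots:a_n)\in\mathbb{P}^n$, with homogeneous ideal $I_{\ell^\vee}\subset S$. For a general $\ell$ (in a suitable nonempty Zariski-open subset of $[S]_1$ depending on $\mathcal{A}$), the general residual of $\mathcal{A}$ with respect to $\ell$ is $r_{\mathcal{A}}=(f_{\mathcal{A}},\frac{\partial f_{\mathcal{A}}}{\partial\ell}):\mathrm{Jac}(f_{\mathcal{A}})$. The Hilbert function is $h_M(j)=\dim_K[M]_j$. *)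

theory Defs
  imports Complex_Main "HOL-Library.Poly_Mapping" "HOL-Library.Cardinality"
begin

section \<open>The standard graded polynomial ring\<close>

text \<open>The variables are indexed by a finite type \<open>'v\<close>; for
  $S = K[x_0,\dots,x_n]$ that type has $n+1$ elements. A monomial is its exponent vector, and
  multiplication of polynomials is the convolution product of finitely supported functions.\<close>

type_synonym ('v, 'k) mpoly = "('v \<Rightarrow>\<^sub>0 nat) \<Rightarrow>\<^sub>0 'k"

definition mdeg :: "('v::finite \<Rightarrow>\<^sub>0 nat) \<Rightarrow> nat" where
  "mdeg m = (\<Sum>i\<in>UNIV. Poly_Mapping.lookup m i)"

text \<open>The graded piece $[S]_d$ (so the zero polynomial is homogeneous of every degree).\<close>

definition graded_piece :: "nat \<Rightarrow> ('v::finite, 'k::zero) mpoly set" where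
  "graded_piece d = {p. \<forall>m\<in>Poly_Mapping.keys p. mdeg m = d}"

definition const_poly :: "'k::zero \<Rightarrow> ('v, 'k) mpoly" where
  "const_poly c = Poly_Mapping.single 0 c"

definition linear_form :: "('v::finite \<Rightarrow> 'k::comm_monoid_add) \<Rightarrow> ('v, 'k) mpoly" where
  "linear_form a = (\<Sum>i\<in>UNIV. Poly_Mapping.single (Poly_Mapping.single i 1) (a i))"

definition eval_poly :: "('v::finite, 'k::comm_semiring_1) mpoly \<Rightarrow> ('v \<Rightarrow> 'k) \<Rightarrow> 'k" where
  "eval_poly p v =
     (\<Sum>m\<in>Poly_Mapping.keys p.
        Poly_Mapping.lookup p m * (\<Prod>i\<in>UNIV. v i ^ Poly_Mapping.lookup m i))"

text \<open>The exponent subtraction below is truncated, but it only truncates where the coefficient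
  vanishes.\<close>

definition partial_deriv :: "'v \<Rightarrow> ('v, 'k::comm_semiring_1) mpoly \<Rightarrow> ('v, 'k) mpoly" where
  "partial_deriv i p =
     (\<Sum>m\<in>Poly_Mapping.keys p.
        Poly_Mapping.single (m - Poly_Mapping.single i 1)
          (Poly_Mapping.lookup p m * of_nat (Poly_Mapping.lookup m i)))"

text \<open>$\partial f/\partial\ell$, where the linear form $\ell=\sum_i a_i x_i$ is given by its
  coefficient vector \<open>a\<close>.\<close>

definition deriv_along ::
  "('v::finite \<Rightarrow> 'k::comm_semiring_1) \<Rightarrow> ('v, 'k) mpoly \<Rightarrow> ('v, 'k) mpoly" where
  "deriv_along a f = (\<Sum>i\<in>UNIV. const_poly (a i) * partial_deriv i f)"

section \<open>Ideals\<close>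

text \<open>Ideals of a commutative ring are the submodules of the ring over itself.\<close>

definition ideal_gen :: "'r::comm_ring_1 set \<Rightarrow> 'r set" where
  "ideal_gen G = module.span (*) G"

definition colon :: "'r::comm_ring_1 set \<Rightarrow> 'r set \<Rightarrow> 'r set" where
  "colon I J = {g. \<forall>h\<in>J. g * h \<in> I}"

definition jacobian_ideal :: "('v::finite, 'k::comm_ring_1) mpoly \<Rightarrow> ('v, 'k) mpoly set" where
  "jacobian_ideal f = ideal_gen (range (\<lambda>i. partial_deriv i f))"

definition residual ::
  "('v::finite, 'k::comm_ring_1) mpoly \<Rightarrow> ('v \<Rightarrow> 'k) \<Rightarrow> ('v, 'k) mpoly set" where
  "residual f a = colon (ideal_gen {f, deriv_along a f}) (jacobian_ideal f)"

text \<open>The homogeneous ideal of the projective point with homogeneous coordinate vector \<open>a\<close>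
  (meaningful for nonzero \<open>a\<close>). For a linear form with coefficient vector \<open>a\<close>, this is the
  ideal of its dual point.\<close>

definition point_ideal :: "('v::finite \<Rightarrow> 'k::comm_ring_1) \<Rightarrow> ('v, 'k) mpoly set" where
  "point_ideal a = ideal_gen {g. (\<exists>d. g \<in> graded_piece d) \<and> eval_poly g a = 0}"

text \<open>Minimal generating sets of homogeneous ideals consist of homogeneous elements, as usual in
  the graded setting.\<close>

definition minimal_generating_set ::
  "('v::finite, 'k::comm_ring_1) mpoly set \<Rightarrow> ('v, 'k) mpoly set \<Rightarrow> bool" where
  "minimal_generating_set G I \<longleftrightarrow>
     (\<forall>g\<in>G. \<exists>d. g \<in> graded_piece d) \<and> ideal_gen G = I \<and> (\<forall>G'. G' \<subset> G \<longrightarrow> ideal_gen G' \<noteq> I)"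

section \<open>Hyperplane arrangements and general linear forms\<close>

text \<open>Hyperplanes of $\mathbb{P}^n$ are identified with the linear hyperplanes in $K^{n+1}$ that
  they are the projectivisations of.\<close>

definition hyperplane :: "('v::finite \<Rightarrow> 'k::field) \<Rightarrow> ('v \<Rightarrow> 'k) set" where
  "hyperplane c = {v. (\<Sum>i\<in>UNIV. c i * v i) = 0}"

definition hyperplane_arrangement :: "('v::finite \<Rightarrow> 'k::field) set set \<Rightarrow> bool" where
  "hyperplane_arrangement A \<longleftrightarrow>
     finite A \<and> A \<noteq> {} \<and> (\<forall>H\<in>A. \<exists>c. c \<noteq> (\<lambda>_. 0) \<and> H = hyperplane c)"

text \<open>\<open>L H\<close> is the coefficient vector of a linear form defining \<open>H\<close>; it is determined by \<open>H\<close> up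
  to a nonzero scalar.\<close>

definition defining_forms ::
  "('v::finite \<Rightarrow> 'k::field) set set \<Rightarrow> (('v \<Rightarrow> 'k) set \<Rightarrow> 'v \<Rightarrow> 'k) \<Rightarrow> bool" where
  "defining_forms A L \<longleftrightarrow> (\<forall>H\<in>A. L H \<noteq> (\<lambda>_. 0) \<and> H = hyperplane (L H))"

definition arrangement_poly ::
  "('v::finite \<Rightarrow> 'k::field) set set \<Rightarrow> (('v \<Rightarrow> 'k) set \<Rightarrow> 'v \<Rightarrow> 'k) \<Rightarrow> ('v, 'k) mpoly" where
  "arrangement_poly A L = (\<Prod>H\<in>A. linear_form (L H))"

definition zariski_open :: "('v::finite \<Rightarrow> 'k::field) set \<Rightarrow> bool" where
  "zariski_open U \<longleftrightarrow> (\<exists>P :: ('v, 'k) mpoly set. U = {a. \<exists>p\<in>P. eval_poly p a \<noteq> 0})"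

section \<open>Hilbert function\<close>

text \<open>\<open>quotient_basis I j B\<close>: the residue classes of the elements of \<open>B\<close> are pairwise distinct and
  form a \<open>K\<close>-basis of $[S/I]_j = [S]_j/(I \cap [S]_j)$.\<close>

definition quotient_basis ::
  "('v::finite, 'k::field) mpoly set \<Rightarrow> nat \<Rightarrow> ('v, 'k) mpoly set \<Rightarrow> bool" where
  "quotient_basis I j B \<longleftrightarrow>
     finite B \<and> B \<subseteq> graded_piece j \<and>
     (\<forall>p\<in>graded_piece j. \<exists>!c. (\<forall>b. b \<notin> B \<longrightarrow> c b = 0) \<and>
        p - (\<Sum>b\<in>B. const_poly (c b) * b) \<in> I)"

text \<open>The Hilbert function of $S/I$, as a function of the ideal \<open>I\<close>.\<close>

definition hilbert_function :: "('v::finite, 'k::field) mpoly set \<Rightarrow> nat \<Rightarrow> nat" where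
  "hilbert_function I j = card (SOME B. quotient_basis I j B)"

section \<open>Castelnuovo-Mumford regularity\<close>

text \<open>Elements of the free module $S^r$.\<close>

definition free_mod :: "nat \<Rightarrow> (nat \<Rightarrow> 'r::zero) set" where
  "free_mod r = {v. \<forall>j\<ge>r. v j = 0}"

text \<open>The map $S^c \to S^r$ given by an $r \times c$ matrix.\<close>

definition mat_apply ::
  "nat \<Rightarrow> nat \<Rightarrow> (nat \<Rightarrow> nat \<Rightarrow> 'r::comm_semiring_0) \<Rightarrow> (nat \<Rightarrow> 'r) \<Rightarrow> nat \<Rightarrow> 'r" where
  "mat_apply r c M v = (\<lambda>j. if j < r then \<Sum>k<c. M j k * v k else 0)"

text \<open>A minimal graded free resolution $\cdots \to F_1 \to F_0 \to I \to 0$ with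
  $F_i = \bigoplus_{j < b_i} S(-a_{ij})$: the augmentation $F_0 \to I$ sends the \<open>j\<close>-th basis
  vector to \<open>g j\<close>, and \<open>M i\<close> is the matrix of $F_{i+1} \to F_i$. The first two conditions say
  that these maps are homogeneous of degree 0, the next three are exactness, and the last one is
  minimality, i.e. the matrix entries lie in the maximal ideal $(x_0,\dots,x_n)$.\<close>

definition minimal_graded_free_resolution ::
  "('v::finite, 'k::field) mpoly set \<Rightarrow> (nat \<Rightarrow> nat) \<Rightarrow> (nat \<Rightarrow> nat \<Rightarrow> int) \<Rightarrow>
   (nat \<Rightarrow> ('v, 'k) mpoly) \<Rightarrow> (nat \<Rightarrow> nat \<Rightarrow> nat \<Rightarrow> ('v, 'k) mpoly) \<Rightarrow> bool" where
  "minimal_graded_free_resolution I b a g M \<longleftrightarrow>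
     (\<forall>j<b 0. \<forall>m\<in>Poly_Mapping.keys (g j). int (mdeg m) = a 0 j) \<and>
     (\<forall>i. \<forall>j<b i. \<forall>k<b (Suc i). \<forall>m\<in>Poly_Mapping.keys (M i j k).
        a i j + int (mdeg m) = a (Suc i) k) \<and>
     (\<lambda>v. \<Sum>j<b 0. g j * v j) ` free_mod (b 0) = I \<and>
     {v \<in> free_mod (b 0). (\<Sum>j<b 0. g j * v j) = 0} =
       mat_apply (b 0) (b 1) (M 0) ` free_mod (b 1) \<and>
     (\<forall>i. {v \<in> free_mod (b (Suc i)). mat_apply (b i) (b (Suc i)) (M i) v = (\<lambda>_. 0)} =
       mat_apply (b (Suc i)) (b (Suc (Suc i))) (M (Suc i)) ` free_mod (b (Suc (Suc i)))) \<and>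
     (\<forall>i. \<forall>j<b i. \<forall>k<b (Suc i). Poly_Mapping.lookup (M i j k) 0 = 0)"

text \<open>\<open>has_regularity I r\<close>: $\mathrm{reg}\, I = r$, where
  $\mathrm{reg}\, I = \max_{i,j} (a_{ij} - i)$ for the shifts $a_{ij}$ of the minimal graded free
  resolution of \<open>I\<close>. Since that resolution is unique up to isomorphism, the shifts, and hence
  \<open>r\<close>, do not depend on the one chosen.\<close>

definition has_regularity :: "('v::finite, 'k::field) mpoly set \<Rightarrow> int \<Rightarrow> bool" where
  "has_regularity I r \<longleftrightarrow>
     (\<exists>b a g M. minimal_graded_free_resolution I b a g M \<and>
        (\<exists>i j. j < b i \<and> a i j - int i = r) \<and>
        (\<forall>i j. j < b i \<longrightarrow> a i j - int i \<le> r))"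

end

theory Submission
  imports Defs "HOL-Library.Function_Algebras" "HOL-Library.FuncSet"
begin

text \<open>Write \<open>f\<close> for the defining polynomial, \<open>d\<close> for its degree and \<open>a\<close> for the dual point of \<open>\<ell>\<close>,
  where it suffices that \<open>f a \<noteq> 0\<close>. On a hyperplane \<open>H\<close> all partial derivatives of \<open>f\<close> are proportional
  to the coefficients of the form \<open>L\<^sub>H\<close>. Hence \<open>g\<close> lies in the residual iff for every \<open>i\<close> there is \<open>\<beta>\<close> such
  that \<open>L\<^sub>H\<close> divides \<open>L\<^sub>H(e\<^sub>i) g - L\<^sub>H(a) \<beta>\<close> for all \<open>H\<close>. This description makes sense for every
  subarrangement and satisfies \<open>L\<^sub>H R(B - H) \<subseteq> R(B) \<subseteq> R(B - H)\<close>, so induction on the arrangement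
  (the approximation technique of Derksen and Sidman) bounds the regularity of the residual by
  \<open>d - 1\<close>, in terms of a flag of linear forms in general position, as in the criterion of Bayer and
  Stillman. Elements of the residual of degree less than \<open>d - 1\<close> vanish at \<open>a\<close> by Euler's formula,
  while \<open>\<partial>f/\<partial>\<ell>\<close> does not. This gives the first two claims, and the bound \<open>d\<close> for the regularity of
  \<open>I\<close>. The bound is attained: modulo the first form of the flag, \<open>\<partial>f/\<partial>\<ell>\<close> is a socle element of
  \<open>S/I\<close> of degree \<open>d - 1\<close>, and it induces socle elements of the successive syzygy modules, the last
  of which forces a generator.\<close>


section \<open>Polynomials\<close>

text \<open>Apart from the deletion argument, every nonzerodivisor statement comes from one
  observation in characteristic zero: if an ideal is stable under the derivative along
  \<open>w\<close> and a form takes the value 1 at \<open>w\<close>, the form can be cancelled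
  modulo the ideal. General position is therefore always expressed by the existence of such vectors
  \<open>w\<close>. Regularity is defined through a minimal resolution, so the degree bounds along
  the flag have to be carried through all syzygies. They are read as a vanishing of Tor, whose bound
  rises by one with each syzygy module, as the normalisation \<open>a i j - i\<close> requires.
  Sharpness travels the same way: each syzygy module spends one more form of the flag and one more
  degree. The ideal starts with two forms, so after \<open>CARD('v) - 2\<close> steps the flag is
  used up and the socle element lies outside the maximal ideal times the module. The assumption
  \<open>n \<ge> 2\<close> makes two hyperplane forms and the first flag form independent. Hence
  that form is a nonzerodivisor modulo the residual in every degree, not only in large ones, and
  this keeps the derivative along the general form outside \<open>I\<close> modulo the first flag
  form.\<close>

lemma mpoly_induct [case_names single add]:
  assumes single: "\<And>m c. P (Poly_Mapping.single m c)"
    and add: "\<And>p q. P p \<Longrightarrow> P q \<Longrightarrow> P (p + q)"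
  shows "P (p :: 'a \<Rightarrow>\<^sub>0 'k::comm_monoid_add)"
proof (induction p rule: Poly_Mapping.update_induct)
  case const
  show ?case using single[of undefined 0] by simp
next
  case (update p m c)
  have "Poly_Mapping.update m c p = p + Poly_Mapping.single m c"
    using update by (intro poly_mapping_eqI) 
      (auto simp: lookup_update lookup_add lookup_single when_def in_keys_iff)
  then show ?case using update add single by metis
qed

lemma mpoly_sum_singles:
  "p = (\<Sum>m\<in>Poly_Mapping.keys p. Poly_Mapping.single m (Poly_Mapping.lookup p m))"
  by (intro poly_mapping_eqI)
    (simp add: lookup_sum lookup_single when_def sum.delta in_keys_iff)

lemma const_poly_0 [simp]: "const_poly 0 = 0"
  by (simp add: const_poly_def)

lemma const_poly_1 [simp]: "const_poly 1 = 1"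
  by (simp add: const_poly_def)

lemma const_poly_add: "const_poly (a + b) = const_poly a + const_poly b"
  by (simp add: const_poly_def single_add)

lemma const_poly_diff: "const_poly (a - b) = const_poly a - const_poly (b::'k::ab_group_add)"
  by (simp add: const_poly_def single_diff)

lemma const_poly_uminus: "const_poly (- b) = - const_poly (b::'k::ab_group_add)"
  by (simp add: const_poly_def single_uminus)

lemma const_poly_mult: "const_poly (a * b) = const_poly a * const_poly (b::'k::semiring_0)"
  by (simp add: const_poly_def mult_single)

lemma const_poly_sum: "const_poly (sum f X) = (\<Sum>x\<in>X. const_poly (f x))"
  by (induction X rule: infinite_finite_induct) (auto simp: const_poly_add)

lemma const_poly_of_nat: "const_poly (of_nat n) = of_nat n"
  by (simp add: const_poly_def)

lemma const_poly_inverse_cancel: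
  "c \<noteq> 0 \<Longrightarrow> const_poly (inverse c) * (const_poly c * p) = p" for c :: "'k::field"
  by (simp add: mult.assoc[symmetric] const_poly_mult[symmetric])

lemma const_poly_mult_single:
  "const_poly (a::'k::semiring_0) * Poly_Mapping.single m c = Poly_Mapping.single m (a * c)"
  by (simp add: const_poly_def mult_single)

lemma lookup_const_mult [simp]:
  "Poly_Mapping.lookup (const_poly a * p) m = a * Poly_Mapping.lookup p m"
  for a :: "'k::semiring_0"
  by (induction p rule: mpoly_induct)
    (simp_all add: const_poly_mult_single lookup_single when_def lookup_add algebra_simps)

subsection \<open>Partial derivatives\<close>

lemma partial_deriv_single:
  "partial_deriv i (Poly_Mapping.single m c) =
    Poly_Mapping.single (m - Poly_Mapping.single i 1) (c * of_nat (Poly_Mapping.lookup m i))"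
  by (cases "c = 0") (simp_all add: partial_deriv_def)

lemma partial_deriv_0 [simp]: "partial_deriv i 0 = 0"
  by (simp add: partial_deriv_def)

lemma partial_deriv_add: "partial_deriv i (p + q) = partial_deriv i p + partial_deriv i q"
  unfolding partial_deriv_def
  by (rule setsum_keys_plus_distrib) (simp_all add: algebra_simps single_add)

lemma partial_deriv_mult:
  "partial_deriv i (p * q) = partial_deriv i p * q + p * partial_deriv i q"
proof (induction p rule: mpoly_induct)
  case (single m c)
  show ?case
  proof (induction q rule: mpoly_induct)
    case (single m' c')
    let ?e = "Poly_Mapping.single i (1::nat)"
    \<comment> \<open>Truncated subtraction is exact only if the variable \<open>i\<close> occurs in
      \<open>m\<close>; otherwise the factor \<open>lookup m i\<close> makes the whole term zero,
      which gives 2.\<close>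
    have 1: "m - ?e + m' = m + m' - ?e" if "Poly_Mapping.lookup m i \<noteq> 0" for m m'
      using that by (intro poly_mapping_eqI)
        (auto simp: lookup_add lookup_minus lookup_single when_def)
    have 2: "Poly_Mapping.single (m - ?e + m') (of_nat (Poly_Mapping.lookup m i) * c'') =
        Poly_Mapping.single (m + m' - ?e) (of_nat (Poly_Mapping.lookup m i) * c'')"
      for m m' and c'' :: 'b
      using 1[of m m'] by (cases "Poly_Mapping.lookup m i = 0") simp_all
    show ?case
      using 2[of m m' "c * c'"] 2[of m' m "c * c'"]
      by (simp add: partial_deriv_single mult_single lookup_add algebra_simps single_add)
  next
    case (add p q)
    then show ?case by (simp add: partial_deriv_add algebra_simps)
  qed
next
  case (add p q)
  then show ?case by (simp add: partial_deriv_add algebra_simps)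
qed

lemma deriv_along_add: "deriv_along a (p + q) = deriv_along a p + deriv_along a q"
  by (simp add: deriv_along_def partial_deriv_add algebra_simps sum.distrib)

lemma deriv_along_0 [simp]: "deriv_along a 0 = 0"
  by (simp add: deriv_along_def partial_deriv_def)

lemma deriv_along_mult:
  "deriv_along a (p * q) = deriv_along a p * q + p * deriv_along a q"
  unfolding deriv_along_def sum_distrib_left sum_distrib_right sum.distrib[symmetric]
  by (rule sum.cong) (auto simp: partial_deriv_mult algebra_simps)

lemma deriv_along_diff: "deriv_along a (p - q) = deriv_along a p - deriv_along a q"
  for p q :: "('v::finite, 'k::comm_ring_1) mpoly"
  using deriv_along_add[of a "p - q" q] by (simp add: algebra_simps)

lemma deriv_along_const [simp]: "deriv_along a (const_poly c) = 0"
  by (simp add: deriv_along_def const_poly_def partial_deriv_single)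

lemma deriv_along_linear_form:
  "deriv_along a (linear_form c) = const_poly (\<Sum>i\<in>UNIV. c i * a i)"
proof -
  have 1: "partial_deriv i (sum f X) = (\<Sum>x\<in>X. partial_deriv i (f x))"
    if "finite X" for i :: 'a and f :: "'c \<Rightarrow> ('a, 'b) mpoly" and X
    using that by (induction X) (auto simp: partial_deriv_add)
  have "partial_deriv i (linear_form c) = const_poly (c i)" for i
    unfolding linear_form_def
    by (subst 1) (auto simp: partial_deriv_single lookup_single when_def const_poly_def
        if_distrib[of "\<lambda>t. _ * of_nat t"] if_distrib[of "\<lambda>t. Poly_Mapping.single _ t"]
        cong: if_cong)
  then show ?thesis
    by (simp add: deriv_along_def const_poly_sum const_poly_mult mult.commute)
qed

lemma deriv_along_prod:
  assumes "finite X"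
  shows "deriv_along a (prod g X) = (\<Sum>x\<in>X. deriv_along a (g x) * prod g (X - {x}))"
  using assms
proof induction
  case empty
  show ?case using deriv_along_const[of a 1] by simp
next
  case (insert y X)
  have "(\<Sum>x\<in>X. deriv_along a (g x) * prod g (insert y X - {x})) =
      (\<Sum>x\<in>X. g y * (deriv_along a (g x) * prod g (X - {x})))"
  proof (rule sum.cong)
    fix x assume "x \<in> X"
    then have "insert y X - {x} = insert y (X - {x})" using insert by auto
    then show "deriv_along a (g x) * prod g (insert y X - {x}) =
        g y * (deriv_along a (g x) * prod g (X - {x}))"
      using insert by (simp add: algebra_simps)
  qed simp
  with insert show ?case by (simp add: deriv_along_mult sum_distrib_left)
qed

lemma deriv_along_unit: "deriv_along (\<lambda>j. if j = i then 1 else 0) p = partial_deriv i p"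
  by (simp add: deriv_along_def if_distrib[of const_poly] if_distrib[of "\<lambda>t. t * _"] 
      cong: if_cong)

subsection \<open>Evaluation\<close>

lemma eval_poly_single:
  "eval_poly (Poly_Mapping.single m c) v = c * (\<Prod>i\<in>UNIV. v i ^ Poly_Mapping.lookup m i)"
  by (cases "c = 0") (simp_all add: eval_poly_def)

lemma eval_poly_add: "eval_poly (p + q) v = eval_poly p v + eval_poly q v"
  unfolding eval_poly_def
  by (rule setsum_keys_plus_distrib) (simp_all add: algebra_simps)

lemma eval_poly_0 [simp]: "eval_poly 0 v = 0"
  by (simp add: eval_poly_def)

lemma eval_poly_mult: "eval_poly (p * q) v = eval_poly p v * eval_poly q v"
proof (induction p rule: mpoly_induct)
  case (single m c)
  show ?case
  proof (induction q rule: mpoly_induct)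
    case (single m' c')
    show ?case
      by (simp add: eval_poly_single mult_single lookup_add power_add prod.distrib algebra_simps)
  qed (simp add: eval_poly_add algebra_simps)
qed (simp add: eval_poly_add algebra_simps)

lemma eval_poly_diff: "eval_poly (p - q) v = eval_poly p v - eval_poly q v"
  for p q :: "('v::finite, 'k::comm_ring_1) mpoly"
  using eval_poly_add[of "p - q" q] by (simp add: algebra_simps)

lemma eval_poly_sum: "eval_poly (sum f X) v = (\<Sum>x\<in>X. eval_poly (f x) v)"
  by (induction X rule: infinite_finite_induct) (auto simp: eval_poly_add)

lemma eval_poly_const [simp]: "eval_poly (const_poly c) v = c"
  by (simp add: const_poly_def eval_poly_single)

lemma eval_poly_prod: "eval_poly (prod f X) v = (\<Prod>x\<in>X. eval_poly (f x) v)"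
  using eval_poly_const[of 1 v]
  by (induction X rule: infinite_finite_induct) (auto simp: eval_poly_mult)

lemma eval_poly_power: "eval_poly (p ^ k) v = eval_poly p v ^ k"
  using eval_poly_const[of 1 v] by (induction k) (auto simp: eval_poly_mult)

lemma eval_linear_form: "eval_poly (linear_form c) v = (\<Sum>i\<in>UNIV. c i * v i)"
proof -
  have "(\<Prod>j\<in>UNIV. v j ^ (1 when i = j)) = v i" for i
    by (simp add: when_def if_distrib[of "\<lambda>t. _ ^ t"] prod.delta' cong: if_cong)
  then show ?thesis
    by (simp add: linear_form_def eval_poly_sum eval_poly_single lookup_single)
qed

subsection \<open>Linear forms\<close>

lemma linear_form_add: "linear_form (\<lambda>i. c i + d i) = linear_form c + linear_form d"
  by (simp add: linear_form_def single_add sum.distrib)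

lemma linear_form_diff:
  "linear_form (\<lambda>i. c i - d i) = linear_form c - linear_form (d :: 'v::finite \<Rightarrow> 'k::ab_group_add)"
  by (simp add: linear_form_def single_diff sum_subtractf)

lemma linear_form_scale:
  "linear_form (\<lambda>i. t * c i) = const_poly t * linear_form (c :: 'v::finite \<Rightarrow> 'k::semiring_0)"
  by (simp add: linear_form_def sum_distrib_left const_poly_mult_single)

lemma linear_form_0 [simp]: "linear_form (\<lambda>_. 0) = 0"
  by (simp add: linear_form_def)

lemma linear_form_unit:
  "linear_form (\<lambda>j. if j = i then 1 else 0) = Poly_Mapping.single (Poly_Mapping.single i 1) 1"
proof -
  have "Poly_Mapping.single m (if j = i then 1 else 0 :: 'b) =
      (if j = i then Poly_Mapping.single m 1 else 0)" for m :: "'a \<Rightarrow>\<^sub>0 nat" and j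
    by simp
  then show ?thesis
    by (simp add: linear_form_def)
qed

subsection \<open>The grading\<close>

lemma mdeg_0 [simp]: "mdeg 0 = 0"
  by (simp add: mdeg_def)

lemma mdeg_add: "mdeg (m + m') = mdeg m + mdeg m'"
  by (simp add: mdeg_def lookup_add sum.distrib)

lemma mdeg_single [simp]: "mdeg (Poly_Mapping.single i k) = k"
  by (simp add: mdeg_def lookup_single when_def)

lemma mdeg_eq_0 [simp]: "mdeg m = 0 \<longleftrightarrow> m = 0"
proof
  assume "mdeg m = 0"
  then show "m = 0"
    by (intro poly_mapping_eqI) (simp add: mdeg_def)
qed simp

lemma lookup_le_mdeg: "Poly_Mapping.lookup m i \<le> mdeg m"
  unfolding mdeg_def by (rule member_le_sum) auto

lemma finite_mdeg: "finite {m :: 'v::finite \<Rightarrow>\<^sub>0 nat. mdeg m = k}" (is "finite ?M")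
proof (rule finite_imageD)
  have "Poly_Mapping.lookup m \<in> PiE UNIV (\<lambda>_. {..k})" if "m \<in> ?M" for m
  proof (rule PiE_I)
    show "Poly_Mapping.lookup m i \<in> {..k}" for i
      using that lookup_le_mdeg[of m i] by simp
  qed simp
  then have "Poly_Mapping.lookup ` ?M \<subseteq> PiE UNIV (\<lambda>_. {..k})"
    by (rule image_subsetI)
  then show "finite (Poly_Mapping.lookup ` ?M)"
    by (rule finite_subset) (rule finite_PiE, simp_all)
  show "inj_on Poly_Mapping.lookup ?M"
    by (rule inj_onI) (simp only: poly_mapping_eq_iff)
qed

definition hcomp :: "nat \<Rightarrow> ('v::finite, 'k::zero) mpoly \<Rightarrow> ('v, 'k) mpoly" where
  "hcomp k p = Poly_Mapping.mapp (\<lambda>m c. c when mdeg m = k) p"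

lemma lookup_hcomp: "Poly_Mapping.lookup (hcomp k p) m = (Poly_Mapping.lookup p m when mdeg m = k)"
  by (auto simp: hcomp_def lookup_mapp when_def in_keys_iff)

lemma hcomp_0 [simp]: "hcomp k 0 = 0"
  by (intro poly_mapping_eqI) (simp add: lookup_hcomp)

lemma hcomp_add: "hcomp k (p + q) = hcomp k p + hcomp k q"
  by (intro poly_mapping_eqI) (simp add: lookup_hcomp lookup_add when_add_distrib)

lemma hcomp_diff: "hcomp k (p - q) = hcomp k p - hcomp k q"
  for p q :: "('v::finite, 'k::ab_group_add) mpoly"
  by (intro poly_mapping_eqI) (simp add: lookup_hcomp lookup_minus when_diff_distrib)

lemma hcomp_sum: "hcomp k (sum f X) = (\<Sum>x\<in>X. hcomp k (f x))"
  by (induction X rule: infinite_finite_induct) (auto simp: hcomp_add)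

lemma hcomp_single:
  "hcomp k (Poly_Mapping.single m c) = (if mdeg m = k then Poly_Mapping.single m c else 0)"
  by (intro poly_mapping_eqI) (auto simp: lookup_hcomp lookup_single when_def)

lemma hcomp_in_graded [simp]: "hcomp k p \<in> graded_piece k"
  by (auto simp: graded_piece_def in_keys_iff lookup_hcomp)

lemma graded_lookup:
  "p \<in> graded_piece k \<longleftrightarrow> (\<forall>m. mdeg m \<noteq> k \<longrightarrow> Poly_Mapping.lookup p m = 0)"
  by (auto simp: graded_piece_def in_keys_iff)

lemma hcomp_graded: "p \<in> graded_piece k \<Longrightarrow> hcomp j p = (if j = k then p else 0)"
  by (intro poly_mapping_eqI) (auto simp: lookup_hcomp graded_lookup when_def)

lemma hcomp_mult_graded:
  assumes "q \<in> graded_piece e"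
  shows "hcomp j (q * p) = (if e \<le> j then q * hcomp (j - e) p else 0)"
proof -
  have 1: "hcomp j (Poly_Mapping.single m c * p) =
      (if e \<le> j then Poly_Mapping.single m c * hcomp (j - e) p else 0)" if "mdeg m = e" for m c
  proof (induction p rule: mpoly_induct)
    case (single m' c')
    show ?case using that by (auto simp: mult_single hcomp_single mdeg_add)
  qed (simp add: hcomp_add algebra_simps)
  let ?s = "\<lambda>m. Poly_Mapping.single m (Poly_Mapping.lookup q m)"
  have q: "(\<Sum>m\<in>Poly_Mapping.keys q. ?s m) = q"
    by (rule mpoly_sum_singles[symmetric])
  have "hcomp j (q * p) = hcomp j ((\<Sum>m\<in>Poly_Mapping.keys q. ?s m) * p)"
    by (simp only: q)
  also have "\<dots> = (\<Sum>m\<in>Poly_Mapping.keys q. hcomp j (?s m * p))"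
    by (simp only: sum_distrib_right hcomp_sum)
  also have "\<dots> = (\<Sum>m\<in>Poly_Mapping.keys q. if e \<le> j then ?s m * hcomp (j - e) p else 0)"
    using assms by (intro sum.cong 1) (auto simp: graded_piece_def)
  also have "\<dots> = (if e \<le> j then (\<Sum>m\<in>Poly_Mapping.keys q. ?s m) * hcomp (j - e) p else 0)"
    by (simp add: sum_distrib_right)
  finally show ?thesis
    by (simp only: q)
qed

lemma graded_0 [simp]: "0 \<in> graded_piece k"
  by (simp add: graded_piece_def)

lemma graded_add: "p \<in> graded_piece k \<Longrightarrow> q \<in> graded_piece k \<Longrightarrow> p + q \<in> graded_piece k"
  by (simp add: graded_lookup lookup_add)

lemma graded_diff: "p \<in> graded_piece k \<Longrightarrow> q \<in> graded_piece k \<Longrightarrow> p - q \<in> graded_piece k"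
  for p q :: "('v::finite, 'k::ab_group_add) mpoly"
  by (simp add: graded_lookup lookup_minus)

lemma graded_sum: "(\<And>x. x \<in> X \<Longrightarrow> f x \<in> graded_piece k) \<Longrightarrow> sum f X \<in> graded_piece k"
  by (induction X rule: infinite_finite_induct) (auto simp: graded_add)

lemma graded_mult:
  "p \<in> graded_piece j \<Longrightarrow> q \<in> graded_piece k \<Longrightarrow> p * q \<in> graded_piece (j + k)"
  using hcomp_mult_graded[of p j "j + k" q] hcomp_graded[of q k k] hcomp_in_graded[of "j + k" "p * q"]
  by simp

lemma const_in_graded [simp]: "const_poly c \<in> graded_piece 0"
  by (auto simp: graded_piece_def const_poly_def)

lemma one_in_graded [simp]: "1 \<in> graded_piece 0"
  by (auto simp: graded_piece_def)

lemma graded_const_mult: "p \<in> graded_piece k \<Longrightarrow> const_poly c * p \<in> graded_piece k"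
  for p :: "('v::finite, 'k::semiring_0) mpoly"
  by (simp add: graded_lookup)

lemma hcomp_const_mult: "hcomp k (const_poly c * p) = const_poly c * hcomp k p"
  for p :: "('v::finite, 'k::semiring_0) mpoly"
  by (intro poly_mapping_eqI) (auto simp: lookup_hcomp when_def)

lemma linear_form_in_graded [simp]: "linear_form c \<in> graded_piece 1"
  unfolding linear_form_def by (rule graded_sum) (auto simp: graded_piece_def)

lemma graded_prod:
  "(\<And>x. x \<in> X \<Longrightarrow> f x \<in> graded_piece 1) \<Longrightarrow> finite X \<Longrightarrow> prod f X \<in> graded_piece (card X)"
proof (induction X rule: infinite_finite_induct)
  case (insert x F)
  then show ?case using graded_mult[of "f x" 1 "prod f F" "card F"] by simp
qed auto

lemma graded_power: "p \<in> graded_piece 1 \<Longrightarrow> p ^ k \<in> graded_piece k"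
  by (induction k) (use graded_mult[of p 1] in auto)

lemma partial_deriv_graded:
  assumes "p \<in> graded_piece k" shows "partial_deriv i p \<in> graded_piece (k - 1)"
  unfolding partial_deriv_def
proof (rule graded_sum)
  fix m assume m: "m \<in> Poly_Mapping.keys p"
  let ?e = "Poly_Mapping.single i (1::nat)"
  show "Poly_Mapping.single (m - ?e) (Poly_Mapping.lookup p m * of_nat (Poly_Mapping.lookup m i))
      \<in> graded_piece (k - 1)"
  proof (cases "Poly_Mapping.lookup m i = 0")
    case False
    then have "m = m - ?e + ?e"
      by (intro poly_mapping_eqI) (auto simp: lookup_add lookup_minus lookup_single when_def)
    then have "mdeg m = mdeg (m - ?e) + 1"
      using mdeg_add[of "m - ?e" ?e] by simp
    then show ?thesis using assms m by (auto simp: graded_piece_def)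
  qed simp
qed

lemma deriv_along_graded:
  "p \<in> graded_piece k \<Longrightarrow> deriv_along a p \<in> graded_piece (k - 1)"
  unfolding deriv_along_def
  by (intro graded_sum graded_const_mult partial_deriv_graded)

lemma mpoly_eq_sum_hcomp:
  obtains K where "\<And>k. k > K \<Longrightarrow> hcomp k p = 0" "p = (\<Sum>k\<le>K. hcomp k p)"
proof
  define K where "K = Max (insert 0 (mdeg ` Poly_Mapping.keys p))"
  have K: "mdeg m \<le> K" if "Poly_Mapping.lookup p m \<noteq> 0" for m
    unfolding K_def using that by (intro Max_ge) (auto simp: in_keys_iff)
  show "hcomp k p = 0" if "k > K" for k
  proof (rule poly_mapping_eqI)
    show "Poly_Mapping.lookup (hcomp k p) m = Poly_Mapping.lookup 0 m" for m
      using K[of m] that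
      by (cases "Poly_Mapping.lookup p m = 0") (auto simp: lookup_hcomp)
  qed
  show "p = (\<Sum>k\<le>K. hcomp k p)"
  proof (rule poly_mapping_eqI)
    show "Poly_Mapping.lookup p m = Poly_Mapping.lookup (\<Sum>k\<le>K. hcomp k p) m" for m
      using K[of m]
      by (cases "Poly_Mapping.lookup p m = 0") (auto simp: lookup_sum lookup_hcomp when_def)
  qed
qed

lemma hcomp_eqI:
  assumes "\<And>k. hcomp k p = hcomp k q"
  shows "p = q"
proof (rule poly_mapping_eqI)
  show "Poly_Mapping.lookup p m = Poly_Mapping.lookup q m" for m
    using arg_cong[OF assms[of "mdeg m"], of "\<lambda>p. Poly_Mapping.lookup p m"]
    by (simp add: lookup_hcomp)
qed

text \<open>A derivative lowers the degree, so a homogeneous polynomial of degree k dies after k + 1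
  steps, and a polynomial has finitely many components. This starts the downward induction by which
  linear forms are cancelled.\<close>

lemma deriv_along_nilpotent:
  obtains K where "(deriv_along a ^^ K) p = 0"
proof -
  have 1: "p \<in> graded_piece k \<Longrightarrow> (deriv_along a ^^ Suc k) p = 0" for k and p :: "('a,'b) mpoly"
  proof (induction k arbitrary: p)
    case 0
    then have "p = const_poly (Poly_Mapping.lookup p 0)"
      by (intro poly_mapping_eqI) (auto simp: graded_lookup const_poly_def lookup_single when_def)
    then show ?case using deriv_along_const[of a] by (metis funpow_0 funpow.simps(2) o_apply)
  next
    case (Suc k)
    then show ?case
      using Suc.IH[OF deriv_along_graded[OF Suc.prems, simplified]]
      by (simp add: funpow_swap1)
  qed
  have add: "(deriv_along a ^^ k) (p + q) = (deriv_along a ^^ k) p + (deriv_along a ^^ k) q"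
    for k and p q :: "('a,'b) mpoly"
    by (induction k) (auto simp: deriv_along_add)
  have zero: "(deriv_along a ^^ k) (0 :: ('a,'b) mpoly) = 0" for k
    by (induction k) auto
  have mono: "(deriv_along a ^^ k) p = 0 \<Longrightarrow> (deriv_along a ^^ (j + k)) p = 0"
    for j k and p :: "('a,'b) mpoly"
    by (simp add: funpow_add zero)
  have sum: "\<exists>K. (deriv_along a ^^ K) (\<Sum>x\<in>X. q x) = 0"
    if "finite X" "\<And>x. x \<in> X \<Longrightarrow> \<exists>K. (deriv_along a ^^ K) (q x) = 0"
    for X and q :: "nat \<Rightarrow> ('a,'b) mpoly"
    using that
  proof induction
    case (insert x F)
    then obtain K K' where "(deriv_along a ^^ K) (q x) = 0" "(deriv_along a ^^ K') (sum q F) = 0"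
      by (metis insertI1 insertI2)
    then have "(deriv_along a ^^ (K + K')) (q x + sum q F) = 0"
      using mono[of K "q x" K'] mono[of K' "sum q F" K] by (simp add: add add.commute)
    then show ?case using insert by auto
  qed (auto simp: zero)
  obtain K where "p = (\<Sum>k\<le>K. hcomp k p)" using mpoly_eq_sum_hcomp by metis
  then show thesis using sum[of "{..K}" "\<lambda>k. hcomp k p"] 1[OF hcomp_in_graded] that
    by (metis finite_atMost)
qed

section \<open>Vectors in general position\<close>

definition dot :: "('v::finite \<Rightarrow> 'k::comm_semiring_0) \<Rightarrow> ('v \<Rightarrow> 'k) \<Rightarrow> 'k" where
  "dot c w = (\<Sum>i\<in>UNIV. c i * w i)"

lemma dot_add_left: "dot (\<lambda>i. c i + t * d i) w = dot c w + t * dot d w"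
  by (simp add: dot_def sum.distrib sum_distrib_left algebra_simps)

lemma dot_scale_right: "dot c (\<lambda>i. t * w i) = t * dot c w"
  by (simp add: dot_def sum_distrib_left algebra_simps)

lemma dot_0_right [simp]: "dot c (\<lambda>_. 0) = 0"
  by (simp add: dot_def)

text \<open>Move \<open>z\<close> along the line \<open>z + t e\<close>, where \<open>e\<close> is
  not orthogonal to the new vector. A vector not orthogonal to \<open>e\<close> excludes a single
  \<open>t\<close>, any other keeps its old nonzero product, and the field is infinite.\<close>

lemma exists_dot_nonzero:
  fixes W :: "('v::finite \<Rightarrow> 'k::field_char_0) set"
  assumes "finite W" "(\<lambda>_. 0) \<notin> W"
  shows "\<exists>z. \<forall>w\<in>W. dot z w \<noteq> 0"
  using assms
proof (induction W)
  case (insert w W)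
  then obtain z where z: "\<forall>w\<in>W. dot z w \<noteq> 0" by auto
  obtain i where i: "w i \<noteq> 0" using insert.prems by fastforce
  define e :: "'v \<Rightarrow> 'k" where "e j = (if j = i then 1 else 0)" for j
  have ew: "dot e w \<noteq> 0"
    using i by (simp add: dot_def e_def if_distrib[of "\<lambda>t. t * _"] cong: if_cong)
  have "finite ((\<lambda>w. - (dot z w / dot e w)) ` insert w W)"
    using insert by blast
  then obtain t where t: "t \<notin> (\<lambda>w. - (dot z w / dot e w)) ` insert w W"
    using ex_new_if_finite[OF infinite_UNIV_char_0] by blast
  have "dot (\<lambda>i. z i + t * e i) w' \<noteq> 0" if "w' \<in> insert w W" for w'
  proof (cases "dot e w' = 0")
    case True
    then show ?thesis using that z ew by (auto simp: dot_add_left)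
  next
    case False
    have "t \<noteq> - (dot z w' / dot e w')" using t that by blast
    then show ?thesis
      using False by (auto simp: dot_add_left field_simps eq_neg_iff_add_eq_0)
  qed
  then show ?case by blast
qed simp

abbreviation (input) vscale :: "'k::field \<Rightarrow> ('v \<Rightarrow> 'k) \<Rightarrow> 'v \<Rightarrow> 'k" where
  "vscale t f \<equiv> \<lambda>i. t * f i"

interpretation fv: vector_space "vscale :: 'k::field \<Rightarrow> ('v \<Rightarrow> 'k) \<Rightarrow> _"
  by standard (auto simp: fun_eq_iff algebra_simps)

definition unit_vec :: "'v \<Rightarrow> 'v \<Rightarrow> 'k::zero_neq_one" where
  "unit_vec i = (\<lambda>j. if j = i then 1 else 0)"

lemma sum_unit_vec: "(\<Sum>i\<in>UNIV. vscale (x i) (unit_vec i)) = (x :: 'v::finite \<Rightarrow> 'k::field)"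
proof
  have *: "(\<Sum>i\<in>X. f i) j = (\<Sum>i\<in>X. f i j)" for X :: "'v set" and f :: "'v \<Rightarrow> 'v \<Rightarrow> 'k" and j
    by (induction X rule: infinite_finite_induct) auto
  show "(\<Sum>i\<in>UNIV. vscale (x i) (unit_vec i)) j = x j" for j
    unfolding * unit_vec_def by (simp add: if_distrib[of "\<lambda>t. _ * t"] cong: if_cong)
qed

text \<open>Some functional kills \<open>X\<close> and is 1 at \<open>y\<close>; the vector of its
  values at the unit vectors represents it through \<open>dot\<close>. Such vectors are the
  directions of the derivations used later.\<close>

lemma exists_dual_vector:
  fixes y :: "'v::finite \<Rightarrow> 'k::field"
  assumes "y \<notin> fv.span X"
  obtains w where "\<And>x. x \<in> X \<Longrightarrow> dot x w = 0" "dot y w = 1"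
proof -
  interpret fvd: vector_space_pair "vscale :: 'k \<Rightarrow> ('v \<Rightarrow> 'k) \<Rightarrow> _" "(*) :: 'k \<Rightarrow> 'k \<Rightarrow> 'k"
    by standard (auto simp: algebra_simps)
  obtain B where B: "B \<subseteq> X" "fv.independent B" "X \<subseteq> fv.span B"
    using fv.maximal_independent_subset by blast
  have "y \<notin> fv.span B" using assms B(1) fv.span_mono by blast
  then have "fv.independent (insert y B)" using B(2) by (rule fv.independent_insertI)
  then obtain g where g: "Vector_Spaces.linear vscale (*) g"
      "\<forall>x\<in>insert y B. g x = (if x = y then 1 else 0)"
    using fvd.linear_independent_extend[of "insert y B" "\<lambda>x. if x = y then 1 else 0"] by blast
  interpret g: Vector_Spaces.linear vscale "(*)" g by (rule g(1))
  have dot: "dot x (\<lambda>i. g (unit_vec i)) = g x" for x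
    by (subst (2) sum_unit_vec[of x, symmetric]) (simp only: g.sum g.scale dot_def)
  have "g x = 0" if "x \<in> B" for x
  proof -
    have "x \<noteq> y" using that \<open>y \<notin> fv.span B\<close> fv.span_base by blast
    with g(2) that show ?thesis by auto
  qed
  then have "g x = 0" if "x \<in> fv.span B" for x
    using g.eq_0_on_span that by blast
  with B(3) g(2) dot show thesis
    by (intro that[of "\<lambda>i. g (unit_vec i)"]) auto
qed

lemma independent_unit_vecs:
  "fv.independent (range unit_vec :: ('v::finite \<Rightarrow> 'k::field) set)"
  and card_unit_vecs: "card (range unit_vec :: ('v \<Rightarrow> 'k) set) = CARD('v)"
  and span_unit_vecs: "x \<in> fv.span (range unit_vec :: ('v \<Rightarrow> 'k) set)"
proof -
  have inj: "inj (unit_vec :: 'v \<Rightarrow> 'v \<Rightarrow> 'k)"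
    by (auto simp: inj_def unit_vec_def fun_eq_iff split: if_splits)
  then show card: "card (range unit_vec :: ('v \<Rightarrow> 'k) set) = CARD('v)"
    by (simp add: card_image)
  show "x \<in> fv.span (range unit_vec)" for x :: "'v \<Rightarrow> 'k"
    by (subst sum_unit_vec[of x, symmetric])
      (intro fv.span_sum fv.span_scale fv.span_base, auto)
  show "fv.independent (range unit_vec :: ('v \<Rightarrow> 'k) set)"
  proof (rule fv.independent_if_scalars_zero)
    fix f :: "('v \<Rightarrow> 'k) \<Rightarrow> 'k" and x :: "'v \<Rightarrow> 'k"
    assume "(\<Sum>x\<in>range unit_vec. vscale (f x) x) = 0" and x: "x \<in> range unit_vec"
    then have "(\<Sum>i\<in>UNIV. vscale (f (unit_vec i)) (unit_vec i)) = 0"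
      by (simp add: sum.reindex inj)
    then have "(\<lambda>i. f (unit_vec i)) = 0"
      using sum_unit_vec[of "\<lambda>i. f (unit_vec i)"] by simp
    with x show "f x = 0" by (auto simp: fun_eq_iff)
  qed simp
qed

lemma span_neq_UNIV:
  fixes X :: "('v::finite \<Rightarrow> 'k::field) set"
  assumes "finite X" "card X < CARD('v)"
  shows "fv.span X \<noteq> UNIV"
proof
  assume "fv.span X = UNIV"
  then have "card (range unit_vec :: ('v \<Rightarrow> 'k) set) \<le> card X"
    using fv.independent_span_bound[OF assms(1) independent_unit_vecs] by simp
  with assms(2) show False by (simp add: card_unit_vecs)
qed

text \<open>The forms are chosen one after another. For each of the finitely many \<open>B\<close>
  that does not yet span together with the earlier forms, some nonzero vector is killed by all of
  these; the next form only has to be nonzero at these vectors and at \<open>p\<close>. The empty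
  \<open>B\<close> makes the first \<open>CARD('v)\<close> forms a basis.\<close>

lemma exists_transversal_flag:
  fixes \<B> :: "('v::finite \<Rightarrow> 'k::field_char_0) set set"
  assumes "finite \<B>" "{} \<in> \<B>" "p \<noteq> (\<lambda>_. 0)"
  obtains \<zeta> :: "nat \<Rightarrow> 'v \<Rightarrow> 'k" where
    "\<And>i. dot (\<zeta> i) p \<noteq> 0"
    "\<And>B i. B \<in> \<B> \<Longrightarrow> fv.span (B \<union> \<zeta> ` {..<i}) = UNIV \<or>
       (\<exists>w. (\<forall>b\<in>B. dot b w = 0) \<and> (\<forall>j<i. dot (\<zeta> j) w = 0) \<and> dot (\<zeta> i) w = 1)"
    "fv.span (\<zeta> ` {..<CARD('v)}) = UNIV"
proof -
  define Q where "Q \<zeta> i z \<longleftrightarrow> dot z p \<noteq> 0 \<and> (\<forall>B\<in>\<B>. fv.span (B \<union> \<zeta> ` {..<i}) = UNIV \<or>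
       (\<exists>w. (\<forall>b\<in>B. dot b w = 0) \<and> (\<forall>j<i. dot (\<zeta> j) w = 0) \<and> dot z w = 1))"
    for \<zeta> :: "nat \<Rightarrow> 'v \<Rightarrow> 'k" and i :: nat and z
  have "\<exists>\<zeta>. \<forall>i. Q \<zeta> i (\<zeta> i)"
  proof (rule dependent_wellorder_choice)
    fix r f g and i :: nat
    assume "\<And>y. y < i \<Longrightarrow> f y = (g y :: 'v \<Rightarrow> 'k)"
    moreover from this have "f ` {..<i} = g ` {..<i}" by (intro image_cong) auto
    ultimately show "Q f i r = Q g i r" by (simp add: Q_def)
  next
    fix i :: nat and \<zeta> :: "nat \<Rightarrow> 'v \<Rightarrow> 'k"
    have "\<exists>w. w \<noteq> (\<lambda>_. 0) \<and> (fv.span (B \<union> \<zeta> ` {..<i}) \<noteq> UNIV \<longrightarrow>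
       (\<forall>b\<in>B. dot b w = 0) \<and> (\<forall>j<i. dot (\<zeta> j) w = 0))" for B
    proof (cases "fv.span (B \<union> \<zeta> ` {..<i}) = UNIV")
      case True
      \<comment> \<open>Nothing is demanded of such a \<open>B\<close>; \<open>p\<close> is a
        harmless nonzero default.\<close>
      then show ?thesis using assms(3) by auto
    next
      case False
      then obtain y where "y \<notin> fv.span (B \<union> \<zeta> ` {..<i})" by auto
      then obtain w where w: "\<And>x. x \<in> B \<union> \<zeta> ` {..<i} \<Longrightarrow> dot x w = 0" "dot y w = 1"
        by (rule exists_dual_vector) blast
      then have "w \<noteq> (\<lambda>_. 0)" by auto
      with w show ?thesis by auto
    qed
    then obtain \<omega> where \<omega>: "\<And>B. \<omega> B \<noteq> (\<lambda>_. 0)"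
      "\<And>B. fv.span (B \<union> \<zeta> ` {..<i}) \<noteq> UNIV \<Longrightarrow>
        (\<forall>b\<in>B. dot b (\<omega> B) = 0) \<and> (\<forall>j<i. dot (\<zeta> j) (\<omega> B) = 0)"
      by metis
    have "finite (insert p (\<omega> ` \<B>))" using assms by auto
    moreover have "(\<lambda>_. 0) \<notin> insert p (\<omega> ` \<B>)"
      using assms \<omega>(1) by (auto simp: eq_commute)
    ultimately obtain z where z: "\<forall>w\<in>insert p (\<omega> ` \<B>). dot z w \<noteq> 0"
      using exists_dot_nonzero by metis
    have "\<exists>w. (\<forall>b\<in>B. dot b w = 0) \<and> (\<forall>j<i. dot (\<zeta> j) w = 0) \<and> dot z w = 1"
      if B: "B \<in> \<B>" "fv.span (B \<union> \<zeta> ` {..<i}) \<noteq> UNIV" for B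
      using z B \<omega>(2)[OF B(2)]
      by (intro exI[of _ "\<lambda>j. inverse (dot z (\<omega> B)) * \<omega> B j"]) (auto simp: dot_scale_right)
    with z show "\<exists>r. Q \<zeta> i r" unfolding Q_def by blast
  qed
  then obtain \<zeta> where \<zeta>: "\<And>i. Q \<zeta> i (\<zeta> i)" by blast
  have indep: "fv.independent (\<zeta> ` {..<i}) \<and> card (\<zeta> ` {..<i}) = i" if "i \<le> CARD('v)" for i
    using that
  proof (induction i)
    case (Suc i)
    have "fv.span (\<zeta> ` {..<i}) \<noteq> UNIV"
      using Suc by (intro span_neq_UNIV) simp_all
    then obtain w where w: "\<forall>j<i. dot (\<zeta> j) w = 0" "dot (\<zeta> i) w = 1"
      using \<zeta>[of i] assms(2) unfolding Q_def by force
    have "\<zeta> i \<notin> fv.span (\<zeta> ` {..<i})"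
    proof
      have "dot x w = 0" if "x \<in> fv.span (\<zeta> ` {..<i})" for x
        using that
      proof (induction rule: fv.span_induct_alt)
        case base
        show ?case by (simp add: dot_def)
      next
        case (step c x y)
        then have "dot x w = 0" using w by auto
        moreover have "vscale c x + y = (\<lambda>i. y i + c * x i)" by (auto simp: fun_eq_iff)
        ultimately show ?case using step dot_add_left[of y c x w] by simp
      qed
      moreover assume "\<zeta> i \<in> fv.span (\<zeta> ` {..<i})"
      ultimately show False using w by force
    qed
    moreover have "\<zeta> ` {..<Suc i} = insert (\<zeta> i) (\<zeta> ` {..<i})"
      by (simp add: lessThan_Suc)
    moreover have "\<zeta> i \<notin> \<zeta> ` {..<i}"
      using \<open>\<zeta> i \<notin> fv.span (\<zeta> ` {..<i})\<close> fv.span_superset[of "\<zeta> ` {..<i}"] by blast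
    ultimately show ?case
      using Suc by (simp add: fv.independent_insertI)
  qed (simp add: fv.independent_empty)
  have "fv.span (\<zeta> ` {..<CARD('v)}) = UNIV"
  proof (rule ccontr)
    let ?Z = "\<zeta> ` {..<CARD('v)}"
    assume "fv.span ?Z \<noteq> UNIV"
    then obtain y where y: "y \<notin> fv.span ?Z" by auto
    then have "fv.independent (insert y ?Z)"
      using indep[of "CARD('v)"] by (simp add: fv.independent_insertI)
    then have "card (insert y ?Z) \<le> card (range unit_vec :: ('v \<Rightarrow> 'k) set)"
      by (intro conjunct2[OF fv.independent_span_bound] subsetI span_unit_vecs) simp_all
    moreover have "y \<notin> ?Z" using y fv.span_superset[of ?Z] by blast
    ultimately show False using indep[of "CARD('v)"] by (simp add: card_unit_vecs)
  qed
  then show thesis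
    using \<zeta> unfolding Q_def by (intro that[of \<zeta>]) simp_all
qed

section \<open>Homogeneous ideals\<close>

interpretation rm: module "(*) :: 'r::comm_ring_1 \<Rightarrow> 'r \<Rightarrow> 'r"
  by standard (auto simp: algebra_simps)

declare rm.scale_scale [simp del]

lemma ideal_gen_eq: "ideal_gen = rm.span"
  by (simp add: fun_eq_iff ideal_gen_def)

definition hideal :: "('v::finite, 'k::comm_ring_1) mpoly set \<Rightarrow> bool" where
  "hideal J \<longleftrightarrow> rm.subspace J \<and> (\<forall>p\<in>J. \<forall>k. hcomp k p \<in> J)"

definition adjoin ::
  "('v::finite, 'k::comm_ring_1) mpoly set \<Rightarrow> ('v \<Rightarrow> 'k) \<Rightarrow> ('v, 'k) mpoly set" where
  "adjoin J c = {g + linear_form c * h |g h. g \<in> J}"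

lemma hideal_subspace: "hideal J \<Longrightarrow> rm.subspace J"
  by (simp add: hideal_def)

lemma hideal_hcomp: "hideal J \<Longrightarrow> p \<in> J \<Longrightarrow> hcomp k p \<in> J"
  by (simp add: hideal_def)

lemma subspace_const_cancel:
  fixes J :: "('v::finite, 'k::field) mpoly set"
  assumes "rm.subspace J" "c \<noteq> 0" "const_poly c * p \<in> J"
  shows "p \<in> J"
  using rm.subspace_scale[OF assms(1,3), of "const_poly (inverse c)"] assms(2)
  by (simp add: const_poly_inverse_cancel)

lemma subspace_adjoin:
  assumes "rm.subspace J"
  shows "rm.subspace (adjoin J c)"
proof (rule rm.subspaceI)
  show "0 \<in> adjoin J c"
    using rm.subspace_0[OF assms] unfolding adjoin_def
    by (intro CollectI exI[of _ 0]) simp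
next
  fix x y assume "x \<in> adjoin J c" "y \<in> adjoin J c"
  then obtain g h g' h' where "x = g + linear_form c * h" "y = g' + linear_form c * h'"
    "g \<in> J" "g' \<in> J" unfolding adjoin_def by auto
  then show "x + y \<in> adjoin J c"
    unfolding adjoin_def using rm.subspace_add[OF assms]
    by (intro CollectI exI[of _ "g + g'"] exI[of _ "h + h'"]) (auto simp: algebra_simps)
next
  fix p x assume "x \<in> adjoin J c"
  then obtain g h where "x = g + linear_form c * h" "g \<in> J" unfolding adjoin_def by auto
  then show "p * x \<in> adjoin J c"
    unfolding adjoin_def using rm.subspace_scale[OF assms]
    by (intro CollectI exI[of _ "p * g"] exI[of _ "p * h"]) (auto simp: algebra_simps)
qed

lemma hideal_adjoin:
  assumes "hideal J"
  shows "hideal (adjoin J c)"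
  unfolding hideal_def
proof (intro conjI ballI allI)
  show "rm.subspace (adjoin J c)"
    using assms by (simp add: subspace_adjoin hideal_subspace)
  fix p k assume "p \<in> adjoin J c"
  then obtain g h where gh: "p = g + linear_form c * h" "g \<in> J" unfolding adjoin_def by auto
  have "hcomp k p = hcomp k g + linear_form c * (if 1 \<le> k then hcomp (k - 1) h else 0)"
    using gh(1) hcomp_mult_graded[OF linear_form_in_graded, of k c h] by (simp add: hcomp_add)
  then show "hcomp k p \<in> adjoin J c"
    using hideal_hcomp[OF assms gh(2)] unfolding adjoin_def by blast
qed

lemma adjoin_superset: "J \<subseteq> adjoin J c"
  unfolding adjoin_def by (force intro: exI[of _ 0])

lemma adjoin_mono: "J \<subseteq> J' \<Longrightarrow> adjoin J c \<subseteq> adjoin J' c"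
  unfolding adjoin_def by blast

lemma form_mult_in_adjoin: "rm.subspace J \<Longrightarrow> linear_form c * h \<in> adjoin J c"
  unfolding adjoin_def using rm.subspace_0 by force

lemma adjoin_mult:
  assumes "\<And>g. g \<in> J \<Longrightarrow> q * g \<in> J'" "u \<in> adjoin J c"
  shows "q * u \<in> adjoin J' c"
proof -
  from assms(2) obtain g h where "u = g + linear_form c * h" "g \<in> J" unfolding adjoin_def by auto
  then show ?thesis
    unfolding adjoin_def using assms(1)
    by (intro CollectI exI[of _ "q * g"] exI[of _ "q * h"]) (auto simp: algebra_simps)
qed

lemma adjoin_stable:
  assumes "\<And>p. p \<in> J \<Longrightarrow> deriv_along w p \<in> J" "dot c w = 0" "p \<in> adjoin J c"
  shows "deriv_along w p \<in> adjoin J c"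
proof -
  from assms(3) obtain g h where gh: "p = g + linear_form c * h" "g \<in> J"
    unfolding adjoin_def by auto
  have "deriv_along w p = deriv_along w g + linear_form c * deriv_along w h"
    using assms(2) by (simp add: gh(1) deriv_along_add deriv_along_mult deriv_along_linear_form dot_def)
  then show ?thesis unfolding adjoin_def using assms(1)[OF gh(2)] by blast
qed

text \<open>The ideal \<open>J + (\<zeta> 0, ..., \<zeta> (i - 1))\<close>, built form by form
  because the arguments always peel off the last one.\<close>

primrec plus_forms ::
  "('v::finite, 'k::comm_ring_1) mpoly set \<Rightarrow> (nat \<Rightarrow> 'v \<Rightarrow> 'k) \<Rightarrow> nat \<Rightarrow> ('v, 'k) mpoly set" where
  "plus_forms J \<zeta> 0 = J"
| "plus_forms J \<zeta> (Suc i) = adjoin (plus_forms J \<zeta> i) (\<zeta> i)"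

lemma subspace_plus_forms: "rm.subspace J \<Longrightarrow> rm.subspace (plus_forms J \<zeta> i)"
  by (induction i) (auto simp: subspace_adjoin)

lemma hideal_plus_forms: "hideal J \<Longrightarrow> hideal (plus_forms J \<zeta> i)"
  by (induction i) (auto simp: hideal_adjoin)

lemma plus_forms_mono: "J \<subseteq> J' \<Longrightarrow> plus_forms J \<zeta> i \<subseteq> plus_forms J' \<zeta> i"
  by (induction i) (auto dest: adjoin_mono)

lemma plus_forms_superset: "J \<subseteq> plus_forms J \<zeta> i"
  using adjoin_superset by (induction i) auto

lemma plus_forms_mult:
  "(\<And>g. g \<in> J \<Longrightarrow> q * g \<in> J') \<Longrightarrow> u \<in> plus_forms J \<zeta> i \<Longrightarrow> q * u \<in> plus_forms J' \<zeta> i"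
  by (induction i arbitrary: u) (auto intro: adjoin_mult)

lemma form_mult_in_plus_forms:
  "rm.subspace J \<Longrightarrow> j < i \<Longrightarrow> linear_form (\<zeta> j) * h \<in> plus_forms J \<zeta> i"
proof (induction i)
  case (Suc i)
  show ?case
  proof (cases "j = i")
    case True
    then show ?thesis using Suc by (simp add: form_mult_in_adjoin subspace_plus_forms)
  next
    case False
    then have "linear_form (\<zeta> j) * h \<in> plus_forms J \<zeta> i" using Suc by simp
    then show ?thesis using adjoin_superset[of "plus_forms J \<zeta> i" "\<zeta> i"] by auto
  qed
qed simp

lemma plus_forms_stable:
  assumes "\<And>p. p \<in> J \<Longrightarrow> deriv_along w p \<in> J" "\<And>j. j < i \<Longrightarrow> dot (\<zeta> j) w = 0" "p \<in> plus_forms J \<zeta> i"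
  shows "deriv_along w p \<in> plus_forms J \<zeta> i"
  using assms(2,3)
proof (induction i arbitrary: p)
  case 0
  then show ?case using assms(1) by simp
next
  case (Suc i)
  show ?case
    unfolding plus_forms.simps
    by (rule adjoin_stable) (use Suc in auto)
qed

lemma linear_form_mult_span:
  fixes J :: "('v::finite, 'k::field) mpoly set"
  assumes "rm.subspace J" "\<And>x. x \<in> X \<Longrightarrow> linear_form x * u \<in> J" "y \<in> fv.span X"
  shows "linear_form y * u \<in> J"
  using assms(3)
proof (induction rule: fv.span_induct_alt)
  case base
  have "linear_form (0 :: 'v \<Rightarrow> 'k) = 0" by (simp add: linear_form_def)
  then show ?case using rm.subspace_0[OF assms(1)] by simp
next
  case (step c x y)
  have "linear_form (vscale c x + y) = const_poly c * linear_form x + linear_form y"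
    by (simp add: plus_fun_def linear_form_add linear_form_scale)
  then have eq: "linear_form (vscale c x + y) * u =
      const_poly c * (linear_form x * u) + linear_form y * u"
    by (simp add: algebra_simps)
  show ?case
    unfolding eq using step
    by (intro rm.subspace_add[OF assms(1) rm.subspace_scale[OF assms(1) assms(2)]])
qed

subsection \<open>Regular elements via derivations\<close>

text \<open>If \<open>D\<close> is the derivation along \<open>w\<close> and \<open>z\<close> the linear form, then
  \<open>D\<^sup>k\<^sup>+\<^sup>1 (z u) = (k + 1) D\<^sup>k u + z D\<^sup>k\<^sup>+\<^sup>1 u\<close>; since \<open>D\<close> is nilpotent on \<open>u\<close>, downward
  induction on \<open>k\<close> applies.\<close>

lemma linear_form_regular:
  fixes J :: "('v::finite, 'k::field_char_0) mpoly set"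
  assumes J: "rm.subspace J" and stable: "\<And>p. p \<in> J \<Longrightarrow> deriv_along w p \<in> J"
    and c: "dot c w = 1" and u: "linear_form c * u \<in> J"
  shows "u \<in> J"
proof -
  let ?D = "deriv_along w"
  have of_nat: "?D (of_nat n * p) = of_nat n * ?D p" for n and p :: "('v, 'k) mpoly"
    by (simp add: deriv_along_mult const_poly_of_nat[symmetric])
  have 1: "(?D ^^ Suc k) (linear_form c * u) =
      of_nat (Suc k) * (?D ^^ k) u + linear_form c * (?D ^^ Suc k) u" for k
  proof (induction k)
    case 0
    then show ?case
      using c by (simp add: deriv_along_mult deriv_along_linear_form dot_def algebra_simps)
  next
    case (Suc k)
    have "(?D ^^ Suc (Suc k)) (linear_form c * u) =
        ?D (of_nat (Suc k) * (?D ^^ k) u + linear_form c * (?D ^^ Suc k) u)"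
      using Suc by simp
    also have "\<dots> = of_nat (Suc k) * (?D ^^ Suc k) u + ((?D ^^ Suc k) u
        + linear_form c * (?D ^^ Suc (Suc k)) u)"
      unfolding deriv_along_add of_nat
      using c by (simp add: deriv_along_mult deriv_along_linear_form dot_def)
    finally show ?case by (simp add: algebra_simps)
  qed
  have 2: "(?D ^^ k) p \<in> J" if "p \<in> J" for k p
    using that stable by (induction k) auto
  obtain K where K: "(?D ^^ K) u = 0" by (rule deriv_along_nilpotent)
  have "(?D ^^ (K - k)) u \<in> J" for k
  proof (induction k)
    case 0
    show ?case using K rm.subspace_0[OF J] by simp
  next
    case (Suc k)
    show ?case
    proof (cases "K - k")
      case 0
      then show ?thesis using Suc by simp
    next
      case (Suc m)
      then have m: "(?D ^^ Suc m) u \<in> J" and km: "K - Suc k = m"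
        using \<open>(?D ^^ (K - k)) u \<in> J\<close> by auto
      have "(?D ^^ Suc m) (linear_form c * u) - linear_form c * (?D ^^ Suc m) u \<in> J"
        using 2[OF u] rm.subspace_scale[OF J m] by (intro rm.subspace_diff[OF J])
      then have "const_poly (of_nat (Suc m)) * (?D ^^ m) u \<in> J"
        unfolding 1 by (simp add: const_poly_of_nat del: of_nat_Suc)
      then show ?thesis
        unfolding km by (rule subspace_const_cancel[OF J, rotated]) (simp del: of_nat_Suc)
    qed
  qed
  from this[of K] show ?thesis by simp
qed

lemma linear_forms_prod_regular:
  fixes J :: "('v::finite, 'k::field_char_0) mpoly set"
  assumes "finite X" "rm.subspace J"
    and "\<And>x. x \<in> X \<Longrightarrow> \<exists>w. dot (c x) w = 1 \<and> (\<forall>p\<in>J. deriv_along w p \<in> J)"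
    and "(\<Prod>x\<in>X. linear_form (c x)) * u \<in> J"
  shows "u \<in> J"
  using assms(1,3,4)
proof (induction arbitrary: u)
  case (insert x X)
  have "linear_form (c x) * ((\<Prod>x\<in>X. linear_form (c x)) * u) \<in> J"
    using insert by (simp add: mult.assoc)
  moreover obtain w where "dot (c x) w = 1" "\<forall>p\<in>J. deriv_along w p \<in> J"
    using insert.prems(1) by blast
  ultimately have "(\<Prod>x\<in>X. linear_form (c x)) * u \<in> J"
    using linear_form_regular[OF assms(2)] by blast
  then show ?case using insert by blast
qed simp

text \<open>Modulo \<open>J\<close>, the common multiples of the forms are the multiples of their
  product. If \<open>u\<close> is \<open>?P * h\<close> modulo \<open>J\<close> and also lies in
  \<open>adjoin J (c y)\<close>, the factors of \<open>?P\<close> cancel one by one modulo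
  \<open>adjoin J (c y)\<close>, since the vectors \<open>w\<close> with
  \<open>dot (c y) w = 0\<close> preserve that ideal; so \<open>c y\<close> divides \<open>h\<close>
  modulo \<open>J\<close>. It is applied with \<open>J\<close> zero and with \<open>J\<close>
  generated by one further form.\<close>

lemma inter_adjoin_linear_forms:
  fixes J :: "('v::finite, 'k::field_char_0) mpoly set"
  assumes "finite X" "rm.subspace J"
    and "\<And>x y. x \<in> X \<Longrightarrow> y \<in> X \<Longrightarrow> x \<noteq> y \<Longrightarrow>
      \<exists>w. dot (c x) w = 1 \<and> dot (c y) w = 0 \<and> (\<forall>p\<in>J. deriv_along w p \<in> J)"
    and "\<And>x. x \<in> X \<Longrightarrow> u \<in> adjoin J (c x)"
  obtains h where "u - (\<Prod>x\<in>X. linear_form (c x)) * h \<in> J"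
proof -
  have "\<exists>h. u - (\<Prod>x\<in>X. linear_form (c x)) * h \<in> J"
    using assms(1,3,4)
  proof induction
    case empty
    show ?case using rm.subspace_0[OF assms(2)] by (intro exI[of _ u]) simp
  next
    case (insert y X)
    let ?P = "\<Prod>x\<in>X. linear_form (c x)"
    obtain h where h: "u - ?P * h \<in> J" using insert by auto
    have J': "rm.subspace (adjoin J (c y))" using assms(2) by (rule subspace_adjoin)
    have "u - (u - ?P * h) \<in> adjoin J (c y)"
      by (rule rm.subspace_diff[OF J' insert.prems(2)[OF insertI1] subsetD[OF adjoin_superset h]])
    then have "?P * h \<in> adjoin J (c y)" by simp
    moreover have "\<exists>w. dot (c x) w = 1 \<and> (\<forall>p\<in>adjoin J (c y). deriv_along w p \<in> adjoin J (c y))"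
      if x: "x \<in> X" for x
    proof -
      obtain w where "dot (c x) w = 1" "dot (c y) w = 0" "\<forall>p\<in>J. deriv_along w p \<in> J"
        using insert.prems(1)[of x y] insert.hyps x by blast
      then show ?thesis using adjoin_stable[of J w "c y"] by blast
    qed
    ultimately have "h \<in> adjoin J (c y)"
      using linear_forms_prod_regular[OF insert.hyps(1) J', of c] by blast
    then obtain g h' where g: "h = g + linear_form (c y) * h'" "g \<in> J"
      unfolding adjoin_def by auto
    have "u - (linear_form (c y) * ?P) * h' = (u - ?P * h) + ?P * g"
      by (simp add: g(1) algebra_simps)
    also have "\<dots> \<in> J" using h g(2) rm.subspace_add[OF assms(2)] rm.subspace_scale[OF assms(2)] by blast
    finally show ?case using insert.hyps by (auto intro: exI[of _ h'])
  qed
  with that show thesis by blast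
qed

lemma hcomp_low_mult:
  assumes "f \<in> graded_piece d" "j < d" shows "hcomp j (f * h) = 0"
  using hcomp_mult_graded[OF assms(1), of j h] assms(2) by simp

section \<open>The residual of an arrangement\<close>

lemma subspace_zero: "rm.subspace {0}"
  by (rule rm.subspaceI) auto

lemma hideal_zero: "hideal {0}"
  by (simp add: hideal_def subspace_zero)

text \<open>A monomial of positive degree has a variable as a factor, and variables are combinations
  of the spanning forms.\<close>

lemma in_plus_forms_span:
  fixes J :: "('v::finite, 'k::field) mpoly set"
  assumes J: "rm.subspace J" and span: "fv.span (\<zeta> ` {..<N}) = UNIV"
    and u: "u \<in> graded_piece k" "1 \<le> k"
  shows "u \<in> plus_forms J \<zeta> N"
proof -
  note sub = subspace_plus_forms[OF J]
  have forms: "linear_form y * p \<in> plus_forms J \<zeta> N" for y p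
    by (rule linear_form_mult_span[OF sub, of "\<zeta> ` {..<N}"])
      (use form_mult_in_plus_forms[OF J] span in auto)
  have "u = (\<Sum>m\<in>Poly_Mapping.keys u. Poly_Mapping.single m (Poly_Mapping.lookup u m))"
    by (rule mpoly_sum_singles)
  also have "\<dots> \<in> plus_forms J \<zeta> N"
  proof (rule rm.subspace_sum[OF sub])
    fix m assume m: "m \<in> Poly_Mapping.keys u"
    then have "mdeg m = k" using u by (auto simp: graded_piece_def)
    with u(2) obtain j where j: "Poly_Mapping.lookup m j \<noteq> 0"
      by (metis mdeg_eq_0 not_one_le_zero poly_mapping_eqI lookup_zero)
    define m' where "m' = m - Poly_Mapping.single j 1"
    have "m = Poly_Mapping.single j 1 + m'"
      unfolding m'_def using j
      by (intro poly_mapping_eqI) (auto simp: lookup_add lookup_minus lookup_single when_def)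
    then have "Poly_Mapping.single m (Poly_Mapping.lookup u m) =
        linear_form (\<lambda>j'. if j' = j then 1 else 0) * Poly_Mapping.single m' (Poly_Mapping.lookup u m)"
      by (simp add: linear_form_unit mult_single)
    then show "Poly_Mapping.single m (Poly_Mapping.lookup u m) \<in> plus_forms J \<zeta> N"
      using forms by simp
  qed
  finally show ?thesis .
qed

text \<open>Distinctness of the hyperplanes enters as independence of any two forms, stated through
  the direction along which one form is differentiated while the other is treated as a
  constant.\<close>

locale forms_at_point =
  fixes A :: "'h set" and L :: "'h \<Rightarrow> 'v::finite \<Rightarrow> 'k::field_char_0" and a :: "'v \<Rightarrow> 'k"
  assumes finite_A: "finite A" and nonempty_A: "A \<noteq> {}"
    and dot_a: "H \<in> A \<Longrightarrow> dot (L H) a \<noteq> 0"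
    and pairwise: "H \<in> A \<Longrightarrow> H' \<in> A \<Longrightarrow> H \<noteq> H' \<Longrightarrow> \<exists>w. dot (L H) w = 1 \<and> dot (L H') w = 0"
begin

abbreviation P :: "'h \<Rightarrow> ('v, 'k) mpoly set" where
  "P H \<equiv> adjoin {0} (L H)"

definition f :: "('v, 'k) mpoly" where
  "f = (\<Prod>H\<in>A. linear_form (L H))"

text \<open>The polynomial \<open>\<beta>\<close> stands for the coefficient of the derivative along
  \<open>a\<close> in an expression of \<open>g * partial_deriv i f\<close>. For one hyperplane of
  \<open>A\<close> it always exists, because \<open>dot (L H) a\<close> is invertible; the condition
  is that a single \<open>\<beta>\<close> serves all \<open>H\<close> in \<open>B\<close>.\<close>

definition R :: "'h set \<Rightarrow> ('v, 'k) mpoly set" where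
  "R B = {g. \<forall>i. \<exists>\<beta>. \<forall>H\<in>B.
     const_poly (L H i) * g - const_poly (dot (L H) a) * \<beta> \<in> P H}"

lemma subspace_P: "rm.subspace (P H)"
  by (rule subspace_adjoin[OF subspace_zero])

lemma P_stable:
  assumes "dot (L H) w = 0" "p \<in> P H" shows "deriv_along w p \<in> P H"
  by (rule adjoin_stable[OF _ assms]) simp

lemma P_regular:
  assumes "dot (L H) w = 0" "dot c w = 1" "linear_form c * u \<in> P H" shows "u \<in> P H"
  by (rule linear_form_regular[OF subspace_P P_stable[OF assms(1)] assms(2,3)])

lemma in_R_I:
  assumes "\<And>i H. H \<in> B \<Longrightarrow> const_poly (L H i) * g - const_poly (dot (L H) a) * \<beta> i \<in> P H"
  shows "g \<in> R B"
  using assms unfolding R_def by blast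

lemma in_R_E:
  assumes "g \<in> R B"
  obtains \<beta> where "\<forall>i. \<forall>H\<in>B. const_poly (L H i) * g - const_poly (dot (L H) a) * \<beta> i \<in> P H"
proof -
  from assms have "\<forall>i. \<exists>\<beta>. \<forall>H\<in>B.
     const_poly (L H i) * g - const_poly (dot (L H) a) * \<beta> \<in> P H"
    by (simp add: R_def)
  from choice[OF this] that show thesis by blast
qed

lemma subspace_R: "rm.subspace (R B)"
proof (rule rm.subspaceI)
  show "0 \<in> R B"
    by (rule in_R_I[of _ _ "\<lambda>_. 0"]) (simp add: rm.subspace_0[OF subspace_P])
next
  fix g h assume "g \<in> R B" "h \<in> R B"
  from \<open>g \<in> R B\<close> obtain \<beta> where
    1: "\<forall>i. \<forall>H\<in>B. const_poly (L H i) * g - const_poly (dot (L H) a) * \<beta> i \<in> P H"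
    by (rule in_R_E)
  from \<open>h \<in> R B\<close> obtain \<gamma> where
    2: "\<forall>i. \<forall>H\<in>B. const_poly (L H i) * h - const_poly (dot (L H) a) * \<gamma> i \<in> P H"
    by (rule in_R_E)
  show "g + h \<in> R B"
  proof (rule in_R_I[of _ _ "\<lambda>i. \<beta> i + \<gamma> i"])
    show "const_poly (L H i) * (g + h) - const_poly (dot (L H) a) * (\<beta> i + \<gamma> i) \<in> P H"
      if "H \<in> B" for i H
      using rm.subspace_add[OF subspace_P 1[rule_format, OF that, of i] 2[rule_format, OF that, of i]]
      by (simp add: algebra_simps)
  qed
next
  fix c g assume "g \<in> R B"
  then obtain \<beta> where
    1: "\<forall>i. \<forall>H\<in>B. const_poly (L H i) * g - const_poly (dot (L H) a) * \<beta> i \<in> P H"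
    by (rule in_R_E)
  show "c * g \<in> R B"
  proof (rule in_R_I[of _ _ "\<lambda>i. c * \<beta> i"])
    show "const_poly (L H i) * (c * g) - const_poly (dot (L H) a) * (c * \<beta> i) \<in> P H"
      if "H \<in> B" for i H
      using rm.subspace_scale[OF subspace_P 1[rule_format, OF that, of i], of c]
      by (simp add: algebra_simps)
  qed
qed

lemma hideal_R: "hideal (R B)"
  unfolding hideal_def
proof (intro conjI ballI allI subspace_R)
  fix g k assume "g \<in> R B"
  then obtain \<beta> where
    1: "\<forall>i. \<forall>H\<in>B. const_poly (L H i) * g - const_poly (dot (L H) a) * \<beta> i \<in> P H"
    by (rule in_R_E)
  show "hcomp k g \<in> R B"
  proof (rule in_R_I[of _ _ "\<lambda>i. hcomp k (\<beta> i)"])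
    show "const_poly (L H i) * hcomp k g - const_poly (dot (L H) a) * hcomp k (\<beta> i) \<in> P H"
      if "H \<in> B" for i H
      using hideal_hcomp[OF hideal_adjoin[OF hideal_zero] 1[rule_format, OF that, of i], of k]
      by (simp add: hcomp_diff hcomp_const_mult)
  qed
qed

text \<open>The derivation preserves every \<open>P H\<close> with \<open>H\<close> in
  \<open>B\<close>, and the coefficients in the congruences are constants; so the differentiated
  witnesses are witnesses for the derivative.\<close>

lemma R_stable:
  assumes "\<And>H. H \<in> B \<Longrightarrow> dot (L H) w = 0" "g \<in> R B"
  shows "deriv_along w g \<in> R B"
proof -
  from assms(2) obtain \<beta> where
    1: "\<forall>i. \<forall>H\<in>B. const_poly (L H i) * g - const_poly (dot (L H) a) * \<beta> i \<in> P H"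
    by (rule in_R_E)
  show ?thesis
  proof (rule in_R_I[of _ _ "\<lambda>i. deriv_along w (\<beta> i)"])
    show "const_poly (L H i) * deriv_along w g - const_poly (dot (L H) a) * deriv_along w (\<beta> i) \<in> P H"
      if "H \<in> B" for i H
      using P_stable[OF assms(1)[OF that] 1[rule_format, OF that, of i]]
      by (simp add: deriv_along_diff deriv_along_mult)
  qed
qed

lemma R_antimono: "B \<subseteq> B' \<Longrightarrow> R B' \<subseteq> R B"
  unfolding R_def by blast

text \<open>The old witnesses times the form of \<open>H\<close> still serve the other hyperplanes,
  and at \<open>H\<close> itself every multiple of that form is allowed.\<close>

lemma R_mult:
  assumes "H \<in> B" "g \<in> R (B - {H})"
  shows "linear_form (L H) * g \<in> R B"
proof -
  from assms(2) obtain \<beta> where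
    1: "\<forall>i. \<forall>H'\<in>B - {H}.
      const_poly (L H' i) * g - const_poly (dot (L H') a) * \<beta> i \<in> P H'"
    by (rule in_R_E)
  show ?thesis
  proof (rule in_R_I[of _ _ "\<lambda>i. linear_form (L H) * \<beta> i"])
    fix i H' assume H': "H' \<in> B"
    have eq: "const_poly (L H' i) * (linear_form (L H) * g) -
        const_poly (dot (L H') a) * (linear_form (L H) * \<beta> i) =
        linear_form (L H) * (const_poly (L H' i) * g - const_poly (dot (L H') a) * \<beta> i)"
      by (simp add: algebra_simps)
    show "const_poly (L H' i) * (linear_form (L H) * g) -
        const_poly (dot (L H') a) * (linear_form (L H) * \<beta> i) \<in> P H'"
    proof (cases "H' = H")
      case True
      then show ?thesis unfolding eq by (simp add: form_mult_in_adjoin[OF subspace_zero])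
    next
      case False
      then show ?thesis unfolding eq using 1 H' by (intro rm.subspace_scale[OF subspace_P]) auto
    qed
  qed
qed

text \<open>The base of the deletion induction: a single congruence can be solved for
  \<open>\<beta>\<close>.\<close>

lemma R_small:
  assumes "B \<subseteq> A" "card B \<le> 1"
  shows "R B = UNIV"
proof -
  have "finite B" using assms finite_A finite_subset by blast
  then have unique: "\<forall>x\<in>B. \<forall>y\<in>B. x = y" using assms(2) card_le_Suc0_iff_eq[of B] by simp
  show ?thesis
  proof (cases "B = {}")
    case True
    then show ?thesis by (simp add: R_def)
  next
    case False
    with unique obtain H where B: "B = {H}" by blast
    then have "dot (L H) a \<noteq> 0" using assms(1) dot_a by auto
    then have eq: "const_poly (L H i) * g -
       const_poly (dot (L H) a) * (const_poly (inverse (dot (L H) a) * L H i) * g) = 0" for i g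
      by (simp add: mult.assoc[symmetric] const_poly_mult[symmetric])
    have "g \<in> R B" for g
      by (rule in_R_I[of _ _ "\<lambda>i. const_poly (inverse (dot (L H) a) * L H i) * g"])
        (simp add: B eq rm.subspace_0[OF subspace_P])
    then show ?thesis by auto
  qed
qed

subsection \<open>Regularity of the residual along a transversal flag\<close>

text \<open>The outer induction deletes a hyperplane, the inner one runs towards the end of the
  flag. If the forms of \<open>B\<close> and the earlier flag forms miss a direction, a derivation
  cancels \<open>\<zeta> i\<close> in every degree. If they span, membership of all products with
  linear forms follows from that of the products with the forms of \<open>B\<close>, and
  \<open>R_mult\<close> fetches these from the deletions.\<close>

lemma R_regular:
  assumes flag: "\<And>B i. B \<subseteq> A \<Longrightarrow> fv.span (L ` B \<union> \<zeta> ` {..<i}) = UNIV \<or>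
       (\<exists>w. (\<forall>b\<in>L ` B. dot b w = 0) \<and> (\<forall>j<i. dot (\<zeta> j) w = 0) \<and> dot (\<zeta> i) w = 1)"
    and span: "fv.span (\<zeta> ` {..<N}) = UNIV"
    and "B \<subseteq> A" "u \<in> graded_piece k" "card B \<le> Suc k" "i < N"
    and "linear_form (\<zeta> i) * u \<in> plus_forms (R B) \<zeta> i"
  shows "u \<in> plus_forms (R B) \<zeta> i"
  using assms(3-7)
proof (induction "card B" arbitrary: B i u k rule: less_induct)
  case less
  note B = less.prems(1) and deletion_IH = less.hyps
  have finB: "finite B" using B finite_A finite_subset by blast
  show ?case
  proof (cases "card B \<le> 1")
    case True
    then show ?thesis using R_small[OF B] plus_forms_superset[of "R B" \<zeta> i] by auto
  next
    case large: False
    have sub: "rm.subspace (plus_forms (R B') \<zeta> i)" for B' i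
      by (rule subspace_plus_forms[OF subspace_R])
    \<comment> \<open>The deletion has one hyperplane less, so its induction hypothesis reaches one
      degree lower than the claim for \<open>B\<close>: hence the bound
      \<open>Suc (Suc k)\<close>.\<close>
    have deleted: "linear_form (L H) * v \<in> plus_forms (R B) \<zeta> i"
      if H: "H \<in> B" and i: "i < N" and v: "v \<in> graded_piece k" "card B \<le> Suc (Suc k)"
        and zv: "linear_form (\<zeta> i) * v \<in> plus_forms (R (B - {H})) \<zeta> i" for H v k i
    proof -
      have "v \<in> plus_forms (R (B - {H})) \<zeta> i"
      proof (rule less.hyps)
        show "card (B - {H}) < card B" using H finB by (intro psubset_card_mono) auto
        show "card (B - {H}) \<le> Suc k" using H finB v(2) by simp
      qed (use B i v zv in auto)
      then show ?thesis by (rule plus_forms_mult[rotated]) (rule R_mult[OF H])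
    qed
    have anti: "plus_forms (R B) \<zeta> i \<subseteq> plus_forms (R (B - {H})) \<zeta> i" for H i
      by (intro plus_forms_mono R_antimono) auto
    from less.prems(2-5) show ?thesis
    proof (induction "N - i" arbitrary: i u k rule: less_induct)
      case (less i u k)
      note u = less.prems(1) and k = less.prems(2) and i = less.prems(3) and zu = less.prems(4)
      consider (full) "fv.span (L ` B \<union> \<zeta> ` {..<i}) = UNIV"
        | (free) w where "\<And>H. H \<in> B \<Longrightarrow> dot (L H) w = 0" "\<And>j. j < i \<Longrightarrow> dot (\<zeta> j) w = 0"
            "dot (\<zeta> i) w = 1"
        using flag[OF B, of i] by auto
      then show ?case
      proof cases
        case free
        show ?thesis
        proof (rule linear_form_regular[OF sub _ free(3) zu])
          show "deriv_along w p \<in> plus_forms (R B) \<zeta> i" if "p \<in> plus_forms (R B) \<zeta> i" for p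
            using plus_forms_stable[of "R B" w i \<zeta> p] R_stable[of B w] free that by blast
        qed
      next
        case full
        have all_forms: "linear_form y * v \<in> plus_forms (R B) \<zeta> i"
          if "v \<in> graded_piece k'" "card B \<le> Suc (Suc k')"
            "\<And>H. linear_form (\<zeta> i) * v \<in> plus_forms (R (B - {H})) \<zeta> i" for y v k'
        proof (rule linear_form_mult_span[OF sub])
          show "y \<in> fv.span (L ` B \<union> \<zeta> ` {..<i})" using full by simp
          fix x assume "x \<in> L ` B \<union> \<zeta> ` {..<i}"
          then show "linear_form x * v \<in> plus_forms (R B) \<zeta> i"
            using deleted[OF _ i that(1,2,3)] form_mult_in_plus_forms[OF subspace_R] by auto
        qed
        have kB: "card B \<le> Suc (Suc k)" and k1: "1 \<le> k" using k large by auto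
        have Su: "linear_form y * u \<in> plus_forms (R B) \<zeta> i" for y
          using all_forms[OF u kB] zu anti by blast
        \<comment> \<open>Multiplication by the next flag form also takes \<open>u\<close> into the
          ideal, so the inner induction, or positive degree at the end of the flag, gives membership
          once \<open>\<zeta> i\<close> is adjoined. What remains is the remainder
          \<open>linear_form (\<zeta> i) * w\<close>.\<close>
        have "u \<in> plus_forms (R B) \<zeta> (Suc i)"
        proof (cases "Suc i < N")
          case True
          have "linear_form (\<zeta> (Suc i)) * u \<in> plus_forms (R B) \<zeta> (Suc i)"
            using Su adjoin_superset[of "plus_forms (R B) \<zeta> i" "\<zeta> i"] by auto
          then show ?thesis using less.hyps[of "Suc i" u k] u k True i by auto
        next
          case False
          with i have N: "Suc i = N" by simp
          show ?thesis
            unfolding N by (rule in_plus_forms_span[OF subspace_R span u k1])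
        qed
        then obtain g h where gh: "u = g + linear_form (\<zeta> i) * h" "g \<in> plus_forms (R B) \<zeta> i"
          by (auto simp: adjoin_def)
        define w where "w = hcomp (k - 1) h"
        define m where "m = hcomp k g"
        have w: "w \<in> graded_piece (k - 1)" by (simp add: w_def)
        have um: "u = m + linear_form (\<zeta> i) * w"
          using arg_cong[OF gh(1), of "hcomp k"] hcomp_graded[OF u, of k] k1
          by (simp add: hcomp_add hcomp_mult_graded[OF linear_form_in_graded] m_def w_def)
        have m: "m \<in> plus_forms (R B) \<zeta> i"
          unfolding m_def using gh(2) by (intro hideal_hcomp hideal_plus_forms hideal_R)
        have "linear_form (\<zeta> i) * (linear_form (\<zeta> i) * w) =
            linear_form (\<zeta> i) * u - linear_form (\<zeta> i) * m"
          by (simp add: um algebra_simps)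
        also have "\<dots> \<in> plus_forms (R B) \<zeta> i"
          by (intro rm.subspace_diff[OF sub] zu rm.subspace_scale[OF sub] m)
        finally have zzw: "linear_form (\<zeta> i) * (linear_form (\<zeta> i) * w) \<in> plus_forms (R B) \<zeta> i" .
        have zw: "linear_form (\<zeta> i) * w \<in> graded_piece k"
          using graded_mult[OF linear_form_in_graded w, of "\<zeta> i"] k1 by simp
        \<comment> \<open>Deletion is used twice. In degree \<open>k\<close> it cancels one of the
          two factors \<open>\<zeta> i\<close>; in degree \<open>k - 1\<close>,
          \<open>deleted\<close> trades the other for the form of \<open>H\<close>. As these forms
          and the earlier flag forms span, a combination of the results restores
          \<open>\<zeta> i\<close>, now over \<open>R B\<close>.\<close>
        have "linear_form (\<zeta> i) * w \<in> plus_forms (R (B - {H})) \<zeta> i" if H: "H \<in> B" for H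
        proof (rule deletion_IH)
          show "card (B - {H}) < card B" using H finB by (intro psubset_card_mono) auto
          then show "card (B - {H}) \<le> Suc k" using k by simp
        qed (use B i zw zzw anti in auto)
        then have Lw: "linear_form (L H) * w \<in> plus_forms (R B) \<zeta> i" if H: "H \<in> B" for H
          using deleted[OF H i w] k k1 H by auto
        have "linear_form (\<zeta> i) * w \<in> plus_forms (R B) \<zeta> i"
        proof (rule linear_form_mult_span[OF sub])
          show "\<zeta> i \<in> fv.span (L ` B \<union> \<zeta> ` {..<i})" using full by simp
          show "linear_form x * w \<in> plus_forms (R B) \<zeta> i"
            if "x \<in> L ` B \<union> \<zeta> ` {..<i}" for x
            using that Lw form_mult_in_plus_forms[OF subspace_R] by auto
        qed
        with m show ?thesis unfolding um by (intro rm.subspace_add[OF sub])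
      qed
    qed
  qed
qed

end

section \<open>Homogeneous spans, the ideal of a point, and separating an ideal from the
  flag\<close>

lemma span_pair: "p \<in> rm.span {x, y} \<longleftrightarrow> (\<exists>\<alpha> \<beta>. p = \<alpha> * x + \<beta> * y)"
proof
  assume "p \<in> rm.span {x, y}"
  then obtain \<alpha> \<beta> where "p - \<alpha> * x = \<beta> * y"
    by (auto simp: rm.span_breakdown_eq rm.span_singleton)
  then have "p = \<alpha> * x + \<beta> * y" by (simp add: algebra_simps)
  then show "\<exists>\<alpha> \<beta>. p = \<alpha> * x + \<beta> * y" by blast
next
  assume "\<exists>\<alpha> \<beta>. p = \<alpha> * x + \<beta> * y"
  then obtain \<alpha> \<beta> where p: "p = \<alpha> * x + \<beta> * y" by blast
  show "p \<in> rm.span {x, y}"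
    unfolding p by (intro rm.span_add rm.span_scale rm.span_base) auto
qed

lemma hideal_span:
  assumes "\<And>g. g \<in> G \<Longrightarrow> \<exists>d. g \<in> graded_piece d"
  shows "hideal (rm.span G)"
  unfolding hideal_def
proof (intro conjI ballI allI rm.subspace_span)
  fix p k assume "p \<in> rm.span G"
  then show "hcomp k p \<in> rm.span G"
  proof (induction rule: rm.span_induct_alt)
    case base
    show ?case by (simp add: rm.span_zero)
  next
    case (step c x y)
    obtain d where d: "x \<in> graded_piece d" using assms step by blast
    have "hcomp k (c * x) = (if d \<le> k then hcomp (k - d) c else 0) * x"
      using hcomp_mult_graded[OF d, of k c] by (simp add: mult.commute)
    also have "\<dots> \<in> rm.span G" using step by (intro rm.span_scale rm.span_base)
    finally show ?case using step by (simp add: hcomp_add rm.span_add)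
  qed
qed

lemma eval_point_ideal:
  "p \<in> point_ideal a \<Longrightarrow> eval_poly p a = 0"
  unfolding point_ideal_def ideal_gen_eq
  by (induction rule: rm.span_induct_alt) (auto simp: eval_poly_add eval_poly_mult)

lemma in_point_ideal_iff:
  "p \<in> graded_piece k \<Longrightarrow> p \<in> point_ideal a \<longleftrightarrow> eval_poly p a = 0"
  using eval_point_ideal[of p a]
  by (auto simp: point_ideal_def ideal_gen_eq intro!: rm.span_base)

lemma hideal_point_ideal: "hideal (point_ideal a)"
  unfolding point_ideal_def ideal_gen_eq by (rule hideal_span) auto

lemma hideal_Int: "hideal J \<Longrightarrow> hideal J' \<Longrightarrow> hideal (J \<inter> J')"
  by (auto simp: hideal_def rm.subspace_inter)

lemma plus_forms_split:
  assumes "u \<in> plus_forms J \<zeta> i"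
  obtains g where "g \<in> J" "u - g \<in> plus_forms {0} \<zeta> i"
proof -
  have "\<exists>g\<in>J. u - g \<in> plus_forms {0} \<zeta> i"
    using assms
  proof (induction i arbitrary: u)
    case (Suc i)
    then obtain g h where "u = g + linear_form (\<zeta> i) * h" "g \<in> plus_forms J \<zeta> i"
      by (auto simp: adjoin_def)
    moreover from Suc.IH[OF this(2)] obtain g' where "g' \<in> J" "g - g' \<in> plus_forms {0} \<zeta> i" by blast
    ultimately have "u - g' = (g - g') + linear_form (\<zeta> i) * h" by simp
    with \<open>g - g' \<in> _\<close> have "u - g' \<in> plus_forms {0} \<zeta> (Suc i)"
      unfolding plus_forms.simps adjoin_def by blast
    with \<open>g' \<in> J\<close> show ?case by blast
  qed (auto)
  with that show thesis by blast
qed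

lemma plus_forms_split_graded:
  assumes "hideal J" "u \<in> plus_forms J \<zeta> i" "u \<in> graded_piece k"
  obtains g where "g \<in> J" "g \<in> graded_piece k" "u - g \<in> plus_forms {0} \<zeta> i"
proof -
  obtain g where g: "g \<in> J" "u - g \<in> plus_forms {0} \<zeta> i"
    using assms(2) by (rule plus_forms_split)
  have "hcomp k (u - g) \<in> plus_forms {0} \<zeta> i"
    using g(2) by (intro hideal_hcomp hideal_plus_forms hideal_zero)
  then show thesis
    using that[of "hcomp k g"] hideal_hcomp[OF assms(1) g(1)] hcomp_graded[OF assms(3), of k]
    by (simp add: hcomp_diff)
qed

section \<open>Identification of the residual with the ideal of congruences\<close>

context forms_at_point
begin

definition f_del :: "'h \<Rightarrow> ('v, 'k) mpoly" where
  "f_del H = (\<Prod>H'\<in>A - {H}. linear_form (L H'))"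

abbreviation fl :: "('v, 'k) mpoly" where "fl \<equiv> deriv_along a f"

lemma deriv_f: "deriv_along v f = (\<Sum>H\<in>A. const_poly (dot (L H) v) * f_del H)"
  unfolding f_def f_del_def
  by (simp add: deriv_along_prod[OF finite_A] deriv_along_linear_form dot_def)

lemma f_graded: "f \<in> graded_piece (card A)"
  unfolding f_def by (rule graded_prod[OF linear_form_in_graded finite_A])

lemma fl_graded: "fl \<in> graded_piece (card A - 1)"
  by (rule deriv_along_graded[OF f_graded])

lemma card_A: "1 \<le> card A"
  using finite_A nonempty_A by (simp add: Suc_le_eq card_gt_0_iff)

lemma f_split: "H \<in> A \<Longrightarrow> f = linear_form (L H) * f_del H"
  unfolding f_def f_del_def by (rule prod.remove[OF finite_A])

lemma f_in_P: "H \<in> A \<Longrightarrow> f * p \<in> P H"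
  using form_mult_in_adjoin[OF subspace_zero, of "L H" "f_del H * p"] f_split
  by (simp add: mult.assoc)

text \<open>In the product rule every summand but the one of \<open>H\<close> keeps the form of
  \<open>H\<close> as a factor.\<close>

lemma deriv_mod:
  assumes "H \<in> A"
  shows "deriv_along v f - const_poly (dot (L H) v) * f_del H \<in> P H"
proof -
  have "deriv_along v f - const_poly (dot (L H) v) * f_del H =
      (\<Sum>H'\<in>A - {H}. const_poly (dot (L H') v) * f_del H')"
    unfolding deriv_f by (simp add: sum.remove[OF finite_A assms])
  also have "\<dots> \<in> P H"
  proof (rule rm.subspace_sum[OF subspace_P])
    fix H' assume H': "H' \<in> A - {H}"
    then have "f_del H' = linear_form (L H) * (\<Prod>H\<in>A - {H'} - {H}. linear_form (L H))"
      unfolding f_del_def using assms finite_A by (intro prod.remove) auto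
    then show "const_poly (dot (L H') v) * f_del H' \<in> P H"
      by (simp add: rm.subspace_scale[OF subspace_P] form_mult_in_adjoin[OF subspace_zero])
  qed
  finally show ?thesis .
qed

text \<open>The other forms are cancelled one at a time by derivations along directions inside
  \<open>H\<close>, which preserve \<open>P H\<close>.\<close>

lemma f_del_regular:
  assumes "H \<in> A" "f_del H * u \<in> P H"
  shows "u \<in> P H"
  using _ subspace_P _ assms(2)[unfolded f_del_def]
proof (rule linear_forms_prod_regular)
  show "finite (A - {H})" using finite_A by simp
  fix H' assume "H' \<in> A - {H}"
  then obtain w where "dot (L H') w = 1" "dot (L H) w = 0"
    using pairwise assms(1) by blast
  then show "\<exists>w. dot (L H') w = 1 \<and> (\<forall>p\<in>P H. deriv_along w p \<in> P H)"
    using P_stable by blast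
qed

lemma inter_P:
  assumes "\<And>H. H \<in> A \<Longrightarrow> u \<in> P H"
  obtains h where "u = f * h"
proof -
  have dual: "\<exists>w. dot (L x) w = 1 \<and> dot (L y) w = 0 \<and> (\<forall>p\<in>{0}. deriv_along w p \<in> {0})"
    if "x \<in> A" "y \<in> A" "x \<noteq> y" for x y using pairwise[OF that] by simp
  obtain h where "u - (\<Prod>x\<in>A. linear_form (L x)) * h \<in> {0}"
    by (rule inter_adjoin_linear_forms[of A "{0}" L u, OF finite_A subspace_zero dual assms])
  then have "u - f * h \<in> {0}" by (simp add: f_def)
  with that show thesis by simp
qed

text \<open>Modulo the form of \<open>H\<close>, the partial derivatives and \<open>fl\<close> are
  multiples of \<open>f_del H\<close>, which can be cancelled. So the congruence at \<open>H\<close>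
  says that this form divides \<open>g * partial_deriv i f - \<beta> * fl\<close>, and divisibility
  by all the forms is divisibility by \<open>f\<close>.\<close>

lemma residual_eq_R: "residual f a = R A"
proof -
  have sp: "rm.subspace {h. g * h \<in> ideal_gen {f, fl}}" for g
    unfolding ideal_gen_eq
    by (rule rm.subspaceI) (auto simp: rm.span_zero rm.span_add algebra_simps
      mult.left_commute[of g] intro: rm.span_scale)
  have eq: "(const_poly (L H i) * g - const_poly (dot (L H) a) * \<beta>) * f_del H -
      (g * partial_deriv i f - \<beta> * fl) \<in> P H" if "H \<in> A" for H i g \<beta>
  proof -
    have "dot (L H) (\<lambda>j. if j = i then 1 else 0) = L H i"
      by (simp add: dot_def if_distrib[of "\<lambda>t. _ * t"] cong: if_cong)
    then have 1: "partial_deriv i f - const_poly (L H i) * f_del H \<in> P H"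
      using deriv_mod[OF that, of "\<lambda>j. if j = i then 1 else 0"] by (simp add: deriv_along_unit)
    have 2: "fl - const_poly (dot (L H) a) * f_del H \<in> P H"
      by (rule deriv_mod[OF that])
    have "(const_poly (L H i) * g - const_poly (dot (L H) a) * \<beta>) * f_del H -
        (g * partial_deriv i f - \<beta> * fl) =
        \<beta> * (fl - const_poly (dot (L H) a) * f_del H) -
        g * (partial_deriv i f - const_poly (L H i) * f_del H)"
      by (simp add: algebra_simps)
    also have "\<dots> \<in> P H"
      by (intro rm.subspace_diff[OF subspace_P] rm.subspace_scale[OF subspace_P] 1 2)
    finally show ?thesis .
  qed
  have "g \<in> residual f a \<longleftrightarrow> (\<forall>i. g * partial_deriv i f \<in> ideal_gen {f, fl})" for g
  proof -
    have "g \<in> residual f a \<longleftrightarrow> jacobian_ideal f \<subseteq> {h. g * h \<in> ideal_gen {f, fl}}"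
      by (auto simp: residual_def colon_def)
    also have "\<dots> \<longleftrightarrow> range (\<lambda>i. partial_deriv i f) \<subseteq> {h. g * h \<in> ideal_gen {f, fl}}"
      unfolding jacobian_ideal_def ideal_gen_eq[symmetric]
      using sp[of g] rm.span_superset rm.span_minimal unfolding ideal_gen_eq by blast
    finally show ?thesis by auto
  qed
  also have "(\<forall>i. g * partial_deriv i f \<in> ideal_gen {f, fl}) \<longleftrightarrow> g \<in> R A" for g
  proof
    assume g: "\<forall>i. g * partial_deriv i f \<in> ideal_gen {f, fl}"
    have "\<exists>\<beta>. \<forall>H\<in>A. const_poly (L H i) * g - const_poly (dot (L H) a) * \<beta> \<in> P H" for i
    proof -
      from g[rule_format, of i] obtain \<alpha> \<beta> where "g * partial_deriv i f = \<alpha> * f + \<beta> * fl"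
        unfolding ideal_gen_eq span_pair by blast
      then have ab: "g * partial_deriv i f - \<beta> * fl = f * \<alpha>" by (simp add: mult.commute)
      have "const_poly (L H i) * g - const_poly (dot (L H) a) * \<beta> \<in> P H" if H: "H \<in> A" for H
      proof (rule f_del_regular[OF H])
        have "(const_poly (L H i) * g - const_poly (dot (L H) a) * \<beta>) * f_del H - f * \<alpha> + f * \<alpha> \<in> P H"
          using rm.subspace_add[OF subspace_P eq[OF H, of i g \<beta>, unfolded ab] f_in_P[OF H, of \<alpha>]] .
        then show "f_del H * (const_poly (L H i) * g - const_poly (dot (L H) a) * \<beta>) \<in> P H"
          by (simp add: mult.commute)
      qed
      then show ?thesis by blast
    qed
    then show "g \<in> R A" by (simp add: R_def)
  next
    assume "g \<in> R A"
    then obtain \<beta> where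
      \<beta>: "\<forall>i. \<forall>H\<in>A. const_poly (L H i) * g - const_poly (dot (L H) a) * \<beta> i \<in> P H"
      by (rule in_R_E)
    show "\<forall>i. g * partial_deriv i f \<in> ideal_gen {f, fl}"
    proof
      fix i
      have "g * partial_deriv i f - \<beta> i * fl \<in> P H" if H: "H \<in> A" for H
      proof -
        have "f_del H * (const_poly (L H i) * g - const_poly (dot (L H) a) * \<beta> i) -
          ((const_poly (L H i) * g - const_poly (dot (L H) a) * \<beta> i) * f_del H -
          (g * partial_deriv i f - \<beta> i * fl)) \<in> P H"
          by (rule rm.subspace_diff[OF subspace_P
                rm.subspace_scale[OF subspace_P \<beta>[rule_format, OF H]] eq[OF H]])
        then show ?thesis by (simp add: mult.commute)
      qed
      then obtain h where "g * partial_deriv i f - \<beta> i * fl = f * h" by (rule inter_P)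
      then have "g * partial_deriv i f = h * f + \<beta> i * fl" by (simp add: algebra_simps)
      then show "g * partial_deriv i f \<in> ideal_gen {f, fl}"
        unfolding ideal_gen_eq span_pair by blast
    qed
  qed
  finally show ?thesis by blast
qed

lemma fl_in_R: "fl \<in> R A"
proof -
  have "fl * h \<in> ideal_gen {f, fl}" for h
    unfolding ideal_gen_eq using rm.span_scale[OF rm.span_base, of fl "{f, fl}" h]
    by (simp add: mult.commute)
  then show ?thesis unfolding residual_eq_R[symmetric] residual_def colon_def by blast
qed

lemma eval_f: "eval_poly f a \<noteq> 0"
  using dot_a finite_A by (simp add: f_def eval_poly_prod eval_linear_form dot_def)

text \<open>Euler's formula at \<open>a\<close>: the value is \<open>card A\<close> times that of
  \<open>f\<close>, nonzero in characteristic zero.\<close>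

lemma eval_fl: "eval_poly fl a \<noteq> 0"
proof -
  have "eval_poly fl a = (\<Sum>H\<in>A. dot (L H) a * eval_poly (f_del H) a)"
    by (simp add: deriv_f eval_poly_sum eval_poly_mult)
  also have "\<dots> = (\<Sum>H\<in>A. eval_poly f a)"
    using f_split by (intro sum.cong) (simp_all add: eval_poly_mult eval_linear_form dot_def)
  also have "\<dots> = of_nat (card A) * eval_poly f a" by simp
  finally show ?thesis using eval_f card_A by simp
qed

text \<open>If \<open>\<beta> i\<close> are the witnesses for \<open>g \<in> R A\<close>, then both \<open>\<Sum>i. x\<^sub>i \<beta> i\<close> and
  \<open>g - \<Sum>i. a\<^sub>i \<beta> i\<close> are divisible by \<open>f\<close>, hence vanish in low degree.\<close>

lemma R_low_degree_vanishes:
  assumes g: "g \<in> R A" "g \<in> graded_piece j" and j: "j + 1 < card A"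
  shows "eval_poly g a = 0"
proof -
  from g(1) obtain \<beta> where
    \<beta>: "\<forall>i. \<forall>H\<in>A. const_poly (L H i) * g - const_poly (dot (L H) a) * \<beta> i \<in> P H"
    by (rule in_R_E)
  define x :: "'v \<Rightarrow> ('v, 'k) mpoly" where "x i = linear_form (\<lambda>j. if j = i then 1 else 0)" for i
  define s where "s = (\<Sum>i\<in>UNIV. x i * \<beta> i)"
  define t where "t = (\<Sum>i\<in>UNIV. const_poly (a i) * \<beta> i)"
  \<comment> \<open>The congruences are combined over \<open>i\<close>. With the variables as
    \<open>q\<close> the coefficient of \<open>g\<close> becomes the form of \<open>H\<close>; with
    the constants \<open>a i\<close> it becomes the value of that form at \<open>a\<close>.\<close>
  have comb: "(\<Sum>i\<in>UNIV. const_poly (L H i) * q i) * g - const_poly (dot (L H) a) * (\<Sum>i\<in>UNIV. q i * \<beta> i) \<in> P H"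
    if H: "H \<in> A" for H and q :: "'v \<Rightarrow> ('v, 'k) mpoly"
  proof -
    have "(\<Sum>i\<in>UNIV. const_poly (L H i) * q i) * g - const_poly (dot (L H) a) * (\<Sum>i\<in>UNIV. q i * \<beta> i) =
        (\<Sum>i\<in>UNIV. q i * (const_poly (L H i) * g - const_poly (dot (L H) a) * \<beta> i))"
      by (simp add: sum_distrib_left sum_distrib_right sum_subtractf algebra_simps)
    also have "\<dots> \<in> P H"
      by (intro rm.subspace_sum[OF subspace_P] rm.subspace_scale[OF subspace_P]) (use \<beta> H in auto)
    finally show ?thesis .
  qed
  have "s \<in> P H" if H: "H \<in> A" for H
  proof -
    have "linear_form (L H) = (\<Sum>i\<in>UNIV. const_poly (L H i) * x i)"
      by (simp add: x_def linear_form_unit const_poly_mult_single linear_form_def)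
    then have "linear_form (L H) * g - const_poly (dot (L H) a) * s \<in> P H"
      using comb[OF H, of x] by (simp add: s_def)
    from rm.subspace_diff[OF subspace_P form_mult_in_adjoin[OF subspace_zero, of "L H" g] this]
    have "const_poly (dot (L H) a) * s \<in> P H" by simp
    then show ?thesis by (rule subspace_const_cancel[OF subspace_P dot_a[OF H]])
  qed
  then obtain h where h: "s = f * h" by (rule inter_P)
  have "hcomp (j + 1) s = 0" unfolding h by (rule hcomp_low_mult[OF f_graded j])
  then have "(\<Sum>i\<in>UNIV. x i * hcomp j (\<beta> i)) = 0"
    by (simp add: s_def hcomp_sum x_def hcomp_mult_graded[OF linear_form_in_graded])
  \<comment> \<open>At the point \<open>a\<close> the variable \<open>x i\<close> takes the value
    \<open>a i\<close>, so the relation for \<open>s\<close> turns into the sum that gives the value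
    of the degree \<open>j\<close> part of \<open>t\<close>.\<close>
  then have 0: "(\<Sum>i\<in>UNIV. a i * eval_poly (hcomp j (\<beta> i)) a) = 0"
    by (auto dest!: arg_cong[of _ 0 "\<lambda>p. eval_poly p a"] simp: eval_poly_sum eval_poly_mult
      eval_linear_form x_def if_distrib[of "\<lambda>t. t * _"] cong: if_cong)
  have "g - t \<in> P H" if H: "H \<in> A" for H
  proof -
    have "(const_poly (dot (L H) a) :: ('v, 'k) mpoly) =
        (\<Sum>i\<in>UNIV. const_poly (L H i) * const_poly (a i))"
      by (simp add: dot_def const_poly_sum const_poly_mult)
    then have "const_poly (dot (L H) a) * (g - t) \<in> P H"
      using comb[OF H, of "\<lambda>i. const_poly (a i)"] by (simp add: t_def right_diff_distrib)
    then show ?thesis by (rule subspace_const_cancel[OF subspace_P dot_a[OF H]])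
  qed
  then obtain h' where h': "g - t = f * h'" by (rule inter_P)
  have "hcomp j (g - t) = 0" unfolding h' by (rule hcomp_low_mult[OF f_graded]) (use j in simp)
  then have "g = hcomp j t" using hcomp_graded[OF g(2), of j] by (simp add: hcomp_diff)
  also have "\<dots> = (\<Sum>i\<in>UNIV. const_poly (a i) * hcomp j (\<beta> i))"
    by (simp add: t_def hcomp_sum hcomp_const_mult)
  finally have "eval_poly g a = (\<Sum>i\<in>UNIV. a i * eval_poly (hcomp j (\<beta> i)) a)"
    by (simp add: eval_poly_sum eval_poly_mult)
  with 0 show ?thesis by simp
qed

text \<open>Unlike \<open>R_regular\<close>, this cancels the form in every degree. Modulo
  \<open>c\<close> the term with \<open>g\<close> disappears from the congruences, so each witness
  is divisible by all hyperplane forms modulo \<open>c\<close>, hence by \<open>f\<close>: it is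
  \<open>f * h\<close> plus a multiple of \<open>c\<close>. The summand \<open>f * h\<close> is
  irrelevant modulo every \<open>P H\<close>, and the cofactor of \<open>c\<close> is a witness for
  \<open>g\<close>.\<close>

lemma R_form_descent:
  assumes triple: "\<And>H H'. H \<in> A \<Longrightarrow> H' \<in> A \<Longrightarrow> H \<noteq> H' \<Longrightarrow>
      \<exists>w. dot (L H) w = 1 \<and> dot (L H') w = 0 \<and> dot c w = 0"
    and single: "\<And>H. H \<in> A \<Longrightarrow> \<exists>w. dot (L H) w = 0 \<and> dot c w = 1"
    and g: "linear_form c * g \<in> R A"
  shows "g \<in> R A"
proof -
  let ?z = "linear_form c"
  let ?Z = "adjoin {0} c"
  have subZ: "rm.subspace ?Z" by (rule subspace_adjoin[OF subspace_zero])
  from g obtain \<beta> where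
    \<beta>: "\<forall>i. \<forall>H\<in>A. const_poly (L H i) * (?z * g) - const_poly (dot (L H) a) * \<beta> i \<in> P H"
    by (rule in_R_E)
  have "\<exists>\<gamma>. \<forall>H\<in>A. const_poly (L H i) * g - const_poly (dot (L H) a) * \<gamma> \<in> P H" for i
  proof -
    have mem: "\<beta> i \<in> adjoin ?Z (L H)" if H: "H \<in> A" for H
    proof -
      obtain q where q: "const_poly (L H i) * (?z * g) - const_poly (dot (L H) a) * \<beta> i = linear_form (L H) * q"
        using \<beta> H by (auto simp: adjoin_def)
      have "const_poly (dot (L H) a) * \<beta> i = ?z * (const_poly (L H i) * g) - linear_form (L H) * q"
        using q by (simp add: algebra_simps)
      also have "\<dots> \<in> adjoin ?Z (L H)"
        by (intro rm.subspace_diff[OF subspace_adjoin[OF subZ]] form_mult_in_adjoin[OF subZ]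
            subsetD[OF adjoin_superset form_mult_in_adjoin[OF subspace_zero]])
      finally show ?thesis by (rule subspace_const_cancel[OF subspace_adjoin[OF subZ] dot_a[OF H]])
    qed
    have dual: "\<exists>w. dot (L x) w = 1 \<and> dot (L y) w = 0 \<and> (\<forall>p\<in>?Z. deriv_along w p \<in> ?Z)"
      if xy: "x \<in> A" "y \<in> A" "x \<noteq> y" for x y
    proof -
      obtain w where "dot (L x) w = 1" "dot (L y) w = 0" "dot c w = 0"
        using triple[OF xy] by blast
      then show ?thesis using adjoin_stable[of "{0}" w c] by auto
    qed
    obtain h where "\<beta> i - (\<Prod>x\<in>A. linear_form (L x)) * h \<in> ?Z"
      by (rule inter_adjoin_linear_forms[of A ?Z L "\<beta> i", OF finite_A subZ dual mem])
    then have "\<beta> i - f * h \<in> ?Z" by (simp add: f_def)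
    then obtain \<gamma> where \<gamma>: "\<beta> i = f * h + ?z * \<gamma>"
      by (auto simp: adjoin_def algebra_simps)
    have "const_poly (L H i) * g - const_poly (dot (L H) a) * \<gamma> \<in> P H" if H: "H \<in> A" for H
    proof -
      have "?z * (const_poly (L H i) * g - const_poly (dot (L H) a) * \<gamma>) =
          (const_poly (L H i) * (?z * g) - const_poly (dot (L H) a) * \<beta> i) +
          f * (const_poly (dot (L H) a) * h)"
        by (simp add: \<gamma> algebra_simps)
      also have "\<dots> \<in> P H"
        using \<beta> H by (intro rm.subspace_add[OF subspace_P] f_in_P) auto
      finally show ?thesis using P_regular single[OF H] by blast
    qed
    then show ?thesis by blast
  qed
  then show ?thesis by (simp add: R_def)
qed

subsection \<open>The intersection with the ideal of the dual point\<close>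

definition I :: "('v, 'k) mpoly set" where
  "I = R A \<inter> point_ideal a"

lemma hideal_I: "hideal I"
  unfolding I_def by (intro hideal_Int hideal_R hideal_point_ideal)

lemma subspace_I: "rm.subspace I"
  by (rule hideal_subspace[OF hideal_I])

lemma in_I_iff: "p \<in> graded_piece k \<Longrightarrow> p \<in> I \<longleftrightarrow> p \<in> R A \<and> eval_poly p a = 0"
  by (simp add: I_def in_point_ideal_iff)

lemma eval_I: "p \<in> I \<Longrightarrow> eval_poly p a = 0"
  by (simp add: I_def eval_point_ideal)

text \<open>On the degree \<open>k\<close> part of \<open>R A\<close>, \<open>I\<close> is the
  kernel of evaluation at \<open>a\<close>; the power of \<open>c\<close> lifts \<open>fl\<close>
  from degree \<open>card A - 1\<close> to degree \<open>k\<close> without making it vanish at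
  \<open>a\<close>. So \<open>t\<close> is a quotient of two values.\<close>

lemma R_mod_I:
  assumes c: "dot c a \<noteq> 0" and p: "p \<in> R A" "p \<in> graded_piece k" "card A \<le> k + 1"
  obtains t where "p - const_poly t * (linear_form c ^ (k + 1 - card A) * fl) \<in> I"
proof
  let ?q = "linear_form c ^ (k + 1 - card A) * fl"
  let ?t = "eval_poly p a / eval_poly ?q a"
  have "k + 1 - card A + (card A - 1) = k" using p(3) card_A by simp
  then have q: "?q \<in> graded_piece k"
    using graded_mult[OF graded_power[OF linear_form_in_graded[of c], of "k + 1 - card A"] fl_graded]
    by simp
  have q0: "eval_poly ?q a \<noteq> 0"
    using c eval_fl by (simp add: eval_poly_mult eval_poly_power eval_linear_form dot_def)
  have "p - const_poly ?t * ?q \<in> R A"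
    by (intro rm.subspace_diff[OF subspace_R] rm.subspace_scale[OF subspace_R] p fl_in_R)
  moreover have "eval_poly (p - const_poly ?t * ?q) a = 0"
    using q0 by (simp add: eval_poly_diff eval_poly_mult[of "const_poly _"])
  moreover have "p - const_poly ?t * ?q \<in> graded_piece k"
    by (intro graded_diff p graded_const_mult q)
  ultimately show "p - const_poly ?t * ?q \<in> I" using in_I_iff by blast
qed

text \<open>Above the degree of \<open>fl\<close> the correction term contains at least one factor
  \<open>c\<close>.\<close>

lemma R_high_degree:
  assumes c: "dot c a \<noteq> 0" and p: "p \<in> R A" "p \<in> graded_piece k" "card A \<le> k"
  shows "p \<in> adjoin I c"
proof -
  obtain t where t: "p - const_poly t * (linear_form c ^ (k + 1 - card A) * fl) \<in> I"
    using R_mod_I[OF c p(1,2)] p(3) by auto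
  have "k + 1 - card A = Suc (k - card A)" using p(3) by simp
  then have "p = (p - const_poly t * (linear_form c ^ (k + 1 - card A) * fl)) +
     linear_form c * (const_poly t * (linear_form c ^ (k - card A) * fl))"
    by (simp add: algebra_simps)
  with t show ?thesis unfolding adjoin_def by blast
qed

text \<open>For \<open>i = 0\<close>, an element of \<open>R A\<close> lies in \<open>I\<close> once
  it vanishes at \<open>a\<close>, where \<open>\<zeta> 0\<close> does not. For \<open>i > 0\<close>
  the form \<open>\<zeta> 0\<close> has been adjoined, and modulo it \<open>I\<close> and
  \<open>R A\<close> agree from degree \<open>card A\<close> on, one degree later than the bound for
  \<open>R A\<close>.\<close>

lemma I_regular:
  assumes flag: "\<And>B i. B \<subseteq> A \<Longrightarrow> fv.span (L ` B \<union> \<zeta> ` {..<i}) = UNIV \<or>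
       (\<exists>w. (\<forall>b\<in>L ` B. dot b w = 0) \<and> (\<forall>j<i. dot (\<zeta> j) w = 0) \<and> dot (\<zeta> i) w = 1)"
    and span: "fv.span (\<zeta> ` {..<N}) = UNIV" and c: "dot (\<zeta> 0) a \<noteq> 0"
    and u: "u \<in> graded_piece k" "card A \<le> k" "i < N"
      "linear_form (\<zeta> i) * u \<in> plus_forms I \<zeta> i"
  shows "u \<in> plus_forms I \<zeta> i"
proof -
  have "linear_form (\<zeta> i) * u \<in> plus_forms (R A) \<zeta> i"
    using u(4) plus_forms_mono[of I "R A" \<zeta> i] by (auto simp: I_def)
  then have uR: "u \<in> plus_forms (R A) \<zeta> i"
    using R_regular[OF flag span subset_refl u(1) _ u(3)] u(2) by auto
  show ?thesis
  proof (cases i)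
    case 0
    then have "eval_poly (linear_form (\<zeta> 0) * u) a = 0" using u(4) eval_I by simp
    then have "eval_poly u a = 0"
      using c by (simp add: eval_poly_mult eval_linear_form dot_def)
    then show ?thesis using uR 0 in_I_iff[OF u(1)] by simp
  next
    case (Suc i')
    obtain g where g: "g \<in> R A" "g \<in> graded_piece k" "u - g \<in> plus_forms {0} \<zeta> i"
      using plus_forms_split_graded[OF hideal_R uR u(1)] .
    have "plus_forms I \<zeta> (Suc 0) \<subseteq> plus_forms I \<zeta> (Suc j)" for j
      using adjoin_superset by (induction j) fastforce+
    then have "g \<in> plus_forms I \<zeta> i"
      using R_high_degree[OF c g(1,2) u(2)] Suc by auto
    moreover have "u - g \<in> plus_forms I \<zeta> i"
      using g(3) plus_forms_mono[of "{0}" I \<zeta> i] rm.subspace_0[OF subspace_I] by auto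
    ultimately have "g + (u - g) \<in> plus_forms I \<zeta> i"
      by (rule rm.subspace_add[OF subspace_plus_forms[OF subspace_I]])
    then show ?thesis by simp
  qed
qed

text \<open>Componentwise: below degree \<open>card A - 1\<close> residual elements vanish at
  \<open>a\<close>; from there on they are multiples of \<open>fl\<close> modulo
  \<open>I\<close>.\<close>

lemma span_I_fl: 
  assumes c: "dot c a \<noteq> 0"
  shows "rm.span (I \<union> {fl}) = R A"
proof
  show "rm.span (I \<union> {fl}) \<subseteq> R A"
    by (rule rm.span_minimal) (use fl_in_R subspace_R in \<open>auto simp: I_def\<close>)
  show "R A \<subseteq> rm.span (I \<union> {fl})"
  proof
    fix p assume p: "p \<in> R A"
    have "hcomp k p \<in> rm.span (I \<union> {fl})" for k
    proof (cases "card A \<le> k + 1")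
      case True
      obtain t where t: "hcomp k p - const_poly t * (linear_form c ^ (k + 1 - card A) * fl) \<in> I"
        using R_mod_I[OF c hideal_hcomp[OF hideal_R p] hcomp_in_graded True] .
      have "(hcomp k p - const_poly t * (linear_form c ^ (k + 1 - card A) * fl)) +
          const_poly t * (linear_form c ^ (k + 1 - card A) * fl) \<in> rm.span (I \<union> {fl})"
        using t by (intro rm.span_add rm.span_scale rm.span_base) auto
      then show ?thesis by simp
    next
      case False
      then have "hcomp k p \<in> I"
        using R_low_degree_vanishes[of "hcomp k p" k] hideal_hcomp[OF hideal_R p]
        by (simp add: in_I_iff[of _ k])
      then show ?thesis by (intro rm.span_base) simp
    qed
    moreover obtain K where "p = (\<Sum>k\<le>K. hcomp k p)" using mpoly_eq_sum_hcomp by metis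
    ultimately show "p \<in> rm.span (I \<union> {fl})" by (metis rm.span_sum)
  qed
qed

end

section \<open>Graded submodules of free modules\<close>

definition smul :: "'r::comm_ring_1 \<Rightarrow> (nat \<Rightarrow> 'r) \<Rightarrow> nat \<Rightarrow> 'r" where
  "smul p v = (\<lambda>j. p * v j)"

lemma smul_apply [simp]: "smul p v j = p * v j"
  by (simp add: smul_def)

interpretation fm: module "smul :: 'r::comm_ring_1 \<Rightarrow> _"
  by standard (auto simp: fun_eq_iff algebra_simps)

interpretation fmv: vector_space
  "\<lambda>c. smul (const_poly c :: ('v::finite, 'k::field) mpoly)"
  by standard (auto simp: fun_eq_iff const_poly_add const_poly_mult algebra_simps)

lemma sum_fun_apply: "(\<Sum>x\<in>X. h x) j = (\<Sum>x\<in>X. h x j)"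
  for h :: "'x \<Rightarrow> nat \<Rightarrow> 'r::comm_monoid_add"
  by (induction X rule: infinite_finite_induct) auto

text \<open>Degree \<open>k\<close> in the sum of the modules S(-a j). A coordinate whose shift
  exceeds \<open>k\<close> is forced to be zero.\<close>

definition homog :: "(nat \<Rightarrow> nat) \<Rightarrow> nat \<Rightarrow> (nat \<Rightarrow> ('v::finite, 'k::zero) mpoly) \<Rightarrow> bool" where
  "homog a k v \<longleftrightarrow> (\<forall>j. \<forall>m\<in>Poly_Mapping.keys (v j). a j + mdeg m = k)"

definition vcomp ::
  "(nat \<Rightarrow> nat) \<Rightarrow> nat \<Rightarrow> (nat \<Rightarrow> ('v::finite, 'k::zero) mpoly) \<Rightarrow> nat \<Rightarrow> ('v, 'k) mpoly" where
  "vcomp a k v = (\<lambda>j. if a j \<le> k then hcomp (k - a j) (v j) else 0)"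

lemma homog_iff: "homog a k v \<longleftrightarrow> (\<forall>j. if a j \<le> k then v j \<in> graded_piece (k - a j) else v j = 0)"
proof -
  have "(\<forall>m\<in>Poly_Mapping.keys (v j). a j + mdeg m = k) \<longleftrightarrow>
      (if a j \<le> k then v j \<in> graded_piece (k - a j) else v j = 0)" for j
  proof (cases "a j \<le> k")
    case True
    then have "a j + mdeg m = k \<longleftrightarrow> mdeg m = k - a j" for m :: "'a \<Rightarrow>\<^sub>0 nat" by auto
    with True show ?thesis by (simp add: graded_piece_def)
  next
    case False
    then have "a j + mdeg m \<noteq> k" for m :: "'a \<Rightarrow>\<^sub>0 nat" by simp
    moreover have "v j = 0" if "Poly_Mapping.keys (v j) = {}"
      using that by (intro poly_mapping_eqI) (auto simp: not_in_keys_iff_lookup_eq_zero[symmetric])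
    ultimately show ?thesis using False by auto
  qed
  then show ?thesis by (simp add: homog_def)
qed

lemma homog_vcomp [simp]: "homog a k (vcomp a k v)"
  by (simp add: homog_iff vcomp_def)

lemma vcomp_homog: "homog a k v \<Longrightarrow> vcomp a k' v = (if k' = k then v else 0)"
  unfolding homog_iff vcomp_def
  by (rule ext) (smt (verit, best) diff_diff_cancel eq_diff_iff hcomp_0 hcomp_graded zero_fun_apply)

lemma vcomp_0 [simp]: "vcomp a k 0 = 0"
  by (auto simp: vcomp_def fun_eq_iff)

lemma vcomp_add: "vcomp a k (u + v) = vcomp a k u + vcomp a k v"
  by (auto simp: vcomp_def fun_eq_iff hcomp_add)

lemma vcomp_smul_form:
  "vcomp a k (smul (linear_form c) v) = (if k = 0 then 0 else smul (linear_form c) (vcomp a (k - 1) v))"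
proof (cases k)
  case 0
  then show ?thesis
    by (auto simp: vcomp_def fun_eq_iff hcomp_mult_graded[OF linear_form_in_graded])
next
  case (Suc k')
  have "vcomp a k (smul (linear_form c) v) j = linear_form c * vcomp a k' v j" for j
    using hcomp_mult_graded[OF linear_form_in_graded, of "k - a j" c "v j"] Suc
    by (cases "a j = Suc k'") (auto simp: vcomp_def Suc_diff_le le_Suc_eq)
  with Suc show ?thesis by (auto simp: fun_eq_iff)
qed

lemma homog_smul_form: "homog a k v \<Longrightarrow> homog a (Suc k) (smul (linear_form c) v)"
  using vcomp_smul_form[of a "Suc k" c v] vcomp_homog[of a k v k] homog_vcomp[of a "Suc k"]
  by (metis diff_Suc_1 nat.distinct(1))

lemma homog_diff: "homog a k u \<Longrightarrow> homog a k v \<Longrightarrow> homog a k (u - v)"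
  for u v :: "nat \<Rightarrow> ('v::finite, 'k::ab_group_add) mpoly"
  unfolding homog_iff by (auto simp: graded_diff)

lemma free_mod_eq_sum_vcomp:
  assumes "v \<in> free_mod b"
  obtains K where "v = (\<Sum>k\<le>K. vcomp a k v)"
proof -
  have "\<exists>K. \<forall>k>K. hcomp k (v j) = 0" for j using mpoly_eq_sum_hcomp by metis
  then obtain K where K: "\<And>j k. k > K j \<Longrightarrow> hcomp k (v j) = 0" by metis
  define M where "M = (\<Sum>j<b. a j + K j)"
  have M: "a j + K j \<le> M" if "j < b" for j
    unfolding M_def using that by (intro member_le_sum) auto
  have "v j = (\<Sum>k\<le>M. vcomp a k v) j" for j
  proof (cases "j < b")
    case True
    show ?thesis
    proof (rule hcomp_eqI)
      fix i
      have "hcomp i (\<Sum>k\<le>M. vcomp a k v j) = (\<Sum>k\<le>M. hcomp i (vcomp a k v j))"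
        by (rule hcomp_sum)
      also have "\<dots> = (\<Sum>k\<le>M. if k = a j + i then hcomp i (v j) else 0)"
        by (intro sum.cong) (auto simp: vcomp_def hcomp_graded[OF hcomp_in_graded])
      also have "\<dots> = (if a j + i \<le> M then hcomp i (v j) else 0)" by simp
      also have "\<dots> = hcomp i (v j)" using M[OF True] K[of j i] by auto
      finally show "hcomp i (v j) = hcomp i ((\<Sum>k\<le>M. vcomp a k v) j)"
        by (simp add: sum_fun_apply)
    qed
  next
    case False
    then have "v j = 0" using assms by (simp add: free_mod_def)
    then have "vcomp a k v j = 0" for k by (auto simp: vcomp_def)
    with \<open>v j = 0\<close> show ?thesis by (simp add: sum_fun_apply)
  qed
  then have "v = (\<Sum>k\<le>M. vcomp a k v)" by blast
  then show thesis by (rule that)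
qed

definition gsub :: "nat \<Rightarrow> (nat \<Rightarrow> nat) \<Rightarrow> (nat \<Rightarrow> ('v::finite, 'k::comm_ring_1) mpoly) set \<Rightarrow> bool" where
  "gsub b a M \<longleftrightarrow> M \<subseteq> free_mod b \<and> fm.subspace M \<and> (\<forall>v\<in>M. \<forall>k. vcomp a k v \<in> M)"

lemma subspace_free_mod: "fm.subspace (free_mod b)"
  by (rule fm.subspaceI) (auto simp: free_mod_def)

lemma gsub_free_mod: "gsub b a (free_mod b)"
  by (auto simp: gsub_def subspace_free_mod) (auto simp: free_mod_def vcomp_def)

lemma gsub_subset:
  assumes "gsub b a M" "fm.subspace M'" "\<And>k v. v \<in> M \<Longrightarrow> homog a k v \<Longrightarrow> v \<in> M'"
  shows "M \<subseteq> M'"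
proof
  fix v assume v: "v \<in> M"
  then obtain K where "v = (\<Sum>k\<le>K. vcomp a k v)"
    using free_mod_eq_sum_vcomp assms(1) unfolding gsub_def by (metis subsetD)
  moreover have "vcomp a k v \<in> M'" for k
    using assms(1,3) v unfolding gsub_def by (metis homog_vcomp)
  ultimately show "v \<in> M'" using fm.subspace_sum[OF assms(2)] by metis
qed

text \<open>The submodule \<open>(\<zeta> 0, ..., \<zeta> (i - 1)) M\<close>. For \<open>M\<close>
  inside a free module \<open>F\<close>, the gap between it and the intersection of \<open>M\<close>
  with \<open>zsub F \<zeta> i\<close> is what Tor measures.\<close>

primrec zsub :: "(nat \<Rightarrow> ('v::finite, 'k::comm_ring_1) mpoly) set \<Rightarrow> (nat \<Rightarrow> 'v \<Rightarrow> 'k) \<Rightarrow> nat \<Rightarrow>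
    (nat \<Rightarrow> ('v, 'k) mpoly) set" where
  "zsub M \<zeta> 0 = {0}"
| "zsub M \<zeta> (Suc i) = {g + smul (linear_form (\<zeta> i)) n |g n. g \<in> zsub M \<zeta> i \<and> n \<in> M}"

lemma zsub_SucE:
  assumes "u \<in> zsub M \<zeta> (Suc i)"
  obtains g n where "u = g + smul (linear_form (\<zeta> i)) n" "g \<in> zsub M \<zeta> i" "n \<in> M"
  using assms by auto

lemma zsub_SucI: "g \<in> zsub M \<zeta> i \<Longrightarrow> n \<in> M \<Longrightarrow> g + smul (linear_form (\<zeta> i)) n \<in> zsub M \<zeta> (Suc i)"
  by auto

lemma subspace_zsub:
  assumes "fm.subspace M"
  shows "fm.subspace (zsub M \<zeta> i)"
proof (induction i)
  case 0
  show ?case by (rule fm.subspaceI) auto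
next
  case (Suc i)
  let ?z = "linear_form (\<zeta> i)"
  show ?case
  proof (rule fm.subspaceI)
    show "0 \<in> zsub M \<zeta> (Suc i)"
      using zsub_SucI[OF fm.subspace_0[OF Suc] fm.subspace_0[OF assms]] by simp
  next
    fix u v assume "u \<in> zsub M \<zeta> (Suc i)" "v \<in> zsub M \<zeta> (Suc i)"
    then obtain g n g' n' where *: "u = g + smul ?z n" "g \<in> zsub M \<zeta> i" "n \<in> M"
        "v = g' + smul ?z n'" "g' \<in> zsub M \<zeta> i" "n' \<in> M"
      by (elim zsub_SucE) blast
    have eq: "u + v = (g + g') + smul ?z (n + n')"
      unfolding * fm.scale_right_distrib by (simp only: ac_simps)
    show "u + v \<in> zsub M \<zeta> (Suc i)"
      unfolding eq by (intro zsub_SucI fm.subspace_add[OF Suc] fm.subspace_add[OF assms] *)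
  next
    fix p u assume "u \<in> zsub M \<zeta> (Suc i)"
    then obtain g n where *: "u = g + smul ?z n" "g \<in> zsub M \<zeta> i" "n \<in> M"
      by (rule zsub_SucE)
    have eq: "smul p u = smul p g + smul ?z (smul p n)"
      by (auto simp: * fun_eq_iff algebra_simps)
    show "smul p u \<in> zsub M \<zeta> (Suc i)"
      unfolding eq by (intro zsub_SucI fm.subspace_scale[OF Suc] fm.subspace_scale[OF assms] *)
  qed
qed

lemma zsub_subset: "fm.subspace M \<Longrightarrow> zsub M \<zeta> i \<subseteq> M"
  by (induction i) (auto simp: fm.subspace_0 intro!: fm.subspace_add fm.subspace_scale)

lemma zsub_mono: "M \<subseteq> M' \<Longrightarrow> zsub M \<zeta> i \<subseteq> zsub M' \<zeta> i"
  by (induction i) auto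

lemma vcomp_zsub: "gsub b a M \<Longrightarrow> u \<in> zsub M \<zeta> i \<Longrightarrow> vcomp a k u \<in> zsub M \<zeta> i"
proof (induction i arbitrary: u k)
  case (Suc i)
  obtain g n where *: "u = g + smul (linear_form (\<zeta> i)) n" "g \<in> zsub M \<zeta> i" "n \<in> M"
    using Suc.prems(2) by (rule zsub_SucE)
  have eq: "vcomp a k u = vcomp a k g + smul (linear_form (\<zeta> i)) (if k = 0 then 0 else vcomp a (k - 1) n)"
    unfolding *(1) vcomp_add vcomp_smul_form by simp
  have "(if k = 0 then 0 else vcomp a (k - 1) n) \<in> M"
    using Suc.prems(1) *(3) by (auto simp: gsub_def fm.subspace_0)
  then show ?case
    unfolding eq by (intro zsub_SucI Suc.IH Suc.prems(1) *(2))
qed simp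

lemma zsub_homogE:
  assumes "gsub b a M" "u \<in> zsub M \<zeta> (Suc i)" "homog a (Suc k) u"
  obtains g n where "u = g + smul (linear_form (\<zeta> i)) n" "g \<in> zsub M \<zeta> i" "n \<in> M"
    "homog a (Suc k) g" "homog a k n"
proof -
  obtain g n where *: "u = g + smul (linear_form (\<zeta> i)) n" "g \<in> zsub M \<zeta> i" "n \<in> M"
    using assms(2) by (rule zsub_SucE)
  have "u = vcomp a (Suc k) u" using vcomp_homog[OF assms(3)] by simp
  also have "\<dots> = vcomp a (Suc k) g + smul (linear_form (\<zeta> i)) (vcomp a k n)"
    unfolding *(1) vcomp_add vcomp_smul_form by simp
  finally show thesis
    using that vcomp_zsub[OF assms(1) *(2)] *(3) assms(1) by (metis gsub_def homog_vcomp)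
qed

text \<open>Coefficients of linear forms have one degree less; this is the passage from
  \<open>k\<close> to \<open>k + 1\<close> in a graded Nakayama argument.\<close>

lemma zsub_homog_induct:
  assumes "gsub b a M" "fm.subspace S" "\<And>n. n \<in> M \<Longrightarrow> homog a k n \<Longrightarrow> n \<in> S"
    and "u \<in> zsub M \<zeta> i" "homog a (Suc k) u"
  shows "u \<in> S"
  using assms(4,5)
proof (induction i arbitrary: u)
  case 0
  then have "u = 0" by simp
  then show ?case using fm.subspace_0[OF assms(2)] by (simp only:)
next
  case (Suc i)
  obtain g n where *: "u = g + smul (linear_form (\<zeta> i)) n" "g \<in> zsub M \<zeta> i" "n \<in> M"
    "homog a (Suc k) g" "homog a k n"
    using zsub_homogE[OF assms(1) Suc.prems] .
  show ?case
    unfolding *(1) by (intro fm.subspace_add[OF assms(2)] fm.subspace_scale[OF assms(2)] Suc.IH assms(3) *)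
qed

lemma zsub_free_mod_iff:
  "v \<in> zsub (free_mod b) \<zeta> i \<longleftrightarrow> v \<in> free_mod b \<and> (\<forall>j. v j \<in> plus_forms {0} \<zeta> i)"
proof (induction i arbitrary: v)
  case 0
  have "(0::nat \<Rightarrow> ('a, 'b) mpoly) \<in> free_mod b" by (simp add: free_mod_def)
  moreover have "(\<forall>j. v j \<in> plus_forms {0} \<zeta> 0) \<longleftrightarrow> v = 0" by (simp add: fun_eq_iff)
  ultimately show ?case unfolding zsub.simps by blast
next
  case (Suc i)
  let ?z = "linear_form (\<zeta> i)"
  show ?case
  proof
    assume "v \<in> zsub (free_mod b) \<zeta> (Suc i)"
    then obtain g n where *: "v = g + smul ?z n" "g \<in> zsub (free_mod b) \<zeta> i" "n \<in> free_mod b"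
      by (rule zsub_SucE)
    then have "g \<in> free_mod b" "\<And>j. g j \<in> plus_forms {0} \<zeta> i" using Suc.IH by auto
    with *(1,3) show "v \<in> free_mod b \<and> (\<forall>j. v j \<in> plus_forms {0} \<zeta> (Suc i))"
      by (auto simp: free_mod_def adjoin_def)
  next
    assume v: "v \<in> free_mod b \<and> (\<forall>j. v j \<in> plus_forms {0} \<zeta> (Suc i))"
    then have "\<exists>g h. v j = g + ?z * h \<and> g \<in> plus_forms {0} \<zeta> i" for j
      by (auto simp: adjoin_def)
    then obtain g h where gh: "\<And>j. v j = g j + ?z * h j" "\<And>j. g j \<in> plus_forms {0} \<zeta> i"
      by metis
    define g' where "g' j = (if j < b then g j else 0)" for j
    define h' where "h' j = (if j < b then h j else 0)" for j
    have "g' j \<in> plus_forms {0} \<zeta> i" for j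
      using gh(2) rm.subspace_0[OF subspace_plus_forms[OF subspace_zero]] by (auto simp: g'_def)
    then have "g' \<in> zsub (free_mod b) \<zeta> i"
      using Suc.IH by (auto simp: free_mod_def g'_def)
    moreover have "h' \<in> free_mod b" by (simp add: free_mod_def h'_def)
    moreover have "v = g' + smul ?z h'"
      using v gh(1) by (auto simp: fun_eq_iff g'_def h'_def free_mod_def)
    ultimately show "v \<in> zsub (free_mod b) \<zeta> (Suc i)" using zsub_SucI by metis
  qed
qed

subsection \<open>Homogeneous maps of free modules\<close>

text \<open>The map of free modules with \<open>g k\<close> as the image of the \<open>k\<close>-th
  basis vector. The matrix is stored by columns, transposed against
  \<open>mat_apply\<close>.\<close>

definition lincomb :: "nat \<Rightarrow> (nat \<Rightarrow> nat \<Rightarrow> 'r::comm_ring_1) \<Rightarrow> (nat \<Rightarrow> 'r) \<Rightarrow> nat \<Rightarrow> 'r" where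
  "lincomb c g v = (\<Sum>k<c. smul (v k) (g k))"

lemma lincomb_apply: "lincomb c g v j = (\<Sum>k<c. v k * g k j)"
  by (simp add: lincomb_def sum_fun_apply)

lemma lincomb_add: "lincomb c g (u + v) = lincomb c g u + lincomb c g v"
  by (auto simp: fun_eq_iff lincomb_apply algebra_simps sum.distrib)

lemma lincomb_diff: "lincomb c g (u - v) = lincomb c g u - lincomb c g v"
  by (auto simp: fun_eq_iff lincomb_apply algebra_simps sum_subtractf)

lemma lincomb_smul: "lincomb c g (smul p v) = smul p (lincomb c g v)"
  by (auto simp: fun_eq_iff lincomb_apply algebra_simps sum_distrib_left)

lemma lincomb_0 [simp]: "lincomb c g 0 = 0"
  by (auto simp: fun_eq_iff lincomb_apply)

lemma vcomp_lincomb: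
  assumes "\<And>j. j < c \<Longrightarrow> homog a (s j) (g j)"
  shows "vcomp a k (lincomb c g v) = lincomb c g (vcomp s k v)"
proof
  fix t
  have "(if a t \<le> k then hcomp (k - a t) (v j * g j t) else 0) = vcomp s k v j * g j t"
    if "j < c" for j
  proof (cases "a t \<le> s j")
    case True
    then have g: "g j t \<in> graded_piece (s j - a t)"
      using assms[OF that] by (auto simp: homog_iff)
    have "hcomp (k - a t) (g j t * v j) =
        (if s j - a t \<le> k - a t then g j t * hcomp (k - a t - (s j - a t)) (v j) else 0)"
      by (rule hcomp_mult_graded[OF g])
    then show ?thesis
      using True by (auto simp: vcomp_def mult.commute)
  next
    case False
    then have "g j t = 0" using assms[OF that] by (simp add: homog_iff)
    then show ?thesis by simp
  qed
  then show "vcomp a k (lincomb c g v) t = lincomb c g (vcomp s k v) t"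
    by (auto simp: vcomp_def lincomb_apply hcomp_sum)
qed

lemma lincomb_image_eq_span: "lincomb c g ` free_mod c = fm.span (g ` {..<c})"
proof
  show "lincomb c g ` free_mod c \<subseteq> fm.span (g ` {..<c})"
    unfolding lincomb_def
    by (intro image_subsetI fm.span_sum fm.span_scale, rule fm.span_base) simp
  have "fm.subspace (lincomb c g ` free_mod c)"
  proof (rule fm.subspaceI)
    show "0 \<in> lincomb c g ` free_mod c"
      by (rule image_eqI[of _ _ 0]) (simp_all add: free_mod_def)
  next
    fix u v assume "u \<in> lincomb c g ` free_mod c" "v \<in> lincomb c g ` free_mod c"
    then obtain u' v' where *: "u = lincomb c g u'" "v = lincomb c g v'" "u' \<in> free_mod c" "v' \<in> free_mod c"
      by blast
    show "u + v \<in> lincomb c g ` free_mod c"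
      unfolding * lincomb_add[symmetric] by (intro imageI fm.subspace_add[OF subspace_free_mod] *)
  next
    fix p u assume "u \<in> lincomb c g ` free_mod c"
    then obtain u' where *: "u = lincomb c g u'" "u' \<in> free_mod c" by blast
    show "smul p u \<in> lincomb c g ` free_mod c"
      unfolding * lincomb_smul[symmetric] by (intro imageI fm.subspace_scale[OF subspace_free_mod] *)
  qed
  moreover have "g k \<in> lincomb c g ` free_mod c" if "k < c" for k
  proof
    show "(\<lambda>j. if j = k then 1 else 0) \<in> free_mod c" using that by (simp add: free_mod_def)
    show "g k = lincomb c g (\<lambda>j. if j = k then 1 else 0)"
      using that by (auto simp: fun_eq_iff lincomb_apply if_distrib[of "\<lambda>t. t * _"] cong: if_cong)
  qed
  ultimately show "fm.span (g ` {..<c}) \<subseteq> lincomb c g ` free_mod c"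
    by (intro fm.span_minimal) auto
qed

lemma lincomb_zsub: "lincomb c g ` free_mod c = M \<Longrightarrow> lincomb c g ` zsub (free_mod c) \<zeta> i = zsub M \<zeta> i"
proof (induction i)
  case (Suc i)
  show ?case
  proof
    show "lincomb c g ` zsub (free_mod c) \<zeta> (Suc i) \<subseteq> zsub M \<zeta> (Suc i)"
    proof
      fix u assume "u \<in> lincomb c g ` zsub (free_mod c) \<zeta> (Suc i)"
      then obtain v where v: "u = lincomb c g v" "v \<in> zsub (free_mod c) \<zeta> (Suc i)" by blast
      obtain h n where *: "v = h + smul (linear_form (\<zeta> i)) n" "h \<in> zsub (free_mod c) \<zeta> i" "n \<in> free_mod c"
        using v(2) by (rule zsub_SucE)
      then have "lincomb c g h \<in> zsub M \<zeta> i" "lincomb c g n \<in> M" using Suc by blast+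
      then show "u \<in> zsub M \<zeta> (Suc i)"
        unfolding v(1) *(1) lincomb_add lincomb_smul by (rule zsub_SucI)
    qed
    show "zsub M \<zeta> (Suc i) \<subseteq> lincomb c g ` zsub (free_mod c) \<zeta> (Suc i)"
    proof
      fix u assume "u \<in> zsub M \<zeta> (Suc i)"
      then obtain h n where *: "u = h + smul (linear_form (\<zeta> i)) n" "h \<in> zsub M \<zeta> i" "n \<in> M"
        by (rule zsub_SucE)
      then obtain h' n' where "h = lincomb c g h'" "n = lincomb c g n'"
        "h' \<in> zsub (free_mod c) \<zeta> i" "n' \<in> free_mod c" using Suc by blast
      then have "u = lincomb c g (h' + smul (linear_form (\<zeta> i)) n')"
        "h' + smul (linear_form (\<zeta> i)) n' \<in> zsub (free_mod c) \<zeta> (Suc i)"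
        by (simp_all only: *(1) lincomb_add lincomb_smul zsub_SucI)
      then show "u \<in> lincomb c g ` zsub (free_mod c) \<zeta> (Suc i)" by blast
    qed
  qed
qed simp

section \<open>Minimal resolutions of submodules that are regular along a flag\<close>

lemma homog_span_monomials:
  fixes v :: "nat \<Rightarrow> ('v::finite, 'k::field) mpoly"
  assumes "v \<in> free_mod b" "homog a k v"
  shows "v \<in> fmv.span (\<Union>j<b. (\<lambda>m i. if i = j then Poly_Mapping.single m 1 else 0) ` {m. mdeg m = k - a j})"
    (is "v \<in> fmv.span ?E")
proof -
  let ?e = "\<lambda>j m i. if i = j then Poly_Mapping.single m 1 else 0 :: ('v, 'k) mpoly"
  have "v = (\<Sum>j<b. \<Sum>m\<in>Poly_Mapping.keys (v j). smul (const_poly (Poly_Mapping.lookup (v j) m)) (?e j m))"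
  proof
    fix i
    have "(\<Sum>j<b. \<Sum>m\<in>Poly_Mapping.keys (v j). const_poly (Poly_Mapping.lookup (v j) m) * ?e j m i) =
       (\<Sum>j<b. if j = i then v j else 0)"
    proof (rule sum.cong[OF refl])
      fix j
      show "(\<Sum>m\<in>Poly_Mapping.keys (v j). const_poly (Poly_Mapping.lookup (v j) m) * ?e j m i) =
        (if j = i then v j else 0)"
        using mpoly_sum_singles[of "v j"]
        by (cases "i = j") (simp_all add: const_poly_mult_single)
    qed
    also have "\<dots> = v i" using assms(1) by (simp add: free_mod_def)
    finally show "v i = (\<Sum>j<b. \<Sum>m\<in>Poly_Mapping.keys (v j).
        smul (const_poly (Poly_Mapping.lookup (v j) m)) (?e j m)) i"
      by (simp add: sum_fun_apply)
  qed
  also have "\<dots> \<in> fmv.span ?E"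
  proof (intro fmv.span_sum fmv.span_scale)
    fix j m assume j: "j \<in> {..<b}" and m: "m \<in> Poly_Mapping.keys (v j)"
    have "mdeg m = k - a j" using assms(2) m unfolding homog_def by (metis add_diff_cancel_left')
    then show "?e j m \<in> fmv.span ?E" using j by (intro fmv.span_base) auto
  qed
  finally show ?thesis .
qed

locale flag =
  fixes \<zeta> :: "nat \<Rightarrow> 'v::finite \<Rightarrow> 'k::field_char_0"
  assumes dual: "i < CARD('v) \<Longrightarrow> \<exists>w. (\<forall>j<i. dot (\<zeta> j) w = 0) \<and> dot (\<zeta> i) w = 1"
    and span: "fv.span (\<zeta> ` {..<CARD('v)}) = UNIV"
begin

lemma forms_regular:
  assumes "i < CARD('v)" "linear_form (\<zeta> i) * p \<in> plus_forms {0} \<zeta> i"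
  shows "p \<in> plus_forms {0} \<zeta> i"
proof -
  obtain w where w: "\<And>j. j < i \<Longrightarrow> dot (\<zeta> j) w = 0" "dot (\<zeta> i) w = 1" using dual[OF assms(1)] by blast
  show ?thesis
  proof (rule linear_form_regular[OF subspace_plus_forms[OF subspace_zero] _ w(2) assms(2)])
    show "deriv_along w p \<in> plus_forms {0} \<zeta> i" if "p \<in> plus_forms {0} \<zeta> i" for p
      by (rule plus_forms_stable[OF _ w(1) that]) auto
  qed
qed

lemma free_mod_regular:
  assumes "i < CARD('v)" "v \<in> free_mod b" "smul (linear_form (\<zeta> i)) v \<in> zsub (free_mod b) \<zeta> i"
  shows "v \<in> zsub (free_mod b) \<zeta> i"
  using assms forms_regular unfolding zsub_free_mod_iff by auto

lemma free_mod_positive: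
  assumes v: "v \<in> free_mod b" "homog a k v" and a: "\<And>j. j < b \<Longrightarrow> a j < k"
  shows "v \<in> zsub (free_mod b) \<zeta> CARD('v)"
  unfolding zsub_free_mod_iff
proof (intro conjI allI v(1))
  fix j
  show "v j \<in> plus_forms {0} \<zeta> CARD('v)"
  proof (cases "j < b")
    case True
    then have "v j \<in> graded_piece (k - a j)" using v(2) a[of j] by (auto simp: homog_iff)
    then show ?thesis by (rule in_plus_forms_span[OF subspace_zero span]) (use a[OF True] in simp)
  next
    case False
    then have "v j = 0" using v(1) by (simp add: free_mod_def)
    then show ?thesis using rm.subspace_0[OF subspace_plus_forms[OF subspace_zero]] by simp
  qed
qed

text \<open>For \<open>M \<subseteq> F\<close> this says that \<open>Tor\<^sub>1(F/M, S/(\<zeta> 0, \<dots>, \<zeta> (i - 1)))\<close> vanishes in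
  degrees greater than \<open>e\<close>, for all \<open>i\<close>. It yields that \<open>M\<close> is generated in degrees at most
  \<open>e\<close>, and it passes to the syzygies of \<open>M\<close> with \<open>e\<close> replaced by \<open>e + 1\<close>.\<close>

definition tame :: "nat \<Rightarrow> (nat \<Rightarrow> nat) \<Rightarrow> (nat \<Rightarrow> ('v, 'k) mpoly) set \<Rightarrow> nat \<Rightarrow> bool" where
  "tame b a M e \<longleftrightarrow> (\<forall>k u i. u \<in> M \<longrightarrow> homog a k u \<longrightarrow> e < k \<longrightarrow> i \<le> CARD('v) \<longrightarrow>
     u \<in> zsub (free_mod b) \<zeta> i \<longrightarrow> u \<in> zsub M \<zeta> i)"

lemma tameD:
  "tame b a M e \<Longrightarrow> u \<in> M \<Longrightarrow> homog a k u \<Longrightarrow> e < k \<Longrightarrow> i \<le> CARD('v) \<Longrightarrow>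
     u \<in> zsub (free_mod b) \<zeta> i \<Longrightarrow> u \<in> zsub M \<zeta> i"
  unfolding tame_def by blast

text \<open>Beyond degree \<open>e\<close> every element of \<open>M\<close> lies in the maximal
  ideal times the free module, because all shifts are at most \<open>e\<close>. Tameness for the
  full flag puts it into the maximal ideal times \<open>M\<close>, and the degree drops.\<close>

lemma tame_generated:
  assumes M: "gsub b a M" "tame b a M e" and a: "\<And>j. j < b \<Longrightarrow> a j \<le> e"
  shows "fm.span {v \<in> M. \<exists>k\<le>e. homog a k v} = M" (is "fm.span ?G = M")
proof
  show "fm.span ?G \<subseteq> M" using M(1) by (intro fm.span_minimal) (auto simp: gsub_def)
  show "M \<subseteq> fm.span ?G"
  proof (rule gsub_subset[OF M(1) fm.subspace_span])
    fix k v assume "v \<in> M" "homog a k v"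
    then show "v \<in> fm.span ?G"
    proof (induction k arbitrary: v)
      case 0
      then show ?case by (intro fm.span_base) auto
    next
      case (Suc k)
      show ?case
      proof (cases "Suc k \<le> e")
        case True
        then show ?thesis using Suc.prems by (intro fm.span_base) auto
      next
        case False
        have "v \<in> zsub (free_mod b) \<zeta> CARD('v)"
        proof (rule free_mod_positive)
          show "v \<in> free_mod b" using Suc.prems M(1) by (auto simp: gsub_def)
          show "a j < Suc k" if "j < b" for j using a[OF that] False by simp
        qed (rule Suc.prems)
        then have "v \<in> zsub M \<zeta> CARD('v)"
          using tameD[OF M(2) Suc.prems] False by simp
        with M(1) fm.subspace_span Suc.IH show ?thesis
          by (rule zsub_homog_induct[OF _ _ _ _ Suc.prems(2)])
      qed
    qed
  qed
qed

lemma fm_span_superset_fmv_span: "fmv.span B \<subseteq> fm.span (B :: (nat \<Rightarrow> ('v, 'k) mpoly) set)"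
  by (rule fmv.span_minimal[OF fm.span_superset])
    (auto intro!: fmv.subspaceI fm.span_zero fm.span_add fm.span_scale)

text \<open>Bounded degrees leave finitely many graded pieces, each of finite dimension over the
  field, and vector space bases of these generate.\<close>

lemma tame_finite_generators:
  assumes M: "gsub b a M" "tame b a M e" and a: "\<And>j. j < b \<Longrightarrow> a j \<le> e"
  obtains G where "finite G" "G \<subseteq> M" "\<forall>v\<in>G. \<exists>k\<le>e. homog a k v" "fm.span G = M"
proof -
  define Mk where "Mk k = {v \<in> M. homog a k v}" for k
  have "\<exists>B. finite B \<and> B \<subseteq> Mk k \<and> Mk k \<subseteq> fmv.span B" for k
  proof -
    obtain B where B: "B \<subseteq> Mk k" "fmv.independent B" "Mk k \<subseteq> fmv.span B"
      using fmv.maximal_independent_subset by blast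
    let ?E = "\<Union>j<b. (\<lambda>m i. if i = j then Poly_Mapping.single m 1 else 0 :: ('v, 'k) mpoly) ` {m. mdeg m = k - a j}"
    have "B \<subseteq> fmv.span ?E"
    proof
      fix v assume "v \<in> B"
      then have "v \<in> free_mod b" "homog a k v" using B(1) M(1) by (auto simp: Mk_def gsub_def)
      then show "v \<in> fmv.span ?E" by (rule homog_span_monomials)
    qed
    moreover have "finite ?E" by (intro finite_UN_I finite_imageI finite_mdeg) simp
    ultimately have "finite B" using fmv.independent_span_bound[OF _ B(2)] by blast
    with B show ?thesis by blast
  qed
  then obtain B where B: "\<And>k. finite (B k)" "\<And>k. B k \<subseteq> Mk k" "\<And>k. Mk k \<subseteq> fmv.span (B k)" by metis
  let ?G = "\<Union>k\<le>e. B k"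
  have 1: "{v \<in> M. \<exists>k\<le>e. homog a k v} \<subseteq> fm.span ?G"
  proof
    fix v assume "v \<in> {v \<in> M. \<exists>k\<le>e. homog a k v}"
    then obtain k where k: "k \<le> e" "v \<in> Mk k" by (auto simp: Mk_def)
    then have "v \<in> fm.span (B k)" using B(3) fm_span_superset_fmv_span by blast
    moreover have "fm.span (B k) \<subseteq> fm.span ?G" using k by (intro fm.span_mono) auto
    ultimately show "v \<in> fm.span ?G" by blast
  qed
  have "M \<subseteq> fm.span ?G"
    using fm.span_minimal[OF 1 fm.subspace_span] tame_generated[OF M a] by simp
  moreover have "fm.span ?G \<subseteq> M"
    using M(1) B(2) by (intro fm.span_minimal) (auto simp: Mk_def gsub_def)
  ultimately have "fm.span ?G = M" by blast
  moreover have "finite ?G" "?G \<subseteq> M" "\<forall>v\<in>?G. \<exists>k\<le>e. homog a k v"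
    using B(1,2) by (auto simp: Mk_def)
  ultimately show thesis by (intro that)
qed

text \<open>A generating set of least cardinality admits no relation with a unit coefficient.\<close>

lemma minimal_generators:
  assumes M: "gsub b a M" "tame b a M e" and a: "\<And>j. j < b \<Longrightarrow> a j \<le> e"
  obtains c s g where "\<And>j. j < c \<Longrightarrow> g j \<in> M" "\<And>j. j < c \<Longrightarrow> homog a (s j) (g j)"
    "\<And>j. j < c \<Longrightarrow> s j \<le> e" "lincomb c g ` free_mod c = M"
    "\<And>v j. v \<in> free_mod c \<Longrightarrow> lincomb c g v = 0 \<Longrightarrow> j < c \<Longrightarrow> Poly_Mapping.lookup (v j) 0 = 0"
proof -
  define Gen where "Gen G \<longleftrightarrow> finite G \<and> G \<subseteq> M \<and> (\<forall>v\<in>G. \<exists>k\<le>e. homog a k v) \<and> fm.span G = M" for G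
  obtain G0 where "finite G0" "G0 \<subseteq> M" "\<forall>v\<in>G0. \<exists>k\<le>e. homog a k v" "fm.span G0 = M"
    using tame_finite_generators[OF M a] .
  then have "Gen G0" by (simp add: Gen_def)
  from ex_has_least_nat[of Gen, OF this, of card]
  obtain G where G: "Gen G" and least: "\<And>G'. Gen G' \<Longrightarrow> card G \<le> card G'" by blast
  have "finite G" using G by (simp add: Gen_def)
  then obtain g where g: "bij_betw g {0..<card G} G"
    using ex_bij_betw_nat_finite by blast
  define c where "c = card G"
  have gG: "g ` {..<c} = G" and inj: "inj_on g {..<c}"
    using g by (auto simp: bij_betw_def c_def atLeast0LessThan)
  have "\<forall>j. \<exists>k. j < c \<longrightarrow> k \<le> e \<and> homog a k (g j)" using G gG unfolding Gen_def by blast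
  then obtain s where s: "\<And>j. j < c \<Longrightarrow> s j \<le> e" "\<And>j. j < c \<Longrightarrow> homog a (s j) (g j)" by metis
  have im: "lincomb c g ` free_mod c = M"
    unfolding lincomb_image_eq_span gG using G by (simp add: Gen_def)
  have "Poly_Mapping.lookup (v i) 0 = 0" if v: "v \<in> free_mod c" "lincomb c g v = 0" and i: "i < c" for v i
  proof (rule ccontr)
    let ?t = "Poly_Mapping.lookup (v i) 0"
    assume t: "?t \<noteq> 0"
    \<comment> \<open>In the component of degree \<open>s i\<close> the \<open>i\<close>-th
      coefficient is exactly the constant \<open>?t\<close>. Its inverse exhibits \<open>g i\<close>
      as a combination of the other generators.\<close>
    define v' where "v' = vcomp s (s i) v"
    have "lincomb c g v' = vcomp a (s i) (lincomb c g v)"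
      unfolding v'_def by (rule vcomp_lincomb[symmetric]) (rule s(2))
    then have "lincomb c g v' = 0" by (simp only: v(2) vcomp_0)
    then have "(\<Sum>k<c. smul (v' k) (g k)) = 0" by (simp only: lincomb_def)
    then have rel: "smul (v' i) (g i) = - (\<Sum>k\<in>{..<c} - {i}. smul (v' k) (g k))"
      using i by (simp add: sum.remove[of "{..<c}" i] eq_neg_iff_add_eq_0)
    have "v' i = const_poly ?t"
      by (intro poly_mapping_eqI)
        (auto simp: v'_def vcomp_def lookup_hcomp const_poly_def lookup_single when_def)
    then have "g i = smul (const_poly (inverse ?t)) (smul (v' i) (g i))"
      using t by (simp add: fun_eq_iff const_poly_inverse_cancel del: fm.scale_scale)
    also have "\<dots> \<in> fm.span (G - {g i})"
      unfolding rel
    proof (intro fm.span_scale fm.span_neg fm.span_sum)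
      fix k assume "k \<in> {..<c} - {i}"
      then have "g k \<in> G - {g i}" using gG inj i by (auto simp: inj_on_def)
      then show "g k \<in> fm.span (G - {g i})" by (rule fm.span_base)
    qed
    finally have gi: "g i \<in> fm.span (G - {g i})" .
    have "G \<subseteq> fm.span (G - {g i})"
      using gi fm.span_superset[of "G - {g i}"] by blast
    then have "fm.span G \<subseteq> fm.span (G - {g i})" by (rule fm.span_minimal) (rule fm.subspace_span)
    then have "fm.span (G - {g i}) = M"
      using G fm.span_mono[of "G - {g i}" G] by (auto simp: Gen_def)
    then have "Gen (G - {g i})" using G by (auto simp: Gen_def)
    then have "card G \<le> card (G - {g i})" by (rule least)
    moreover have "g i \<in> G" "finite G" using gG i G by (auto simp: Gen_def)
    ultimately show False by (metis card_Diff1_less leD)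
  qed
  moreover have "g j \<in> M" if "j < c" for j using that gG G by (auto simp: Gen_def)
  ultimately show thesis using s im by (intro that[of c g s])
qed

lemma gsub_kernel:
  assumes "\<And>j. j < c \<Longrightarrow> homog a (s j) (g j)"
  shows "gsub c s {v \<in> free_mod c. lincomb c g v = 0}"
  unfolding gsub_def
proof (intro conjI ballI allI)
  show "fm.subspace {v \<in> free_mod c. lincomb c g v = 0}"
  proof (rule fm.subspaceI)
    show "0 \<in> {v \<in> free_mod c. lincomb c g v = 0}"
      using fm.subspace_0[OF subspace_free_mod, of c] by (simp only: mem_Collect_eq lincomb_0)
  next
    fix u v assume "u \<in> {v \<in> free_mod c. lincomb c g v = 0}" "v \<in> {v \<in> free_mod c. lincomb c g v = 0}"
    then show "u + v \<in> {v \<in> free_mod c. lincomb c g v = 0}"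
      using fm.subspace_add[OF subspace_free_mod, of u c v] by (simp only: mem_Collect_eq lincomb_add) simp
  next
    fix p u assume "u \<in> {v \<in> free_mod c. lincomb c g v = 0}"
    then show "smul p u \<in> {v \<in> free_mod c. lincomb c g v = 0}"
      using fm.subspace_scale[OF subspace_free_mod, of u c p] by (simp only: mem_Collect_eq lincomb_smul) simp
  qed
  fix v k assume "v \<in> {v \<in> free_mod c. lincomb c g v = 0}"
  then show "vcomp s k v \<in> {v \<in> free_mod c. lincomb c g v = 0}"
    using vcomp_lincomb[of c a s g k v, OF assms] gsub_free_mod[of c s] by (auto simp: gsub_def)
qed auto

text \<open>A relation in \<open>zsub (free_mod b) \<zeta> (i + 1)\<close> is changed into one with fewer forms by
  lifting its last coefficient, which lies in \<open>zsub M \<zeta> i\<close> by tameness of \<open>M\<close>.\<close>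

lemma tame_kernel:
  assumes M: "gsub b a M" "tame b a M e"
    and g: "\<And>j. j < c \<Longrightarrow> homog a (s j) (g j)" "lincomb c g ` free_mod c = M"
  shows "tame c s {v \<in> free_mod c. lincomb c g v = 0} (Suc e)" (is "tame c s ?K _")
proof -
  note K = gsub_kernel[of c a s g, OF g(1)]
  have subK: "fm.subspace ?K" using K by (simp add: gsub_def)
  note subF = subspace_zsub[OF subspace_free_mod]
  have subM: "fm.subspace M" using M(1) by (simp add: gsub_def)
  have "u \<in> zsub ?K \<zeta> i"
    if "u \<in> ?K" "homog s k u" "Suc e < k" "i \<le> CARD('v)" "u \<in> zsub (free_mod c) \<zeta> i" for u k i
    using that
  proof (induction i arbitrary: u)
    case 0
    then show ?case by simp
  next
    case (Suc i)
    let ?z = "linear_form (\<zeta> i)"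
    obtain k' where k': "k = Suc k'" using Suc.prems(3) by (cases k) auto
    obtain h n where hn: "u = h + smul ?z n" "h \<in> zsub (free_mod c) \<zeta> i" "n \<in> free_mod c"
      "homog s (Suc k') h" "homog s k' n"
      using zsub_homogE[OF gsub_free_mod Suc.prems(5) Suc.prems(2)[unfolded k']] .
    have "lincomb c g u = lincomb c g h + smul ?z (lincomb c g n)"
      unfolding hn(1) lincomb_add lincomb_smul ..
    moreover have "lincomb c g u = 0" using Suc.prems(1) by (simp only: mem_Collect_eq)
    ultimately have "smul ?z (lincomb c g n) = - lincomb c g h"
      by (metis add_eq_0_iff)
    also have "\<dots> = lincomb c g (- h)"
      by (auto simp: fun_eq_iff lincomb_apply sum_negf)
    finally have zn: "smul ?z (lincomb c g n) = lincomb c g (- h)" .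
    have "lincomb c g (- h) \<in> zsub M \<zeta> i"
      using lincomb_zsub[OF g(2), of \<zeta> i] fm.subspace_neg[OF subF hn(2)] by blast
    then have "smul ?z (lincomb c g n) \<in> zsub (free_mod b) \<zeta> i"
      unfolding zn using zsub_mono[of M "free_mod b" \<zeta> i] M(1) by (auto simp: gsub_def)
    moreover have nM: "lincomb c g n \<in> M" using g(2) hn(3) by blast
    \<comment> \<open>The flag is regular on free modules. Tameness of \<open>M\<close> is then
      applied in degree \<open>k'\<close>, one below that of \<open>u\<close>, which is the reason
      for \<open>Suc e\<close>.\<close>
    ultimately have "lincomb c g n \<in> zsub (free_mod b) \<zeta> i"
      using free_mod_regular[of i "lincomb c g n" b] Suc.prems(4) M(1) by (auto simp: gsub_def)
    moreover have hom_n: "homog a k' (lincomb c g n)"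
      using vcomp_lincomb[of c a s g k' n, OF g(1)] vcomp_homog[OF hn(5), of k'] homog_vcomp[of a k']
      by metis
    ultimately have "lincomb c g n \<in> zsub M \<zeta> i"
      using tameD[OF M(2) nM hom_n] Suc.prems(3,4) k' by auto
    then obtain p0 where p0: "p0 \<in> zsub (free_mod c) \<zeta> i" "lincomb c g p0 = lincomb c g n"
      unfolding lincomb_zsub[OF g(2), symmetric] by auto
    define p where "p = vcomp s k' p0"
    have p: "p \<in> zsub (free_mod c) \<zeta> i" "homog s k' p"
      unfolding p_def using vcomp_zsub[OF gsub_free_mod p0(1)] by simp_all
    have "lincomb c g p = lincomb c g n"
      unfolding p_def using vcomp_lincomb[of c a s g k', OF g(1), symmetric] p0(2) vcomp_homog[OF hom_n, of k']
      by simp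
    moreover have pF: "p \<in> free_mod c" using p(1) zsub_subset[OF subspace_free_mod] by blast
    ultimately have np: "n - p \<in> ?K"
      using fm.subspace_diff[OF subspace_free_mod hn(3) pF] by (simp only: mem_Collect_eq lincomb_diff) simp
    have "u - smul ?z (n - p) = h + smul ?z p"
      by (simp add: hn(1) fun_eq_iff algebra_simps)
    also have "\<dots> \<in> zsub (free_mod c) \<zeta> i"
      by (intro fm.subspace_add[OF subF] fm.subspace_scale[OF subF] hn p)
    finally have m1: "u - smul ?z (n - p) \<in> zsub (free_mod c) \<zeta> i" .
    have m2: "u - smul ?z (n - p) \<in> ?K"
      by (intro fm.subspace_diff[OF subK] fm.subspace_scale[OF subK] Suc.prems np)
    have m3: "homog s k (u - smul ?z (n - p))"
      unfolding k' by (intro homog_diff homog_smul_form hn p Suc.prems(2)[unfolded k'])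
    have "u - smul ?z (n - p) \<in> zsub ?K \<zeta> i"
      by (rule Suc.IH[OF m2 m3 Suc.prems(3) Suc_leD[OF Suc.prems(4)] m1])
    from zsub_SucI[OF this np] show ?case by (simp only: diff_add_cancel)
  qed
  then show ?thesis unfolding tame_def by blast
qed

text \<open>The quotient \<open>M/(\<zeta> 0, \<dots>, \<zeta> (c - 1)) M\<close> has a nonzero socle in degree \<open>k\<close>.\<close>

definition socle :: "(nat \<Rightarrow> nat) \<Rightarrow> (nat \<Rightarrow> ('v, 'k) mpoly) set \<Rightarrow> nat \<Rightarrow> nat \<Rightarrow> bool" where
  "socle a M k c \<longleftrightarrow> (\<exists>u\<in>M. homog a k u \<and> u \<notin> zsub M \<zeta> c \<and>
     (\<forall>y. smul (linear_form y) u \<in> zsub M \<zeta> c))"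

text \<open>A connecting homomorphism. Lift the socle element \<open>u\<close> to \<open>v\<close>,
  lift \<open>\<zeta> i\<close> times \<open>u\<close> to \<open>p\<close> over the earlier forms,
  and take the syzygy \<open>w\<close>, the difference of \<open>\<zeta> i\<close> times
  \<open>v\<close> and \<open>p\<close>. If \<open>w\<close> came from the flag times the kernel,
  cancelling \<open>\<zeta> i\<close> in the free module would put \<open>u\<close> into
  \<open>zsub M \<zeta> i\<close>. Linear multiples of \<open>w\<close> have degree above
  \<open>Suc e\<close>, so tameness of the kernel handles them.\<close>

lemma socle_kernel:
  assumes M: "gsub b a M" "tame b a M e" and i: "i < CARD('v)" and e: "e \<le> k"
    and g: "\<And>j. j < c \<Longrightarrow> homog a (s j) (g j)" "lincomb c g ` free_mod c = M"
    and soc: "socle a M k i"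
  shows "socle s {v \<in> free_mod c. lincomb c g v = 0} (Suc k) (Suc i)" (is "socle s ?K _ _")
proof -
  note K = gsub_kernel[of c a s g, OF g(1)]
  have subK: "fm.subspace ?K" using K by (simp add: gsub_def)
  note subF = subspace_zsub[OF subspace_free_mod]
  let ?z = "linear_form (\<zeta> i)"
  obtain u where u: "u \<in> M" "homog a k u" "u \<notin> zsub M \<zeta> i"
      "\<And>y. smul (linear_form y) u \<in> zsub M \<zeta> i"
    using soc unfolding socle_def by blast
  obtain v0 where v0: "v0 \<in> free_mod c" "lincomb c g v0 = u" using u(1) g(2) by blast
  define v where "v = vcomp s k v0"
  have v: "v \<in> free_mod c" "homog s k v" "lincomb c g v = u"
    unfolding v_def using gsub_free_mod[of c s] v0 vcomp_lincomb[of c a s g k v0, OF g(1)] vcomp_homog[OF u(2), of k]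
    by (auto simp: gsub_def)
  obtain p0 where p0: "p0 \<in> zsub (free_mod c) \<zeta> i" "lincomb c g p0 = smul ?z u"
    using u(4)[of "\<zeta> i"] unfolding lincomb_zsub[OF g(2), symmetric] by auto
  define p where "p = vcomp s (Suc k) p0"
  have p: "p \<in> zsub (free_mod c) \<zeta> i" "homog s (Suc k) p"
    unfolding p_def using vcomp_zsub[OF gsub_free_mod p0(1)] by simp_all
  have lp: "lincomb c g p = smul ?z u"
    unfolding p_def using vcomp_lincomb[of c a s g "Suc k", OF g(1), symmetric] p0(2)
      vcomp_homog[OF homog_smul_form[OF u(2)], of "Suc k"] by simp
  have pF: "p \<in> free_mod c" using p(1) zsub_subset[OF subspace_free_mod] by blast
  define w where "w = smul ?z v - p"
  have wK: "w \<in> ?K"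
    unfolding w_def using fm.subspace_diff[OF subspace_free_mod fm.subspace_scale[OF subspace_free_mod v(1)] pF]
    by (simp only: mem_Collect_eq lincomb_diff lincomb_smul v(3) lp) simp
  have hom_w: "homog s (Suc k) w"
    unfolding w_def by (intro homog_diff homog_smul_form v p)
  have wF: "w \<in> zsub (free_mod c) \<zeta> (Suc i)"
    using zsub_SucI[OF fm.subspace_neg[OF subF p(1)] v(1)] by (simp add: w_def)
  have "w \<notin> zsub ?K \<zeta> (Suc i)"
  proof
    assume "w \<in> zsub ?K \<zeta> (Suc i)"
    then obtain h n where hn: "w = h + smul ?z n" "h \<in> zsub ?K \<zeta> i" "n \<in> ?K" by (rule zsub_SucE)
    have "h \<in> zsub (free_mod c) \<zeta> i" using hn(2) zsub_mono[of ?K "free_mod c" \<zeta> i] by auto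
    then have "h + p \<in> zsub (free_mod c) \<zeta> i" using p(1) by (rule fm.subspace_add[OF subF])
    moreover have "h + p = smul ?z (v - n)"
      using hn(1) by (simp add: w_def fun_eq_iff algebra_simps)
    ultimately have "v - n \<in> zsub (free_mod c) \<zeta> i"
      using free_mod_regular[OF i, of "v - n" c] fm.subspace_diff[OF subspace_free_mod v(1), of n] hn(3) by simp
    then have "lincomb c g (v - n) \<in> zsub M \<zeta> i" using lincomb_zsub[OF g(2), of \<zeta> i] by blast
    then show False using u(3) hn(3) by (simp add: lincomb_diff v(3))
  qed
  moreover have "smul (linear_form y) w \<in> zsub ?K \<zeta> (Suc i)" for y
  proof (rule tameD[OF tame_kernel[OF M g]])
    show "smul (linear_form y) w \<in> ?K" using fm.subspace_scale[OF subK wK] .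
    show "homog s (Suc (Suc k)) (smul (linear_form y) w)" by (rule homog_smul_form[OF hom_w])
    show "smul (linear_form y) w \<in> zsub (free_mod c) \<zeta> (Suc i)" by (rule fm.subspace_scale[OF subF wF])
  qed (use i e in auto)
  ultimately show ?thesis unfolding socle_def using wK hom_w by blast
qed

text \<open>If all generators had degree below \<open>k\<close>, every element of degree
  \<open>k\<close> would have coefficients of positive degree, and the whole flag generates the
  maximal ideal.\<close>

lemma socle_generator:
  assumes M: "gsub b a M" and g: "\<And>j. j < c \<Longrightarrow> homog a (s j) (g j)" "\<And>j. j < c \<Longrightarrow> s j \<le> k"
      "lincomb c g ` free_mod c = M"
    and soc: "socle a M k CARD('v)"
  obtains j where "j < c" "s j = k"
proof -
  obtain u where u: "u \<in> M" "homog a k u" "u \<notin> zsub M \<zeta> CARD('v)"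
    using soc unfolding socle_def by blast
  obtain v0 where v0: "v0 \<in> free_mod c" "lincomb c g v0 = u" using u(1) g(3) by blast
  define v where "v = vcomp s k v0"
  have v: "v \<in> free_mod c" "homog s k v" "lincomb c g v = u"
    unfolding v_def using gsub_free_mod[of c s] v0 vcomp_lincomb[of c a s g k v0, OF g(1)] vcomp_homog[OF u(2), of k]
    by (auto simp: gsub_def)
  have "\<exists>j<c. \<not> s j < k"
  proof (rule ccontr)
    assume "\<not> (\<exists>j<c. \<not> s j < k)"
    then have "v \<in> zsub (free_mod c) \<zeta> CARD('v)" by (intro free_mod_positive[OF v(1,2)]) auto
    then have "u \<in> zsub M \<zeta> CARD('v)" using lincomb_zsub[OF g(3), of \<zeta> "CARD('v)"] v(3) by blast
    with u(3) show False by blast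
  qed
  then show thesis using that g(2) by (meson le_neq_implies_less)
qed

end

section \<open>Ideals as modules of rank one, and assembly of the minimal resolution\<close>

lemma mat_apply_eq_lincomb:
  assumes "\<And>k. k < c \<Longrightarrow> g k \<in> free_mod r"
  shows "mat_apply r c (\<lambda>j k. g k j) v = lincomb c g v"
proof
  fix j
  have "(\<Sum>k<c. v k * g k j) = 0" if "\<not> j < r"
    using that assms by (intro sum.neutral) (auto simp: free_mod_def)
  then show "mat_apply r c (\<lambda>j k. g k j) v j = lincomb c g v j"
    by (simp add: mat_apply_def lincomb_apply mult.commute)
qed

definition emb :: "'r::zero \<Rightarrow> nat \<Rightarrow> 'r" where
  "emb p = (\<lambda>j. if j = 0 then p else 0)"

lemma emb_simps [simp]: "emb p 0 = p" "j > 0 \<Longrightarrow> emb p j = 0"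
  by (simp_all add: emb_def)

lemma emb_free_mod: "emb p \<in> free_mod 1"
  by (simp add: emb_def free_mod_def)

lemma free_mod_1_eq_emb: "v \<in> free_mod 1 \<Longrightarrow> v = emb (v 0)"
  by (auto simp: free_mod_def emb_def fun_eq_iff)

text \<open>Placing an ideal in the free module of rank one lets the first step of the resolution be
  handled like all later ones.\<close>

definition ideal_mod :: "'r::zero set \<Rightarrow> (nat \<Rightarrow> 'r) set" where
  "ideal_mod J = {v \<in> free_mod 1. v 0 \<in> J}"

lemma emb_ideal_mod: "p \<in> J \<Longrightarrow> emb p \<in> ideal_mod J"
  using emb_free_mod[of p] by (simp add: ideal_mod_def)

lemma homog_emb: "p \<in> graded_piece k \<Longrightarrow> homog (\<lambda>_. 0) k (emb p)"
  by (auto simp: homog_iff emb_def)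

lemma gsub_ideal_mod:
  assumes "hideal J" shows "gsub 1 (\<lambda>_. 0) (ideal_mod J)"
  unfolding gsub_def
proof (intro conjI ballI allI)
  have J: "rm.subspace J" using assms by (rule hideal_subspace)
  show "fm.subspace (ideal_mod J)"
    unfolding ideal_mod_def
    by (rule fm.subspaceI)
      (auto simp: free_mod_def intro: rm.subspace_0[OF J] rm.subspace_add[OF J] rm.subspace_scale[OF J])
  fix v k assume "v \<in> ideal_mod J"
  then show "vcomp (\<lambda>_. 0) k v \<in> ideal_mod J"
    using hideal_hcomp[OF assms] by (auto simp: ideal_mod_def free_mod_def vcomp_def)
qed (auto simp: ideal_mod_def)

text \<open>Minimal generators and kernels are iterated. Tameness bounds the generator degrees at
  every stage, and the socle, which starts with two forms, shows that the bound is attained when no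
  variable is left.\<close>

lemma (in flag) has_regularityI:
  assumes J: "hideal J" and tame: "tame 1 (\<lambda>_. 0) (ideal_mod J) d"
    and soc: "socle (\<lambda>_. 0) (ideal_mod J) d 2" and card: "2 \<le> CARD('v)"
  shows "has_regularity J (int d)"
proof -
  \<comment> \<open>A state consists of a rank, shifts and a submodule of that free module: the
    ideal at stage 0, the \<open>i\<close>-th syzygy module afterwards. Degree bound and socle
    degree both grow with \<open>i\<close>; the socle is tracked only while the flag provides
    \<open>i + 2\<close> forms.\<close>
  define P where "P i x \<longleftrightarrow> (case x of (b, a, M) \<Rightarrow> gsub b a M \<and> tame b a M (d + i) \<and> (\<forall>j<b. a j \<le> d + i) \<and>
     (i + 2 \<le> CARD('v) \<longrightarrow> socle a M (d + i) (i + 2)) \<and>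
     (i = 0 \<longrightarrow> a = (\<lambda>_. 0) \<and> M = ideal_mod J))"
    for i :: nat and x :: "nat \<times> (nat \<Rightarrow> nat) \<times> (nat \<Rightarrow> ('v, 'k) mpoly) set"
  define Q where "Q i x y \<longleftrightarrow> (case x of (b, a, M) \<Rightarrow> case y of (b', a', M') \<Rightarrow>
     \<exists>g. (\<forall>j<b'. g j \<in> M \<and> homog a (a' j) (g j) \<and> a' j \<le> d + i) \<and> lincomb b' g ` free_mod b' = M \<and>
       M' = {v \<in> free_mod b'. lincomb b' g v = 0} \<and> (\<forall>v\<in>M'. \<forall>j<b'. Poly_Mapping.lookup (v j) 0 = 0) \<and>
       (i + 2 = CARD('v) \<longrightarrow> (\<exists>j<b'. a' j = d + i)))"
    for i :: nat and x y :: "nat \<times> (nat \<Rightarrow> nat) \<times> (nat \<Rightarrow> ('v, 'k) mpoly) set"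
  have "\<exists>F. \<forall>i. P i (F i) \<and> Q i (F i) (F (Suc i))"
  proof (rule dependent_nat_choice)
    have "P 0 (1, \<lambda>_. 0, ideal_mod J)"
      using gsub_ideal_mod[OF J] tame soc by (simp add: P_def numeral_2_eq_2)
    then show "\<exists>x. P 0 x" ..
  next
    fix x i assume "P i x"
    obtain b a M where x: "x = (b, a, M)" by (cases x)
    have M: "gsub b a M" "tame b a M (d + i)" and a: "\<And>j. j < b \<Longrightarrow> a j \<le> d + i"
      and soc: "i + 2 \<le> CARD('v) \<Longrightarrow> socle a M (d + i) (i + 2)"
      using \<open>P i x\<close> unfolding P_def x by auto
    obtain c s g where g: "\<And>j. j < c \<Longrightarrow> g j \<in> M" "\<And>j. j < c \<Longrightarrow> homog a (s j) (g j)"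
      "\<And>j. j < c \<Longrightarrow> s j \<le> d + i" "lincomb c g ` free_mod c = M"
      "\<And>v j. v \<in> free_mod c \<Longrightarrow> lincomb c g v = 0 \<Longrightarrow> j < c \<Longrightarrow> Poly_Mapping.lookup (v j) 0 = 0"
      using minimal_generators[OF M a] by metis
    let ?K = "{v \<in> free_mod c. lincomb c g v = 0}"
    have "socle s ?K (d + Suc i) (Suc i + 2)" if "Suc i + 2 \<le> CARD('v)"
      using socle_kernel[OF M _ _ g(2,4) soc] that by simp
    moreover have "tame c s ?K (d + Suc i)"
      using tame_kernel[OF M g(2,4)] by simp
    moreover have "s j \<le> d + Suc i" if "j < c" for j using g(3)[OF that] by simp
    ultimately have "P (Suc i) (c, s, ?K)"
      using gsub_kernel[of c a s g, OF g(2)] unfolding P_def prod.case by blast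
    moreover have "\<exists>j<c. s j = d + i" if "i + 2 = CARD('v)"
      using socle_generator[OF M(1) g(2,3,4)] soc that by (metis order_refl)
    then have "Q i x (c, s, ?K)"
      unfolding Q_def x prod.case using g by blast
    ultimately show "\<exists>y. P (Suc i) y \<and> Q i x y" by blast
  qed
  then obtain F where F: "\<And>i. P i (F i)" "\<And>i. Q i (F i) (F (Suc i))" by blast
  define B where "B i = fst (F i)" for i
  define a where "a i = fst (snd (F i))" for i
  define M where "M i = snd (snd (F i))" for i
  have F_eq: "F i = (B i, a i, M i)" for i by (simp add: B_def a_def M_def)
  have gs: "gsub (B i) (a i) (M i)" for i using F(1)[of i] unfolding F_eq P_def by simp
  have 0: "a 0 = (\<lambda>_. 0)" "M 0 = ideal_mod J"
    using F(1)[of 0] unfolding F_eq P_def by simp_all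
  define GG where "GG i g \<longleftrightarrow>
      (\<forall>j<B (Suc i). g j \<in> M i \<and> homog (a i) (a (Suc i) j) (g j) \<and> a (Suc i) j \<le> d + i) \<and>
      lincomb (B (Suc i)) g ` free_mod (B (Suc i)) = M i \<and>
      M (Suc i) = {v \<in> free_mod (B (Suc i)). lincomb (B (Suc i)) g v = 0} \<and>
      (\<forall>v\<in>M (Suc i). \<forall>j<B (Suc i). Poly_Mapping.lookup (v j) 0 = 0) \<and>
      (i + 2 = CARD('v) \<longrightarrow> (\<exists>j<B (Suc i). a (Suc i) j = d + i))" for i g
  have "\<exists>g. GG i g" for i
    using F(2)[of i] unfolding F_eq Q_def GG_def by simp
  then have "\<forall>i. \<exists>g. GG i g" by blast
  from choice[OF this] obtain G where GG: "\<forall>i. GG i (G i)" by blast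
  have G: "\<And>i j. j < B (Suc i) \<Longrightarrow> G i j \<in> M i"
    "\<And>i j. j < B (Suc i) \<Longrightarrow> homog (a i) (a (Suc i) j) (G i j)"
    "\<And>i j. j < B (Suc i) \<Longrightarrow> a (Suc i) j \<le> d + i"
    "\<And>i. lincomb (B (Suc i)) (G i) ` free_mod (B (Suc i)) = M i"
    "\<And>i. M (Suc i) = {v \<in> free_mod (B (Suc i)). lincomb (B (Suc i)) (G i) v = 0}"
    "\<And>i v j. v \<in> M (Suc i) \<Longrightarrow> j < B (Suc i) \<Longrightarrow> Poly_Mapping.lookup (v j) 0 = 0"
    "\<And>i. i + 2 = CARD('v) \<Longrightarrow> \<exists>j<B (Suc i). a (Suc i) j = d + i"
    subgoal for i using GG unfolding GG_def by blast
    subgoal for i using GG unfolding GG_def by blast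
    subgoal for i using GG unfolding GG_def by blast
    subgoal for i using GG unfolding GG_def by blast
    subgoal for i using GG[rule_format, of i] unfolding GG_def by (elim conjE)
    subgoal for i using GG[rule_format, of i] unfolding GG_def by (elim conjE) blast
    subgoal for i using GG unfolding GG_def by blast
    done
  have mat: "mat_apply (B (Suc i)) (B (Suc (Suc i))) (\<lambda>j k. G (Suc i) k j) v =
      lincomb (B (Suc (Suc i))) (G (Suc i)) v" for i v
    using G(1)[of _ "Suc i"] gs[of "Suc i"] by (intro mat_apply_eq_lincomb) (auto simp: gsub_def)
  have eval0: "(\<Sum>j<B 1. G 0 j 0 * v j) = lincomb (B 1) (G 0) v 0" for v
    by (simp add: lincomb_apply mult.commute)
  have M0: "lincomb (B 1) (G 0) v = emb (lincomb (B 1) (G 0) v 0)" "lincomb (B 1) (G 0) v 0 \<in> J"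
    if "v \<in> free_mod (B 1)" for v
  proof -
    have "lincomb (B 1) (G 0) v \<in> ideal_mod J" using G(4)[of 0] 0 that by auto
    then show "lincomb (B 1) (G 0) v = emb (lincomb (B 1) (G 0) v 0)" "lincomb (B 1) (G 0) v 0 \<in> J"
      using free_mod_1_eq_emb by (auto simp: ideal_mod_def)
  qed
  have ker0: "lincomb (B 1) (G 0) v = 0 \<longleftrightarrow> lincomb (B 1) (G 0) v 0 = 0" if "v \<in> free_mod (B 1)" for v
    by (subst M0(1)[OF that]) (auto simp: emb_def fun_eq_iff)
  \<comment> \<open>Stage 0 is the ring that contains the ideal, so position \<open>i\<close> of the
    resolution is occupied by the free module of stage \<open>Suc i\<close>.\<close>
  have "minimal_graded_free_resolution J (\<lambda>i. B (Suc i)) (\<lambda>i j. int (a (Suc i) j))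
      (\<lambda>j. G 0 j 0) (\<lambda>i j k. G (Suc i) k j)"
    unfolding minimal_graded_free_resolution_def
  proof (intro conjI allI impI ballI)
    fix j m assume "j < B (Suc 0)" "m \<in> Poly_Mapping.keys (G 0 j 0)"
    then show "int (mdeg m) = int (a (Suc 0) j)"
      using G(2)[of j 0] 0 by (auto simp: homog_def)
  next
    fix i j k m assume "j < B (Suc i)" "k < B (Suc (Suc i))" "m \<in> Poly_Mapping.keys (G (Suc i) k j)"
    then have "a (Suc i) j + mdeg m = a (Suc (Suc i)) k"
      using G(2)[of k "Suc i"] unfolding homog_def by blast
    then show "int (a (Suc i) j) + int (mdeg m) = int (a (Suc (Suc i)) k)" by simp
  next
    show "(\<lambda>v. \<Sum>j<B (Suc 0). G 0 j 0 * v j) ` free_mod (B (Suc 0)) = J"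
    proof
      show "(\<lambda>v. \<Sum>j<B (Suc 0). G 0 j 0 * v j) ` free_mod (B (Suc 0)) \<subseteq> J"
        using M0(2) eval0 by auto
      show "J \<subseteq> (\<lambda>v. \<Sum>j<B (Suc 0). G 0 j 0 * v j) ` free_mod (B (Suc 0))"
      proof
        fix p assume "p \<in> J"
        then have "emb p \<in> lincomb (B (Suc 0)) (G 0) ` free_mod (B (Suc 0))"
          unfolding G(4) 0 by (rule emb_ideal_mod)
        then obtain v where v: "emb p = lincomb (B (Suc 0)) (G 0) v" "v \<in> free_mod (B (Suc 0))" by blast
        have "p = (\<Sum>j<B (Suc 0). G 0 j 0 * v j)"
          using eval0[of v] arg_cong[OF v(1), of "\<lambda>h. h 0"] by simp
        then show "p \<in> (\<lambda>v. \<Sum>j<B (Suc 0). G 0 j 0 * v j) ` free_mod (B (Suc 0))" using v(2) by blast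
      qed
    qed
  next
    have "{v \<in> free_mod (B (Suc 0)). (\<Sum>j<B (Suc 0). G 0 j 0 * v j) = 0} = M (Suc 0)"
      unfolding G(5) using eval0 ker0 by auto
    also have "\<dots> = mat_apply (B (Suc 0)) (B (Suc 1)) (\<lambda>j k. G (Suc 0) k j) ` free_mod (B (Suc 1))"
      unfolding G(4)[of "Suc 0", symmetric] using mat[of 0] by simp
    finally show "{v \<in> free_mod (B (Suc 0)). (\<Sum>j<B (Suc 0). G 0 j 0 * v j) = 0} =
       mat_apply (B (Suc 0)) (B (Suc 1)) (\<lambda>j k. G (Suc 0) k j) ` free_mod (B (Suc 1))" .
  next
    fix i
    have "{v \<in> free_mod (B (Suc (Suc i))). mat_apply (B (Suc i)) (B (Suc (Suc i))) (\<lambda>j k. G (Suc i) k j) v = (\<lambda>_. 0)} =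
        M (Suc (Suc i))"
      unfolding mat G(5)[of "Suc i"] zero_fun_def ..
    also have "\<dots> = mat_apply (B (Suc (Suc i))) (B (Suc (Suc (Suc i)))) (\<lambda>j k. G (Suc (Suc i)) k j) `
        free_mod (B (Suc (Suc (Suc i))))"
      unfolding G(4)[of "Suc (Suc i)", symmetric] using mat[of "Suc i"] by simp
    finally show "{v \<in> free_mod (B (Suc (Suc i))). mat_apply (B (Suc i)) (B (Suc (Suc i))) (\<lambda>j k. G (Suc i) k j) v = (\<lambda>_. 0)} =
        mat_apply (B (Suc (Suc i))) (B (Suc (Suc (Suc i)))) (\<lambda>j k. G (Suc (Suc i)) k j) `
        free_mod (B (Suc (Suc (Suc i))))" .
  next
    fix i j k assume "j < B (Suc i)" "k < B (Suc (Suc i))"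
    then show "Poly_Mapping.lookup (G (Suc i) k j) 0 = 0"
      using G(1)[of k "Suc i"] G(6) by blast
  qed
  moreover have "\<exists>i j. j < B (Suc i) \<and> int (a (Suc i) j) - int i = int d"
    using G(7)[of "CARD('v) - 2"] card by force
  moreover have "int (a (Suc i) j) - int i \<le> int d" if "j < B (Suc i)" for i j
    using G(3)[OF that] by simp
  ultimately show ?thesis unfolding has_regularity_def by blast
qed

section \<open>Tameness and socle of the intersection ideal\<close>

locale flagged_forms = forms_at_point A L a + flag \<zeta>
  for A :: "'h set" and L :: "'h \<Rightarrow> 'v::finite \<Rightarrow> 'k::field_char_0"
    and a :: "'v \<Rightarrow> 'k" and \<zeta> :: "nat \<Rightarrow> 'v \<Rightarrow> 'k" +
  assumes transversal: "B \<subseteq> A \<Longrightarrow> fv.span (L ` B \<union> \<zeta> ` {..<i}) = UNIV \<or>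
       (\<exists>w. (\<forall>b\<in>L ` B. dot b w = 0) \<and> (\<forall>j<i. dot (\<zeta> j) w = 0) \<and> dot (\<zeta> i) w = 1)"
    and dot_\<zeta>: "dot (\<zeta> 0) a \<noteq> 0"
    and card_v: "3 \<le> CARD('v)"
begin

text \<open>The last coefficient of a representation by flag forms lies, by
  \<open>I_regular\<close>, in \<open>I\<close> modulo the earlier forms; it is replaced by an
  element of \<open>I\<close> and the error is absorbed by the earlier forms. Its degree is one less
  than \<open>k\<close>, hence still at least \<open>card A\<close>.\<close>

lemma tame_I: "tame 1 (\<lambda>_. 0) (ideal_mod I) (card A)"
proof -
  note subF = subspace_zsub[OF subspace_free_mod]
  note subI = subspace_plus_forms[OF subspace_I]
  have subN: "fm.subspace (ideal_mod I)"
    using gsub_ideal_mod[OF hideal_I] by (simp add: gsub_def)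
  have "u \<in> zsub (ideal_mod I) \<zeta> i"
    if "u \<in> ideal_mod I" "homog (\<lambda>_. 0) k u" "card A < k" "i \<le> CARD('v)" "u \<in> zsub (free_mod 1) \<zeta> i" for u k i
    using that
  proof (induction i arbitrary: u)
    case 0
    then show ?case by (simp only: zsub.simps singleton_iff)
  next
    case (Suc i)
    let ?z = "linear_form (\<zeta> i)"
    obtain k' where k': "k = Suc k'" using Suc.prems(3) by (cases k) auto
    obtain h n where hn: "u = h + smul ?z n" "h \<in> zsub (free_mod 1) \<zeta> i" "n \<in> free_mod 1"
      "homog (\<lambda>_. 0) (Suc k') h" "homog (\<lambda>_. 0) k' n"
      using zsub_homogE[OF gsub_free_mod Suc.prems(5) Suc.prems(2)[unfolded k']] .
    have "h 0 \<in> plus_forms {0} \<zeta> i" using hn(2) by (simp add: zsub_free_mod_iff)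
    then have "h 0 \<in> plus_forms I \<zeta> i"
      using plus_forms_mono[of "{0}" I \<zeta> i] rm.subspace_0[OF subspace_I] by blast
    moreover have "u 0 \<in> plus_forms I \<zeta> i"
      using Suc.prems(1) plus_forms_superset[of I \<zeta> i] by (auto simp: ideal_mod_def)
    ultimately have "u 0 - h 0 \<in> plus_forms I \<zeta> i" by (intro rm.subspace_diff[OF subI])
    then have zn: "?z * n 0 \<in> plus_forms I \<zeta> i" by (simp add: hn(1))
    have n0: "n 0 \<in> graded_piece k'" using hn(5) unfolding homog_iff by simp
    have "n 0 \<in> plus_forms I \<zeta> i"
      using I_regular[of \<zeta> "CARD('v)" "n 0" k' i, OF transversal span dot_\<zeta> n0 _ _ zn]
        Suc.prems(3,4) k' by simp
    then obtain g where g: "g \<in> I" "g \<in> graded_piece k'" "n 0 - g \<in> plus_forms {0} \<zeta> i"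
      using plus_forms_split_graded[OF hideal_I _ n0] by metis
    have gN: "emb g \<in> ideal_mod I" by (rule emb_ideal_mod[OF g(1)])
    have "n - emb g \<in> zsub (free_mod 1) \<zeta> i"
      unfolding zsub_free_mod_iff
    proof (intro conjI allI)
      show "n - emb g \<in> free_mod 1" using hn(3) emb_free_mod by (rule fm.subspace_diff[OF subspace_free_mod])
      show "(n - emb g) j \<in> plus_forms {0} \<zeta> i" for j
        using g(3) hn(3) rm.subspace_0[OF subspace_plus_forms[OF subspace_zero]]
        by (cases "j = 0") (auto simp: free_mod_def)
    qed
    then have "h + smul ?z (n - emb g) \<in> zsub (free_mod 1) \<zeta> i"
      by (intro fm.subspace_add[OF subF] fm.subspace_scale[OF subF] hn)
    moreover have "u - smul ?z (emb g) = h + smul ?z (n - emb g)"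
      by (simp add: hn(1) fun_eq_iff algebra_simps)
    ultimately have m1: "u - smul ?z (emb g) \<in> zsub (free_mod 1) \<zeta> i" by simp
    have m2: "u - smul ?z (emb g) \<in> ideal_mod I"
      by (intro fm.subspace_diff[OF subN] fm.subspace_scale[OF subN] Suc.prems gN)
    have m3: "homog (\<lambda>_. 0) k (u - smul ?z (emb g))"
      unfolding k' by (intro homog_diff homog_smul_form homog_emb g Suc.prems(2)[unfolded k'])
    have "u - smul ?z (emb g) \<in> zsub (ideal_mod I) \<zeta> i"
      by (rule Suc.IH[OF m2 m3 Suc.prems(3) Suc_leD[OF Suc.prems(4)] m1])
    from zsub_SucI[OF this gN] show ?case by (simp only: diff_add_cancel)
  qed
  then show ?thesis unfolding tame_def by blast
qed

text \<open>Two forms cannot span in at least three variables, so the second alternative of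
  transversality must hold.\<close>

lemma transversal_small:
  assumes "B \<subseteq> A" "card B \<le> 2"
  shows "\<exists>w. (\<forall>b\<in>B. dot (L b) w = 0) \<and> dot (\<zeta> 0) w = 1"
proof -
  have "finite B" using assms(1) finite_A finite_subset by blast
  then have "card (L ` B) < CARD('v)" using card_image_le[of B L] assms(2) card_v by simp
  then have "fv.span (L ` B) \<noteq> UNIV" using \<open>finite B\<close> by (intro span_neq_UNIV) auto
  then show ?thesis using transversal[OF assms(1), of 0] by auto
qed

lemma \<zeta>_descent: "linear_form (\<zeta> 0) * g \<in> R A \<Longrightarrow> g \<in> R A"
proof (rule R_form_descent)
  fix H H' assume H: "H \<in> A" "H' \<in> A" "H \<noteq> H'"
  obtain w where w: "dot (L H) w = 1" "dot (L H') w = 0" using pairwise[OF H] by blast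
  obtain w' where w': "dot (L H) w' = 0" "dot (L H') w' = 0" "dot (\<zeta> 0) w' = 1"
    using transversal_small[of "{H, H'}"] H by auto
  have *: "dot c (\<lambda>i. w i - t * w' i) = dot c w - t * dot c w'" for c t
    unfolding dot_def sum_distrib_left sum_subtractf[symmetric]
    by (rule sum.cong) (simp_all add: algebra_simps)
  \<comment> \<open>The value at \<open>\<zeta> 0\<close> is corrected along \<open>w'\<close>,
    which both hyperplane forms annihilate.\<close>
  show "\<exists>w. dot (L H) w = 1 \<and> dot (L H') w = 0 \<and> dot (\<zeta> 0) w = 0"
    by (rule exI[of _ "\<lambda>i. w i - dot (\<zeta> 0) w * w' i"]) (simp add: * w w')
next
  fix H assume "H \<in> A"
  then show "\<exists>w. dot (L H) w = 0 \<and> dot (\<zeta> 0) w = 1"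
    using transversal_small[of "{H}"] by auto
qed

text \<open>Otherwise the quotient by \<open>\<zeta> 0\<close> lies in \<open>R A\<close> by
  descent, and its part of degree \<open>card A - 2\<close> vanishes at \<open>a\<close>. Then
  \<open>fl\<close> vanishes there too, against Euler's formula. For a single hyperplane that part
  does not exist, and the product has no component in degree 0.\<close>

lemma fl_notin: "n \<in> I \<Longrightarrow> fl - n \<notin> adjoin {0} (\<zeta> 0)"
proof
  assume n: "n \<in> I" and "fl - n \<in> adjoin {0} (\<zeta> 0)"
  then obtain w where w: "fl - n = linear_form (\<zeta> 0) * w" by (auto simp: adjoin_def)
  have "fl - n \<in> R A"
    using n by (intro rm.subspace_diff[OF subspace_R] fl_in_R) (auto simp: I_def)
  then have wR: "w \<in> R A" unfolding w by (rule \<zeta>_descent)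
  let ?k = "card A - 1"
  have "fl - hcomp ?k n = hcomp ?k (linear_form (\<zeta> 0) * w)"
    unfolding w[symmetric] hcomp_diff using hcomp_graded[OF fl_graded, of ?k] by simp
  also have "\<dots> = (if 1 \<le> ?k then linear_form (\<zeta> 0) * hcomp (?k - 1) w else 0)"
    by (rule hcomp_mult_graded[OF linear_form_in_graded])
  also have "eval_poly \<dots> a = 0"
    using R_low_degree_vanishes[OF hideal_hcomp[OF hideal_R wR] hcomp_in_graded, of "?k - 1"]
    by (auto simp: eval_poly_mult)
  finally have "eval_poly fl a = eval_poly (hcomp ?k n) a" by (simp add: eval_poly_diff)
  also have "\<dots> = 0" by (rule eval_I[OF hideal_hcomp[OF hideal_I n]])
  finally show False using eval_fl by simp
qed

text \<open>The connecting map from the quotient by \<open>I\<close> to \<open>I\<close> takes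
  \<open>fl\<close> to \<open>?y * fl\<close>, where \<open>?y\<close> is a combination of
  \<open>\<zeta> 0\<close> and \<open>\<zeta> 1\<close> that vanishes at \<open>a\<close>; this puts
  the product into \<open>I\<close>. Its linear multiples have degree \<open>card A + 1\<close>,
  where tameness of \<open>I\<close> applies.\<close>

lemma socle_I: "socle (\<lambda>_. 0) (ideal_mod I) (card A) 2"
proof -
  define t where "t = dot (\<zeta> 1) a / dot (\<zeta> 0) a"
  let ?z0 = "linear_form (\<zeta> 0)" and ?z1 = "linear_form (\<zeta> 1)"
  let ?y = "linear_form (\<lambda>i. \<zeta> 1 i - t * \<zeta> 0 i)"
  have y: "?y = ?z1 - const_poly t * ?z0" by (simp add: linear_form_diff linear_form_scale)
  have deg: "?y * fl \<in> graded_piece (card A)"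
    using graded_mult[OF linear_form_in_graded fl_graded] card_A by simp
  have "eval_poly ?y a = 0"
    using dot_\<zeta> unfolding y by (simp add: eval_poly_diff eval_poly_mult eval_linear_form t_def dot_def)
  then have yI: "?y * fl \<in> I"
    using in_I_iff[OF deg] rm.subspace_scale[OF subspace_R fl_in_R] by (simp add: eval_poly_mult)
  have two: "2 = Suc (Suc 0)" by simp
  have "emb (?y * fl) \<notin> zsub (ideal_mod I) \<zeta> 2"
  proof
    assume "emb (?y * fl) \<in> zsub (ideal_mod I) \<zeta> 2"
    then obtain h n1 where 1: "emb (?y * fl) = h + smul ?z1 n1" "h \<in> zsub (ideal_mod I) \<zeta> (Suc 0)" "n1 \<in> ideal_mod I"
      unfolding two by (elim zsub_SucE) auto
    then obtain n0 where 2: "h = smul ?z0 n0" "n0 \<in> ideal_mod I" by auto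
    have eq: "?y * fl = ?z0 * n0 0 + ?z1 * n1 0"
      using arg_cong[OF 1(1), of "\<lambda>h. h 0"] by (simp add: 2(1))
    have "?z1 * (fl - n1 0) = ?z0 * (n0 0 + const_poly t * fl)"
      using eq unfolding y by (simp add: algebra_simps)
    also have "\<dots> \<in> plus_forms {0} \<zeta> 1" by (simp add: form_mult_in_adjoin[OF subspace_zero])
    finally have "?z1 * (fl - n1 0) \<in> plus_forms {0} \<zeta> 1" .
    \<comment> \<open>Since \<open>\<zeta> 1\<close> is regular modulo \<open>\<zeta> 0\<close>, a
      representation over \<open>I\<close> would put \<open>fl\<close> into \<open>I\<close> modulo
      \<open>\<zeta> 0\<close>.\<close>
    then have "fl - n1 0 \<in> plus_forms {0} \<zeta> 1"
      by (rule forms_regular[rotated]) (use card_v in simp)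
    then show False using fl_notin[of "n1 0"] 1(3) by (simp add: ideal_mod_def)
  qed
  moreover have "smul (linear_form c) (emb (?y * fl)) \<in> zsub (ideal_mod I) \<zeta> 2" for c
  proof (rule tameD[OF tame_I])
    have subN: "fm.subspace (ideal_mod I)" using gsub_ideal_mod[OF hideal_I] by (simp add: gsub_def)
    show "smul (linear_form c) (emb (?y * fl)) \<in> ideal_mod I"
      by (intro fm.subspace_scale[OF subN] emb_ideal_mod yI)
    show "homog (\<lambda>_. 0) (Suc (card A)) (smul (linear_form c) (emb (?y * fl)))"
      by (intro homog_smul_form homog_emb deg)
    have "emb (?y * fl) = (0 + smul ?z0 (emb (- (const_poly t * fl)))) + smul ?z1 (emb fl)"
      unfolding y by (auto simp: fun_eq_iff emb_def algebra_simps)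
    also have "\<dots> \<in> zsub (free_mod 1) \<zeta> 2"
      using zsub_SucI[OF zsub_SucI[of 0 "free_mod 1" \<zeta> 0, OF _ emb_free_mod] emb_free_mod, of "- (const_poly t * fl)" fl]
      by (simp only: two zsub.simps(1) singleton_iff One_nat_def)
    finally show "smul (linear_form c) (emb (?y * fl)) \<in> zsub (free_mod 1) \<zeta> 2"
      by (rule fm.subspace_scale[OF subspace_zsub[OF subspace_free_mod]])
  qed (use card_v in auto)
  ultimately show ?thesis
    unfolding socle_def using emb_ideal_mod[OF yI] homog_emb[OF deg] by blast
qed

lemma regularity_I: "has_regularity I (int (card A))"
  by (rule has_regularityI[OF hideal_I tame_I socle_I]) (use card_v in simp)

end

section \<open>The Hilbert function\<close>

interpretation pv: vector_space "\<lambda>c p. const_poly c * (p :: ('v::finite, 'k::field) mpoly)"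
  by standard (auto simp: const_poly_add const_poly_mult algebra_simps)

declare pv.scale_scale [simp del]

lemma graded_piece_subset_span:
  "graded_piece j \<subseteq> pv.span ((\<lambda>m. Poly_Mapping.single m (1::'k::field)) ` {m :: 'v::finite \<Rightarrow>\<^sub>0 nat. mdeg m = j})"
    (is "_ \<subseteq> pv.span ?E")
proof
  fix p :: "('v, 'k) mpoly" assume p: "p \<in> graded_piece j"
  have "p = (\<Sum>m\<in>Poly_Mapping.keys p. const_poly (Poly_Mapping.lookup p m) * Poly_Mapping.single m 1)"
    using mpoly_sum_singles[of p] by (simp add: const_poly_mult_single)
  also have "\<dots> \<in> pv.span ?E"
    using p by (intro pv.span_sum pv.span_scale pv.span_base) (auto simp: graded_piece_def)
  finally show "p \<in> pv.span ?E" .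
qed

lemma subspace_graded_part: "rm.subspace J \<Longrightarrow> pv.subspace (J \<inter> graded_piece j)"
  by (rule pv.subspaceI)
    (auto simp: rm.subspace_0 intro: rm.subspace_add rm.subspace_scale graded_add graded_const_mult)

lemma graded_independent_finite:
  assumes "C \<subseteq> graded_piece j" "pv.independent C"
  shows "finite C"
proof -
  have "finite ((\<lambda>m. Poly_Mapping.single m (1::'b)) ` {m :: 'a \<Rightarrow>\<^sub>0 nat. mdeg m = j})"
    by (intro finite_imageI finite_mdeg)
  then show ?thesis
    using pv.independent_span_bound[OF _ assms(2)] assms(1) graded_piece_subset_span[of j] by blast
qed

text \<open>Uniqueness of the coefficients at the polynomial 0 is independence modulo
  \<open>J\<close>, so \<open>B\<close> and a basis of the degree \<open>j\<close> part of
  \<open>J\<close> form a basis of the graded piece. Hence all quotient bases have the same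
  cardinality, and the choice inside \<open>hilbert_function\<close> is harmless.\<close>

lemma quotient_basis_card:
  fixes J :: "('v::finite, 'k::field) mpoly set"
  assumes J: "rm.subspace J" and B: "quotient_basis J j B"
  shows "card B + pv.dim (J \<inter> graded_piece j) = pv.dim (graded_piece j :: ('v, 'k) mpoly set)"
proof -
  have finB: "finite B" and BS: "B \<subseteq> graded_piece j"
    and ex: "\<And>p. p \<in> graded_piece j \<Longrightarrow> \<exists>c. (\<forall>b. b \<notin> B \<longrightarrow> c b = 0) \<and> p - (\<Sum>b\<in>B. const_poly (c b) * b) \<in> J"
    and uniq: "\<And>c. \<lbrakk>\<And>b. b \<notin> B \<Longrightarrow> c b = 0; - (\<Sum>b\<in>B. const_poly (c b) * b) \<in> J\<rbrakk> \<Longrightarrow> c = (\<lambda>_. 0)"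
  proof -
    show "finite B" "B \<subseteq> graded_piece j" using B by (auto simp: quotient_basis_def)
    show "\<exists>c. (\<forall>b. b \<notin> B \<longrightarrow> c b = 0) \<and> p - (\<Sum>b\<in>B. const_poly (c b) * b) \<in> J"
      if "p \<in> graded_piece j" for p using B that unfolding quotient_basis_def by blast
    fix c assume c: "\<And>b. b \<notin> B \<Longrightarrow> c b = 0" "- (\<Sum>b\<in>B. const_poly (c b) * b) \<in> J"
    define Z where "Z c \<longleftrightarrow> (\<forall>b. b \<notin> B \<longrightarrow> c b = 0) \<and> 0 - (\<Sum>b\<in>B. const_poly (c b) * b) \<in> J" for c
    have "\<exists>!c. Z c"
      using B graded_0 unfolding quotient_basis_def Z_def by blast
    moreover have "Z c" using c by (simp add: Z_def)
    moreover have "Z (\<lambda>_. 0)" using rm.subspace_0[OF J] by (simp add: Z_def)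
    ultimately show "c = (\<lambda>_. 0)" by blast
  qed
  obtain C where C: "C \<subseteq> J \<inter> graded_piece j" "pv.independent C" "J \<inter> graded_piece j \<subseteq> pv.span C"
      "card C = pv.dim (J \<inter> graded_piece j)"
    using pv.basis_exists by blast
  have finC: "finite C" using C graded_independent_finite by blast
  have inJ: "(\<Sum>x\<in>C. const_poly (g x) * x) \<in> J" for g
    using C(1) by (intro rm.subspace_sum[OF J] rm.subspace_scale[OF J]) auto
  have disj: "B \<inter> C = {}"
  proof (rule ccontr)
    assume "B \<inter> C \<noteq> {}"
    then obtain b where b: "b \<in> B" "b \<in> C" by blast
    have eq: "(\<Sum>x\<in>B. const_poly (if x = b then 1 else 0) * x) = b"
      using finB b(1) by (simp add: if_distrib[of const_poly] if_distrib[of "\<lambda>t. t * _"] cong: if_cong)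
    have "b \<in> J" using b(2) C(1) by blast
    then have "- (\<Sum>x\<in>B. const_poly (if x = b then 1 else 0 :: 'k) * x) \<in> J"
      unfolding eq by (rule rm.subspace_neg[OF J])
    then have "(\<lambda>x. if x = b then 1 else 0 :: 'k) = (\<lambda>_. 0)" using b(1) by (intro uniq) auto
    from fun_cong[OF this, of b] show False by simp
  qed
  have "pv.independent (B \<union> C)"
  proof (rule pv.independent_if_scalars_zero)
    show "finite (B \<union> C)" using finB finC by simp
    fix g x assume sum: "(\<Sum>x\<in>B \<union> C. const_poly (g x) * x) = 0" and x: "x \<in> B \<union> C"
    have split: "(\<Sum>x\<in>B. const_poly (g x) * x) + (\<Sum>x\<in>C. const_poly (g x) * x) = 0"
      using sum finB finC disj by (simp add: sum.union_disjoint)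
    define c where "c b = (if b \<in> B then g b else 0)" for b
    have "- (\<Sum>b\<in>B. const_poly (c b) * b) = (\<Sum>x\<in>C. const_poly (g x) * x)"
      using split by (simp add: c_def add_eq_0_iff)
    then have "c = (\<lambda>_. 0)" using inJ by (intro uniq) (auto simp: c_def)
    then have gB: "g b = 0" if "b \<in> B" for b using that by (metis c_def)
    then have "(\<Sum>x\<in>C. const_poly (g x) * x) = 0" using split by simp
    then have "g b = 0" if "b \<in> C" for b
      using pv.independentD[OF C(2) finC subset_refl] that by blast
    with gB x show "g x = 0" by blast
  qed
  moreover have "graded_piece j \<subseteq> pv.span (B \<union> C)"
  proof
    fix p :: "('v, 'k) mpoly" assume p: "p \<in> graded_piece j"
    then obtain c where c: "p - (\<Sum>b\<in>B. const_poly (c b) * b) \<in> J" using ex by blast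
    have sumB: "(\<Sum>b\<in>B. const_poly (c b) * b) \<in> graded_piece j"
      using BS by (intro graded_sum graded_const_mult) auto
    have "p - (\<Sum>b\<in>B. const_poly (c b) * b) \<in> pv.span (B \<union> C)"
      using c p sumB C(3) graded_diff pv.span_mono[of C "B \<union> C"] by blast
    moreover have "(\<Sum>b\<in>B. const_poly (c b) * b) \<in> pv.span (B \<union> C)"
      by (intro pv.span_sum pv.span_scale pv.span_base) auto
    ultimately have "(p - (\<Sum>b\<in>B. const_poly (c b) * b)) + (\<Sum>b\<in>B. const_poly (c b) * b) \<in> pv.span (B \<union> C)"
      by (rule pv.span_add)
    then show "p \<in> pv.span (B \<union> C)" by simp
  qed
  ultimately have "card (B \<union> C) = pv.dim (graded_piece j :: ('v, 'k) mpoly set)"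
    using BS C(1) by (intro pv.basis_card_eq_dim) auto
  then show ?thesis using C(4) card_Un_disjoint[OF finB finC disj] by simp
qed

text \<open>A basis of the degree \<open>j\<close> part of \<open>J\<close> is extended to one of
  the graded piece; the added vectors represent the quotient.\<close>

lemma quotient_basis_exists:
  fixes J :: "('v::finite, 'k::field) mpoly set"
  assumes J: "rm.subspace J"
  shows "\<exists>B. quotient_basis J j B"
proof -
  obtain C where C: "C \<subseteq> J \<inter> graded_piece j" "pv.independent C" "J \<inter> graded_piece j \<subseteq> pv.span C"
    using pv.maximal_independent_subset by blast
  then obtain D where D: "C \<subseteq> D" "D \<subseteq> graded_piece j" "pv.independent D" "graded_piece j \<subseteq> pv.span D"
    using pv.maximal_independent_subset_extend[of C "graded_piece j"] by blast
  have finD: "finite D" using D graded_independent_finite by blast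
  have finC: "finite C" using finD D(1) finite_subset by blast
  define B where "B = D - C"
  have finB: "finite B" and BS: "B \<subseteq> graded_piece j" and DBC: "D = B \<union> C" and disj: "B \<inter> C = {}"
    using finD D by (auto simp: B_def)
  have "\<exists>!c. (\<forall>b. b \<notin> B \<longrightarrow> c b = 0) \<and> p - (\<Sum>b\<in>B. const_poly (c b) * b) \<in> J"
    if p: "p \<in> graded_piece j" for p
  proof (rule ex_ex1I)
    have "p \<in> pv.span D" using p D(4) by blast
    then obtain u where "p = (\<Sum>x\<in>D. const_poly (u x) * x)" using pv.span_finite[OF finD] by auto
    then have u: "p = (\<Sum>x\<in>B. const_poly (u x) * x) + (\<Sum>x\<in>C. const_poly (u x) * x)"
      by (simp only: DBC sum.union_disjoint[OF finB finC disj])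
    have "(\<Sum>x\<in>C. const_poly (u x) * x) \<in> J"
      using C(1) by (intro rm.subspace_sum[OF J] rm.subspace_scale[OF J]) auto
    moreover have "(\<Sum>b\<in>B. const_poly (if b \<in> B then u b else 0) * b) = (\<Sum>b\<in>B. const_poly (u b) * b)"
      by (rule sum.cong) auto
    ultimately show "\<exists>c. (\<forall>b. b \<notin> B \<longrightarrow> c b = 0) \<and> p - (\<Sum>b\<in>B. const_poly (c b) * b) \<in> J"
      by (intro exI[of _ "\<lambda>b. if b \<in> B then u b else 0"]) (simp add: u)
  next
    fix c c'
    assume c: "(\<forall>b. b \<notin> B \<longrightarrow> c b = 0) \<and> p - (\<Sum>b\<in>B. const_poly (c b) * b) \<in> J"
      and c': "(\<forall>b. b \<notin> B \<longrightarrow> c' b = 0) \<and> p - (\<Sum>b\<in>B. const_poly (c' b) * b) \<in> J"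
    let ?s = "\<Sum>b\<in>B. const_poly (c' b - c b) * b"
    have "?s = (p - (\<Sum>b\<in>B. const_poly (c b) * b)) - (p - (\<Sum>b\<in>B. const_poly (c' b) * b))"
      by (simp add: const_poly_diff left_diff_distrib sum_subtractf)
    also have "\<dots> \<in> J" by (rule rm.subspace_diff[OF J conjunct2[OF c] conjunct2[OF c']])
    finally have "?s \<in> J" .
    moreover have "?s \<in> graded_piece j"
      using BS by (intro graded_sum graded_const_mult) auto
    ultimately have "?s \<in> pv.span C" using C(3) by blast
    then obtain v where v: "?s = (\<Sum>x\<in>C. const_poly (v x) * x)" using pv.span_finite[OF finC] by auto
    define g where "g x = (if x \<in> B then c' x - c x else - v x)" for x
    have "(\<Sum>x\<in>D. const_poly (g x) * x) = (\<Sum>x\<in>B. const_poly (g x) * x) + (\<Sum>x\<in>C. const_poly (g x) * x)"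
      unfolding DBC by (rule sum.union_disjoint[OF finB finC disj])
    also have "(\<Sum>x\<in>B. const_poly (g x) * x) = ?s"
      by (rule sum.cong) (auto simp: g_def)
    also have "(\<Sum>x\<in>C. const_poly (g x) * x) = - (\<Sum>x\<in>C. const_poly (v x) * x)"
      unfolding sum_negf[symmetric]
      by (rule sum.cong) (use disj in \<open>auto simp: g_def const_poly_uminus\<close>)
    finally have "(\<Sum>x\<in>D. const_poly (g x) * x) = 0" by (simp add: v)
    then have g0: "g x = 0" if "x \<in> D" for x
      using pv.independentD[OF D(3) finD subset_refl] that by blast
    have "c x = c' x" if "x \<in> B" for x
      using g0[of x] that by (simp add: g_def DBC)
    then show "c = c'" using c c' by (intro ext) metis
  qed
  then have "quotient_basis J j B" using finB BS by (simp add: quotient_basis_def)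
  then show ?thesis ..
qed

lemma hilbert_function_add_dim:
  fixes J :: "('v::finite, 'k::field) mpoly set"
  assumes "rm.subspace J"
  shows "hilbert_function J j + pv.dim (J \<inter> graded_piece j) = pv.dim (graded_piece j :: ('v, 'k) mpoly set)"
  unfolding hilbert_function_def
  by (rule quotient_basis_card[OF assms someI_ex[OF quotient_basis_exists[OF assms]]])

section \<open>Hilbert function and generators of the intersection ideal and the residual\<close>

context flagged_forms
begin

lemma hilbert_low:
  assumes "j + 1 < card A"
  shows "hilbert_function I j = hilbert_function (R A) j"
proof -
  have "I \<inter> graded_piece j = R A \<inter> graded_piece j"
    using in_I_iff R_low_degree_vanishes[OF _ _ assms] by blast
  then show ?thesis
    using hilbert_function_add_dim[OF subspace_I, of j] hilbert_function_add_dim[OF subspace_R, of A j] by simp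
qed

text \<open>Evaluation at \<open>a\<close> is a nonzero functional on the degree \<open>j\<close>
  part of \<open>R A\<close>, with \<open>q\<close> as witness, and its kernel is that of
  \<open>I\<close>; so the dimensions differ by exactly one.\<close>

lemma hilbert_high:
  assumes "card A \<le> j + 1"
  shows "hilbert_function I j = hilbert_function (R A) j + 1"
proof -
  define q where "q = linear_form (\<zeta> 0) ^ (j + 1 - card A) * fl"
  have "j + 1 - card A + (card A - 1) = j" using assms card_A by simp
  then have q: "q \<in> graded_piece j" unfolding q_def
    using graded_mult[OF graded_power[OF linear_form_in_graded[of "\<zeta> 0"], of "j + 1 - card A"] fl_graded]
    by simp
  have qR: "q \<in> R A" unfolding q_def by (intro rm.subspace_scale[OF subspace_R] fl_in_R)
  have "eval_poly q a \<noteq> 0"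
    using dot_\<zeta> eval_fl by (simp add: q_def eval_poly_mult eval_poly_power eval_linear_form dot_def)
  then have qI: "q \<notin> I" using eval_I by blast
  obtain C where C: "C \<subseteq> I \<inter> graded_piece j" "pv.independent C" "I \<inter> graded_piece j \<subseteq> pv.span C"
      "card C = pv.dim (I \<inter> graded_piece j)"
    using pv.basis_exists by blast
  have finC: "finite C" using C graded_independent_finite by blast
  have "pv.span C \<subseteq> I \<inter> graded_piece j"
    by (rule pv.span_minimal[OF C(1) subspace_graded_part[OF subspace_I]])
  then have qC: "q \<notin> pv.span C" using qI by blast
  have "R A \<inter> graded_piece j \<subseteq> pv.span (insert q C)"
  proof
    fix p assume p: "p \<in> R A \<inter> graded_piece j"
    obtain t where t: "p - const_poly t * q \<in> I"
      unfolding q_def using R_mod_I[OF dot_\<zeta> _ _ assms, of p] p by blast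
    have "p - const_poly t * q \<in> graded_piece j" using p q by (intro graded_diff graded_const_mult) auto
    then have "p - const_poly t * q \<in> pv.span C" using t C(3) by blast
    then show "p \<in> pv.span (insert q C)" unfolding pv.span_breakdown_eq by blast
  qed
  moreover have "insert q C \<subseteq> R A \<inter> graded_piece j" using C(1) q qR by (auto simp: I_def)
  ultimately have "card (insert q C) = pv.dim (R A \<inter> graded_piece j)"
    using pv.independent_insertI[OF qC C(2)] by (intro pv.basis_card_eq_dim)
  moreover have "q \<notin> C" using qC pv.span_superset[of C] by blast
  ultimately have "pv.dim (R A \<inter> graded_piece j) = pv.dim (I \<inter> graded_piece j) + 1"
    using C(4) finC by simp
  then show ?thesis
    using hilbert_function_add_dim[OF subspace_I, of j] hilbert_function_add_dim[OF subspace_R, of A j] by simp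
qed

text \<open>The augmentation of the resolution already constructed supplies finitely many
  homogeneous generators.\<close>

lemma I_finitely_generated:
  obtains X where "finite X" "\<forall>g\<in>X. \<exists>d. g \<in> graded_piece d" "rm.span X = I"
proof -
  obtain b :: "nat \<Rightarrow> nat" and s :: "nat \<Rightarrow> nat \<Rightarrow> int" and g M
    where res: "minimal_graded_free_resolution I b s g M"
    using regularity_I unfolding has_regularity_def by blast
  have deg: "\<forall>j<b 0. \<forall>m\<in>Poly_Mapping.keys (g j). int (mdeg m) = s 0 j"
    and im: "(\<lambda>v. \<Sum>j<b 0. g j * v j) ` free_mod (b 0) = I"
    using res unfolding minimal_graded_free_resolution_def by - (elim conjE, assumption)+
  let ?X = "g ` {..<b 0}"
  have "g j \<in> graded_piece (nat (s 0 j))" if "j < b 0" for j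
    unfolding graded_piece_def
  proof (intro CollectI ballI)
    fix m assume "m \<in> Poly_Mapping.keys (g j)"
    from deg[rule_format, OF that this] show "mdeg m = nat (s 0 j)" by linarith
  qed
  moreover have "rm.span ?X = I"
  proof
    show "rm.span ?X \<subseteq> I"
    proof (rule rm.span_minimal[OF _ subspace_I])
      show "?X \<subseteq> I"
      proof
        fix x assume "x \<in> ?X"
        then obtain i where i: "x = g i" "i < b 0" by blast
        have "x = (\<Sum>j<b 0. g j * (if j = i then 1 else 0))"
          using i by (simp add: if_distrib[of "\<lambda>t. _ * t"] cong: if_cong)
        moreover have "(\<lambda>j. if j = i then 1 else 0 :: ('v, 'k) mpoly) \<in> free_mod (b 0)"
          using i by (simp add: free_mod_def)
        ultimately show "x \<in> I"
          unfolding im[symmetric] by (rule image_eqI[of _ "\<lambda>v. \<Sum>j<b 0. g j * v j"])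
      qed
    qed
    show "I \<subseteq> rm.span ?X"
      unfolding im[symmetric]
    proof (intro image_subsetI rm.span_sum)
      fix v :: "nat \<Rightarrow> ('v, 'k) mpoly" and j assume "j \<in> {..<b 0}"
      then have "v j * g j \<in> rm.span ?X" by (intro rm.span_scale rm.span_base) simp
      then show "g j * v j \<in> rm.span ?X" by (simp add: mult.commute)
    qed
  qed
  ultimately show thesis by (intro that[of ?X]) auto
qed

lemma minimal_generators_R:
  "\<exists>G. minimal_generating_set G (R A) \<and> fl \<in> G"
proof -
  obtain X0 where X0: "finite X0" "\<forall>g\<in>X0. \<exists>d. g \<in> graded_piece d" "rm.span X0 = I"
    by (rule I_finitely_generated)
  define Gen where "Gen X \<longleftrightarrow> X \<subseteq> X0 \<and> rm.span (insert fl X) = R A" for X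
  have "X0 \<subseteq> I" using X0(3) rm.span_superset by blast
  have "rm.span (insert fl X0) = R A"
  proof
    show "rm.span (insert fl X0) \<subseteq> R A"
      using \<open>X0 \<subseteq> I\<close> fl_in_R by (intro rm.span_minimal subspace_R) (auto simp: I_def)
    have "I \<union> {fl} \<subseteq> rm.span (insert fl X0)"
      using X0(3) rm.span_mono[of X0 "insert fl X0"] rm.span_base[of fl "insert fl X0"] by auto
    then show "R A \<subseteq> rm.span (insert fl X0)"
      unfolding span_I_fl[OF dot_\<zeta>, symmetric] by (rule rm.span_minimal) (rule rm.subspace_span)
  qed
  then have "Gen X0" by (simp add: Gen_def)
  from ex_has_least_nat[of Gen, OF this, of card]
  obtain X where X: "Gen X" and least: "\<And>X'. Gen X' \<Longrightarrow> card X \<le> card X'" by blast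
  have XI: "X \<subseteq> I" and finX: "finite X" and XX0: "X \<subseteq> X0"
    using X \<open>X0 \<subseteq> I\<close> X0(1) finite_subset by (auto simp: Gen_def)
  have flI: "fl \<notin> I" using eval_I eval_fl by blast
  have "rm.span G' \<noteq> R A" if G': "G' \<subset> insert fl X" for G'
  proof (cases "fl \<in> G'")
    case True
    then have sub: "G' - {fl} \<subset> X" using G' XI flI by blast
    then have "card (G' - {fl}) < card X" using finX by (intro psubset_card_mono)
    then have "\<not> Gen (G' - {fl})" using least by (meson leD)
    moreover have "insert fl (G' - {fl}) = G'" using True by blast
    ultimately show ?thesis using sub XX0 by (auto simp: Gen_def)
  next
    case False
    then have "G' \<subseteq> I" using G' XI by blast
    then have "rm.span G' \<subseteq> I" by (rule rm.span_minimal[OF _ subspace_I])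
    then show ?thesis using flI fl_in_R by blast
  qed
  moreover have "\<forall>g\<in>insert fl X. \<exists>d. g \<in> graded_piece d"
    using X0(2) XX0 fl_graded by blast
  ultimately have "minimal_generating_set (insert fl X) (R A)"
    using X unfolding minimal_generating_set_def ideal_gen_eq Gen_def by blast
  then show ?thesis by blast
qed

end

section \<open>The open set of linear forms and the conclusion\<close>

theorem proposition5p4:
  fixes n :: nat
    and A :: "('v::finite \<Rightarrow> 'k::field_char_0) set set"
    and L :: "('v \<Rightarrow> 'k) set \<Rightarrow> 'v \<Rightarrow> 'k"
  assumes "n \<ge> 2"
    and "CARD('v) = n + 1"
    and "hyperplane_arrangement A"
    and "defining_forms A L"
  shows "\<exists>U. zariski_open U \<and> U \<noteq> {} \<and>
    (\<forall>l\<in>U. l \<noteq> (\<lambda>_. 0) \<and>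
      (let f = arrangement_poly A L;
           r = residual f l;
           I = r \<inter> point_ideal l
       in (\<exists>G. minimal_generating_set G r \<and> deriv_along l f \<in> G) \<and>
          r = ideal_gen (I \<union> {deriv_along l f}) \<and>
          (\<forall>j::nat.
             (int j \<le> int (card A) - 2 \<longrightarrow> hilbert_function I j = hilbert_function r j) \<and>
             (int j \<ge> int (card A) - 1 \<longrightarrow> hilbert_function I j = hilbert_function r j + 1)) \<and>
          has_regularity I (int (card A))))"
proof -
  have finA: "finite A" and neA: "A \<noteq> {}"
    using assms(3) by (auto simp: hyperplane_arrangement_def)
  have L0: "L H \<noteq> (\<lambda>_. 0)" and HL: "H = hyperplane (L H)" if "H \<in> A" for H
    using assms(4) that by (auto simp: defining_forms_def)
  let ?f = "arrangement_poly A L"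
  define U where "U = {l. eval_poly ?f l \<noteq> 0}"
  have U_iff: "l \<in> U \<longleftrightarrow> (\<forall>H\<in>A. dot (L H) l \<noteq> 0)" for l
    using finA by (simp add: U_def arrangement_poly_def eval_poly_prod eval_linear_form dot_def)
  have indep: "\<exists>w. dot (L H) w = 1 \<and> dot (L H') w = 0" if H: "H \<in> A" "H' \<in> A" "H \<noteq> H'" for H H'
  proof -
    \<comment> \<open>Proportional nonzero forms cut out the same hyperplane.\<close>
    have "L H \<notin> fv.span {L H'}"
    proof
      assume "L H \<in> fv.span {L H'}"
      then obtain c where c: "L H = (\<lambda>i. c * L H' i)" by (auto simp: fv.span_singleton)
      with L0[OF H(1)] have "c \<noteq> 0" by auto
      then have "hyperplane (L H) = hyperplane (L H')"
        unfolding c hyperplane_def by (simp add: mult.assoc sum_distrib_left[symmetric])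
      with HL[OF H(1)] HL[OF H(2)] H(3) show False by simp
    qed
    then obtain w where "\<And>x. x \<in> {L H'} \<Longrightarrow> dot x w = 0" "dot (L H) w = 1"
      by (rule exists_dual_vector) blast
    then show ?thesis by auto
  qed
  have "zariski_open U"
    unfolding zariski_open_def U_def by (intro exI[of _ "{?f}"]) simp
  moreover have "U \<noteq> {}"
  proof -
    have "(\<lambda>_. 0) \<notin> L ` A" using L0 by force
    then obtain z where "\<forall>w\<in>L ` A. dot z w \<noteq> 0" using exists_dot_nonzero[of "L ` A"] finA by blast
    then have "z \<in> U" unfolding U_iff by (simp add: dot_def mult.commute)
    then show ?thesis by blast
  qed
  moreover have "l \<noteq> (\<lambda>_. 0) \<and>
      (let f = arrangement_poly A L;
           r = residual f l;
           I = r \<inter> point_ideal l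
       in (\<exists>G. minimal_generating_set G r \<and> deriv_along l f \<in> G) \<and>
          r = ideal_gen (I \<union> {deriv_along l f}) \<and>
          (\<forall>j::nat.
             (int j \<le> int (card A) - 2 \<longrightarrow> hilbert_function I j = hilbert_function r j) \<and>
             (int j \<ge> int (card A) - 1 \<longrightarrow> hilbert_function I j = hilbert_function r j + 1)) \<and>
          has_regularity I (int (card A)))" if l: "l \<in> U" for l
  proof -
    have l0: "l \<noteq> (\<lambda>_. 0)" using l neA unfolding U_iff by auto
    have card3: "3 \<le> CARD('v)" using assms(1,2) by simp
    \<comment> \<open>The flag is made transversal to all subarrangements at once, because the
      deletion induction may meet any of them.\<close>
    have "finite ((\<lambda>B. L ` B) ` Pow A)" using finA by simp
    moreover have "{} \<in> (\<lambda>B. L ` B) ` Pow A" by force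
    ultimately obtain \<zeta> where \<zeta>: "\<And>i. dot (\<zeta> i) l \<noteq> 0"
      "\<And>B i. B \<in> (\<lambda>B. L ` B) ` Pow A \<Longrightarrow> fv.span (B \<union> \<zeta> ` {..<i}) = UNIV \<or>
         (\<exists>w. (\<forall>b\<in>B. dot b w = 0) \<and> (\<forall>j<i. dot (\<zeta> j) w = 0) \<and> dot (\<zeta> i) w = 1)"
      "fv.span (\<zeta> ` {..<CARD('v)}) = UNIV"
      using exists_transversal_flag[OF _ _ l0] by metis
    interpret flagged_forms A L l \<zeta>
    proof
      fix i assume "i < CARD('v)"
      then have "fv.span (\<zeta> ` {..<i}) \<noteq> UNIV"
        using card_image_le[of "{..<i}" \<zeta>] by (intro span_neq_UNIV) auto
      then show "\<exists>w. (\<forall>j<i. dot (\<zeta> j) w = 0) \<and> dot (\<zeta> i) w = 1"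
        using \<zeta>(2)[of "{}" i] by force
    next
      show "dot (L H) l \<noteq> 0" if "H \<in> A" for H using l that unfolding U_iff by blast
    next
      fix B i assume "B \<subseteq> A"
      then have "L ` B \<in> (\<lambda>B. L ` B) ` Pow A" by blast
      from \<zeta>(2)[OF this, of i]
      show "fv.span (L ` B \<union> \<zeta> ` {..<i}) = UNIV \<or>
        (\<exists>w. (\<forall>b\<in>L ` B. dot b w = 0) \<and> (\<forall>j<i. dot (\<zeta> j) w = 0) \<and> dot (\<zeta> i) w = 1)" .
    qed (fact finA neA indep \<zeta>(1,3) card3)+
    have f: "arrangement_poly A L = f" by (simp add: arrangement_poly_def f_def)
    have I: "R A \<inter> point_ideal l = I" by (simp add: I_def)
    have low: "hilbert_function I j = hilbert_function (R A) j" if "int j \<le> int (card A) - 2" for j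
      using that by (intro hilbert_low) linarith
    have high: "hilbert_function I j = hilbert_function (R A) j + 1" if "int j \<ge> int (card A) - 1" for j
      using that by (intro hilbert_high) linarith
    show ?thesis
      unfolding f residual_eq_R Let_def I ideal_gen_eq span_I_fl[OF dot_\<zeta>]
      using l0 minimal_generators_R low high regularity_I by blast
  qed
  ultimately show ?thesis by blast
qed

end
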